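(* Let $A$ be an algebra with finite dominant dimension $n := \mathrm{domdim}(A) \geq 2$ and with Gorenstein dimension $\mathrm{Gdim}(A) = \mathrm{domdim}(A)$. Let $0 \to A \to I_0 \to I_1 \to \cdots$ be a minimal injective resolution of the regular right module $A$. Then $B := \mathrm{End}_A(I_0 \oplus \Omega^{-n}(A))$ has dominant dimension $n$.
   Context: All algebras $A$ are finite dimensional, basic, connected, non-semisimple algebras over a field $K$ (endomorphism algebras constructed from such $A$ need not be basic or connected), and all modules are finite dimensional right modules. Dominant dimension: let $0 \to M \to I_0 \to I_1 \to \cdots$ be a minimal injective resolution of a module $M$. Then $\mathrm{domdim}(M) = 0$ if $I_0$ is not projective, and otherwise $\mathrm{domdim}(M) = \sup\{ n \mid I_i \text{ is projective for } i = 0,1,\dots,n\} + 1$. The dominant dimension of an algebra is the dominant dimension of its regular right module. Gorenstein dimension: let $D = \mathrm{Hom}_K(-,K)$. An algebra $A$ is Gorenstein if $\mathrm{injdim}(A) = \mathrm{projdim}(D(A)) < \infty$; then $\mathrm{Gdim}(A)$ is this common value. If $\mathrm{injdim}(A) = \infty$, then $\mathrm{Gdim}(A) = \infty$. $\Omega^{-n}(A)$ denotes the $n$-th cosyzygy of $A$, i.e. the cokernel of $I_{n-2} \to I_{n-1}$ in the minimal injective resolution of $A$. *)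

theory Defs
  imports
    "Jordan_Normal_Form.Missing_VectorSpace"
    "HOL-Algebra.Ideal"
    "HOL-Library.Extended_Nat"
begin

section \<open>Finite dimensional algebras and right modules\<close>

text \<open>
  An algebra over the field \<open>K\<close> is a ring \<open>A\<close> (not necessarily commutative) that also carries a
  scalar multiplication by \<open>K\<close>; the locale \<open>algebra\<close> of \<open>HOL-Algebra\<close> covers only commutative ones.
\<close>

locale fd_algebra = vectorspace K A + A: ring A
  for K :: "'k ring" and A :: "('k, 'a) module" +
  assumes fin_dim_algebra: "fin_dim"
    and smult_mult_left:
      "\<lbrakk>c \<in> carrier K; x \<in> carrier A; y \<in> carrier A\<rbrakk>
        \<Longrightarrow> (c \<odot>\<^bsub>A\<^esub> x) \<otimes>\<^bsub>A\<^esub> y = c \<odot>\<^bsub>A\<^esub> (x \<otimes>\<^bsub>A\<^esub> y)"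
    and smult_mult_right:
      "\<lbrakk>c \<in> carrier K; x \<in> carrier A; y \<in> carrier A\<rbrakk>
        \<Longrightarrow> x \<otimes>\<^bsub>A\<^esub> (c \<odot>\<^bsub>A\<^esub> y) = c \<odot>\<^bsub>A\<^esub> (x \<otimes>\<^bsub>A\<^esub> y)"

text \<open>
  The fields \<open>mult\<close> and \<open>one\<close> that a module record inherits from rings carry no meaning for modules.
\<close>

record ('k, 'a, 'm) rmodule = "('k, 'm) module" +
  ract :: "'m \<Rightarrow> 'a \<Rightarrow> 'm" (infixl \<open>\<cdot>\<index>\<close> 70)

text \<open>
  The \<open>K\<close>-structure of a right \<open>A\<close>-module \<open>M\<close> is determined by the action, since
  \<open>c \<odot> m = m \<cdot> (c \<odot> 1)\<close>; it is part of the record so that the notions for vector spaces apply.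
\<close>

locale fd_right_module = vectorspace K M
  for K :: "'k ring" and A :: "('k, 'a) module" and M :: "('k, 'a, 'm) rmodule" +
  assumes fd_algebra: "fd_algebra K A"
    and fin_dim_module: "fin_dim"
    and ract_closed:
      "\<lbrakk>m \<in> carrier M; a \<in> carrier A\<rbrakk> \<Longrightarrow> m \<cdot>\<^bsub>M\<^esub> a \<in> carrier M"
    and ract_add_left:
      "\<lbrakk>m \<in> carrier M; m' \<in> carrier M; a \<in> carrier A\<rbrakk>
        \<Longrightarrow> (m \<oplus>\<^bsub>M\<^esub> m') \<cdot>\<^bsub>M\<^esub> a = m \<cdot>\<^bsub>M\<^esub> a \<oplus>\<^bsub>M\<^esub> m' \<cdot>\<^bsub>M\<^esub> a"
    and ract_add_right:
      "\<lbrakk>m \<in> carrier M; a \<in> carrier A; b \<in> carrier A\<rbrakk>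
        \<Longrightarrow> m \<cdot>\<^bsub>M\<^esub> (a \<oplus>\<^bsub>A\<^esub> b) = m \<cdot>\<^bsub>M\<^esub> a \<oplus>\<^bsub>M\<^esub> m \<cdot>\<^bsub>M\<^esub> b"
    and ract_mult:
      "\<lbrakk>m \<in> carrier M; a \<in> carrier A; b \<in> carrier A\<rbrakk>
        \<Longrightarrow> m \<cdot>\<^bsub>M\<^esub> (a \<otimes>\<^bsub>A\<^esub> b) = (m \<cdot>\<^bsub>M\<^esub> a) \<cdot>\<^bsub>M\<^esub> b"
    and ract_one:
      "m \<in> carrier M \<Longrightarrow> m \<cdot>\<^bsub>M\<^esub> \<one>\<^bsub>A\<^esub> = m"
    and ract_smult:
      "\<lbrakk>c \<in> carrier K; m \<in> carrier M; a \<in> carrier A\<rbrakk>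
        \<Longrightarrow> m \<cdot>\<^bsub>M\<^esub> (c \<odot>\<^bsub>A\<^esub> a) = c \<odot>\<^bsub>M\<^esub> (m \<cdot>\<^bsub>M\<^esub> a)"
    and smult_ract:
      "\<lbrakk>c \<in> carrier K; m \<in> carrier M; a \<in> carrier A\<rbrakk>
        \<Longrightarrow> (c \<odot>\<^bsub>M\<^esub> m) \<cdot>\<^bsub>M\<^esub> a = c \<odot>\<^bsub>M\<^esub> (m \<cdot>\<^bsub>M\<^esub> a)"

definition rmod_hom ::
    "'k ring \<Rightarrow> ('k, 'a) module \<Rightarrow> ('k, 'a, 'm) rmodule \<Rightarrow> ('k, 'a, 'n) rmodule \<Rightarrow> ('m \<Rightarrow> 'n) set"
  where "rmod_hom K A M N =
    {f \<in> LinearCombinations.module_hom K M N. \<forall>m\<in>carrier M. \<forall>a\<in>carrier A. f (m \<cdot>\<^bsub>M\<^esub> a) = f m \<cdot>\<^bsub>N\<^esub> a}"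

definition rmod_iso ::
    "'k ring \<Rightarrow> ('k, 'a) module \<Rightarrow> ('k, 'a, 'm) rmodule \<Rightarrow> ('k, 'a, 'n) rmodule \<Rightarrow> bool"
  where "rmod_iso K A M N \<longleftrightarrow> (\<exists>f\<in>rmod_hom K A M N. bij_betw f (carrier M) (carrier N))"

definition rmod_ker :: "('k, 'a, 'm) rmodule \<Rightarrow> ('k, 'a, 'n) rmodule \<Rightarrow> ('m \<Rightarrow> 'n) \<Rightarrow> 'm set"
  where "rmod_ker M N f = {x \<in> carrier M. f x = \<zero>\<^bsub>N\<^esub>}"

definition rsubmodule :: "'k ring \<Rightarrow> ('k, 'a) module \<Rightarrow> ('k, 'a, 'm) rmodule \<Rightarrow> 'm set \<Rightarrow> bool"
  where "rsubmodule K A M N \<longleftrightarrow>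
    LinearCombinations.submodule K N M \<and> (\<forall>x\<in>N. \<forall>a\<in>carrier A. x \<cdot>\<^bsub>M\<^esub> a \<in> N)"


section \<open>Constructions\<close>

definition regular_module :: "('k, 'a) module \<Rightarrow> ('k, 'a, 'a) rmodule"
  where "regular_module A =
    \<lparr>carrier = carrier A, mult = mult A, one = \<one>\<^bsub>A\<^esub>, zero = \<zero>\<^bsub>A\<^esub>, add = add A,
     smult = module.smult A, ract = mult A\<rparr>"

text \<open>
  \<open>D(A) = Hom\<^sub>K(A, K)\<close> for the left regular module \<open>A\<close>: a right module under
  \<open>(f \<cdot> a)(x) = f (a x)\<close>.
\<close>

definition dual_module :: "'k ring \<Rightarrow> ('k, 'a) module \<Rightarrow> ('k, 'a, 'a \<Rightarrow> 'k) rmodule"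
  where "dual_module K A =
    \<lparr>carrier = {f \<in> carrier A \<rightarrow>\<^sub>E carrier K.
        (\<forall>x\<in>carrier A. \<forall>y\<in>carrier A. f (x \<oplus>\<^bsub>A\<^esub> y) = f x \<oplus>\<^bsub>K\<^esub> f y) \<and>
        (\<forall>c\<in>carrier K. \<forall>x\<in>carrier A. f (c \<odot>\<^bsub>A\<^esub> x) = c \<otimes>\<^bsub>K\<^esub> f x)},
     mult = undefined, one = undefined,
     zero = (\<lambda>x\<in>carrier A. \<zero>\<^bsub>K\<^esub>),
     add = (\<lambda>f g. \<lambda>x\<in>carrier A. f x \<oplus>\<^bsub>K\<^esub> g x),
     smult = (\<lambda>c f. \<lambda>x\<in>carrier A. c \<otimes>\<^bsub>K\<^esub> f x),
     ract = (\<lambda>f a. \<lambda>x\<in>carrier A. f (a \<otimes>\<^bsub>A\<^esub> x))\<rparr>"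

definition rmod_sum ::
    "('k, 'a, 'm) rmodule \<Rightarrow> ('k, 'a, 'n) rmodule \<Rightarrow> ('k, 'a, 'm \<times> 'n) rmodule"
  where "rmod_sum M N =
    \<lparr>carrier = carrier M \<times> carrier N, mult = undefined, one = undefined,
     zero = (\<zero>\<^bsub>M\<^esub>, \<zero>\<^bsub>N\<^esub>),
     add = (\<lambda>(x, y) (x', y'). (x \<oplus>\<^bsub>M\<^esub> x', y \<oplus>\<^bsub>N\<^esub> y')),
     smult = (\<lambda>c (x, y). (c \<odot>\<^bsub>M\<^esub> x, c \<odot>\<^bsub>N\<^esub> y)),
     ract = (\<lambda>(x, y) a. (x \<cdot>\<^bsub>M\<^esub> a, y \<cdot>\<^bsub>N\<^esub> a))\<rparr>"

text \<open>
  The union over all representatives of the coset \<open>X\<close> is a union of identical cosets when \<open>N\<close> is a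
  submodule; no representative has to be chosen.
\<close>

definition rmod_quot :: "('k, 'a, 'm) rmodule \<Rightarrow> 'm set \<Rightarrow> ('k, 'a, 'm set) rmodule"
  where "rmod_quot M N =
    \<lparr>carrier = a_rcosets\<^bsub>M\<^esub> N, mult = undefined, one = undefined,
     zero = N,
     add = (\<lambda>X Y. X <+>\<^bsub>M\<^esub> Y),
     smult = (\<lambda>c X. \<Union>x\<in>X. N +>\<^bsub>M\<^esub> (c \<odot>\<^bsub>M\<^esub> x)),
     ract = (\<lambda>X a. \<Union>x\<in>X. N +>\<^bsub>M\<^esub> (x \<cdot>\<^bsub>M\<^esub> a))\<rparr>"

text \<open>
  Endomorphisms act on the left of a right module: \<open>(f g)(x) = f (g x)\<close>. Maps are normalised to be
  \<open>undefined\<close> outside the carrier, so that equality in the algebra is equality of endomorphisms.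
\<close>

definition End_algebra ::
    "'k ring \<Rightarrow> ('k, 'a) module \<Rightarrow> ('k, 'a, 'm) rmodule \<Rightarrow> ('k, 'm \<Rightarrow> 'm) module"
  where "End_algebra K A M =
    \<lparr>carrier = rmod_hom K A M M \<inter> extensional (carrier M),
     mult = (\<lambda>f g. compose (carrier M) f g),
     one = (\<lambda>x\<in>carrier M. x),
     zero = (\<lambda>x\<in>carrier M. \<zero>\<^bsub>M\<^esub>),
     add = (\<lambda>f g. \<lambda>x\<in>carrier M. f x \<oplus>\<^bsub>M\<^esub> g x),
     smult = (\<lambda>c f. \<lambda>x\<in>carrier M. c \<odot>\<^bsub>M\<^esub> f x)\<rparr>"


section \<open>Basic, connected and semisimple algebras\<close>

definition internal_direct_sum ::
    "'k ring \<Rightarrow> ('k, 'a) module \<Rightarrow> ('k, 'a, 'm) rmodule \<Rightarrow> (nat \<Rightarrow> 'm set) \<Rightarrow> nat \<Rightarrow> bool"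
  where "internal_direct_sum K A M S r \<longleftrightarrow>
    (\<forall>i<r. rsubmodule K A M (S i)) \<and>
    (\<forall>x\<in>carrier M. \<exists>!s. s \<in> (\<Pi>\<^sub>E i\<in>{..<r}. S i) \<and> x = finsum M s {..<r})"

definition simple_module :: "'k ring \<Rightarrow> ('k, 'a) module \<Rightarrow> ('k, 'a, 'm) rmodule \<Rightarrow> bool"
  where "simple_module K A M \<longleftrightarrow>
    carrier M \<noteq> {\<zero>\<^bsub>M\<^esub>} \<and> (\<forall>N. rsubmodule K A M N \<longrightarrow> N = {\<zero>\<^bsub>M\<^esub>} \<or> N = carrier M)"

definition indecomposable_module :: "'k ring \<Rightarrow> ('k, 'a) module \<Rightarrow> ('k, 'a, 'm) rmodule \<Rightarrow> bool"
  where "indecomposable_module K A M \<longleftrightarrow>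
    carrier M \<noteq> {\<zero>\<^bsub>M\<^esub>} \<and>
    (\<forall>N N'. rsubmodule K A M N \<and> rsubmodule K A M N' \<and>
       N \<inter> N' = {\<zero>\<^bsub>M\<^esub>} \<and> N <+>\<^bsub>M\<^esub> N' = carrier M \<longrightarrow> N = {\<zero>\<^bsub>M\<^esub>} \<or> N' = {\<zero>\<^bsub>M\<^esub>})"

definition semisimple_algebra :: "'k ring \<Rightarrow> ('k, 'a) module \<Rightarrow> bool"
  where "semisimple_algebra K A \<longleftrightarrow>
    (\<exists>S r. internal_direct_sum K A (regular_module A) S r \<and>
       (\<forall>i<r. simple_module K A ((regular_module A)\<lparr>carrier := S i\<rparr>)))"

text \<open>
  \<open>A = P\<^sub>0 \<oplus> \<dots> \<oplus> P\<^bsub>r-1\<^esub>\<close> with indecomposable, pairwise non-isomorphic right ideals \<open>P\<^sub>i\<close>.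
\<close>

definition basic_algebra :: "'k ring \<Rightarrow> ('k, 'a) module \<Rightarrow> bool"
  where "basic_algebra K A \<longleftrightarrow>
    (\<exists>P r. internal_direct_sum K A (regular_module A) P r \<and>
       (\<forall>i<r. indecomposable_module K A ((regular_module A)\<lparr>carrier := P i\<rparr>)) \<and>
       (\<forall>i<r. \<forall>j<r. i \<noteq> j \<longrightarrow>
          \<not> rmod_iso K A ((regular_module A)\<lparr>carrier := P i\<rparr>) ((regular_module A)\<lparr>carrier := P j\<rparr>)))"

text \<open>
  Connected: nonzero, and not a product of two nonzero algebras. A product decomposition is the same as
  a decomposition into two complementary two-sided ideals.
\<close>

definition connected_algebra :: "('k, 'a) module \<Rightarrow> bool"
  where "connected_algebra A \<longleftrightarrow>
    carrier A \<noteq> {\<zero>\<^bsub>A\<^esub>} \<and>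
    \<not> (\<exists>I J. ideal I A \<and> ideal J A \<and> I \<noteq> {\<zero>\<^bsub>A\<^esub>} \<and> J \<noteq> {\<zero>\<^bsub>A\<^esub>} \<and>
          I \<inter> J = {\<zero>\<^bsub>A\<^esub>} \<and> I <+>\<^bsub>A\<^esub> J = carrier A)"


section \<open>A type that contains all finite dimensional modules up to isomorphism\<close>

text \<open>
  A definition in HOL cannot quantify over all types. Whenever a definition below quantifies over all
  finite dimensional modules, these range over modules whose elements are of type \<^typ>\<open>nat \<Rightarrow> 'k\<close>.
  Since such a module may be any subset of that type with any operations, coordinate vectors give an
  isomorphic copy of every finite dimensional module; this is lemma \<open>ex_isomorphic_fd_module\<close>.
\<close>

definition transport_module :: "('m \<Rightarrow> 'n) \<Rightarrow> ('k, 'a, 'm) rmodule \<Rightarrow> ('k, 'a, 'n) rmodule"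
  where "transport_module f M =
    (let g = inv_into (carrier M) f in
     \<lparr>carrier = f ` carrier M, mult = undefined, one = undefined,
      zero = f \<zero>\<^bsub>M\<^esub>,
      add = (\<lambda>x y. f (g x \<oplus>\<^bsub>M\<^esub> g y)),
      smult = (\<lambda>c x. f (c \<odot>\<^bsub>M\<^esub> g x)),
      ract = (\<lambda>x a. f (g x \<cdot>\<^bsub>M\<^esub> a))\<rparr>)"

lemma transport_module:
  assumes M: "fd_right_module K A M" and inj: "inj_on f (carrier M)"
  shows "fd_right_module K A (transport_module f M)"
    and "rmod_iso K A M (transport_module f M)"
proof -
  interpret M: fd_right_module K A M by fact
  interpret A: fd_algebra K A by (rule M.fd_algebra)
  let ?N = "transport_module f M"
  note gf = inv_into_f_f[OF inj]
  have c: "carrier ?N = f ` carrier M"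
    by (simp add: transport_module_def Let_def)
  have z: "\<zero>\<^bsub>?N\<^esub> = f \<zero>\<^bsub>M\<^esub>"
    by (simp add: transport_module_def Let_def)
  have a: "f x \<oplus>\<^bsub>?N\<^esub> f y = f (x \<oplus>\<^bsub>M\<^esub> y)" if "x \<in> carrier M" "y \<in> carrier M" for x y
    using that by (simp add: transport_module_def Let_def gf)
  have s: "k \<odot>\<^bsub>?N\<^esub> f x = f (k \<odot>\<^bsub>M\<^esub> x)" if "x \<in> carrier M" for k x
    using that by (simp add: transport_module_def Let_def gf)
  have r: "f x \<cdot>\<^bsub>?N\<^esub> b = f (x \<cdot>\<^bsub>M\<^esub> b)" if "x \<in> carrier M" for x b
    using that by (simp add: transport_module_def Let_def gf)
  have vs: "vectorspace K ?N"
  proof (rule vs_criteria)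
    show "field K" by (rule M.field_axioms)
    show "\<forall>v\<in>carrier ?N. \<exists>w\<in>carrier ?N. v \<oplus>\<^bsub>?N\<^esub> w = \<zero>\<^bsub>?N\<^esub>"
      unfolding c z ball_simps bex_simps
    proof
      fix x assume x: "x \<in> carrier M"
      have "f x \<oplus>\<^bsub>?N\<^esub> f (\<ominus>\<^bsub>M\<^esub> x) = f \<zero>\<^bsub>M\<^esub>"
        using x by (simp add: a M.M.r_neg)
      then show "\<exists>y\<in>carrier M. f x \<oplus>\<^bsub>?N\<^esub> f y = f \<zero>\<^bsub>M\<^esub>"
        using x by blast
    qed
    show "\<forall>v w. v \<in> carrier ?N \<and> w \<in> carrier ?N \<longrightarrow> v \<oplus>\<^bsub>?N\<^esub> w = w \<oplus>\<^bsub>?N\<^esub> v"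
      by (clarsimp simp: c a) (simp add: M.M.a_comm)
  qed (auto simp: c z a s M.M.a_assoc M.smult_assoc1 M.smult_l_distr M.smult_r_distr)
  interpret N: vectorspace K ?N by (rule vs)
  have hom: "f \<in> LinearCombinations.module_hom K M ?N"
    by (auto simp: LinearCombinations.module_hom_def c a s)
  have fd: "N.fin_dim"
  proof -
    interpret T: linear_map K M ?N f
      by unfold_locales (rule hom)
    show ?thesis
      by (rule T.surj_fin_dim[OF M.fin_dim_module]) (simp add: c)
  qed
  show "fd_right_module K A ?N"
  proof (intro fd_right_module.intro fd_right_module_axioms.intro)
    show "vectorspace K ?N" "fd_algebra K A" "N.fin_dim"
      by (fact vs M.fd_algebra fd)+
  qed (auto simp: c a s r M.ract_closed M.ract_add_left M.ract_add_right M.ract_mult M.ract_one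
        M.ract_smult M.smult_ract)
  show "rmod_iso K A M ?N"
    unfolding rmod_iso_def rmod_hom_def
    by (rule bexI[of _ f]) (auto simp: hom c r inj bij_betw_def)
qed

lemma ex_isomorphic_fd_module:
  assumes "fd_right_module K A (M :: ('k, 'a, 'm) rmodule)"
  shows "\<exists>N :: ('k, 'a, nat \<Rightarrow> 'k) rmodule. fd_right_module K A N \<and> rmod_iso K A M N"
proof -
  interpret M: fd_right_module K A M by fact
  obtain S where S: "finite S" "S \<subseteq> carrier M" "M.gen_set S"
    using M.fin_dim_module unfolding M.fin_dim_def by blast
  obtain g where g: "\<And>v. v \<in> carrier M \<Longrightarrow> g v \<in> S \<rightarrow> carrier K \<and> M.lincomb (g v) S = v"
    using M.finite_in_span[OF S(1,2)] S(3) by metis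
  obtain h where h: "bij_betw h {0..<card S} S"
    using ex_bij_betw_nat_finite[OF S(1)] by blast
  have "inj_on (\<lambda>v. g v \<circ> h) (carrier M)"
  proof
    fix v w assume v: "v \<in> carrier M" and w: "w \<in> carrier M" and eq: "g v \<circ> h = g w \<circ> h"
    have "g v s = g w s" if s: "s \<in> S" for s
    proof -
      obtain i where "s = h i"
        using h s unfolding bij_betw_def by blast
      then show ?thesis using fun_cong[OF eq, of i] by simp
    qed
    then have "M.lincomb (g v) S = M.lincomb (g w) S"
      using g[OF w] S(2) by (intro M.lincomb_cong) auto
    then show "v = w" using g[OF v] g[OF w] by simp
  qed
  then show ?thesis
    using transport_module[OF assms] by blast
qed

type_synonym ('k, 'a) fd_mod = "('k, 'a, nat \<Rightarrow> 'k) rmodule"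


section \<open>Homological notions\<close>

definition injective_module :: "'k ring \<Rightarrow> ('k, 'a) module \<Rightarrow> ('k, 'a, 'm) rmodule \<Rightarrow> bool"
  where "injective_module K A I \<longleftrightarrow>
    fd_right_module K A I \<and>
    (\<forall>(M :: ('k, 'a) fd_mod) (N :: ('k, 'a) fd_mod) f g.
       fd_right_module K A M \<and> fd_right_module K A N \<and>
       f \<in> rmod_hom K A M N \<and> inj_on f (carrier M) \<and> g \<in> rmod_hom K A M I \<longrightarrow>
       (\<exists>h\<in>rmod_hom K A N I. \<forall>x\<in>carrier M. h (f x) = g x))"

definition projective_module :: "'k ring \<Rightarrow> ('k, 'a) module \<Rightarrow> ('k, 'a, 'm) rmodule \<Rightarrow> bool"
  where "projective_module K A P \<longleftrightarrow>
    fd_right_module K A P \<and>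
    (\<forall>(M :: ('k, 'a) fd_mod) (N :: ('k, 'a) fd_mod) f g.
       fd_right_module K A M \<and> fd_right_module K A N \<and>
       f \<in> rmod_hom K A M N \<and> f ` carrier M = carrier N \<and> g \<in> rmod_hom K A P N \<longrightarrow>
       (\<exists>h\<in>rmod_hom K A P M. \<forall>x\<in>carrier P. f (h x) = g x))"

definition essential_submodule ::
    "'k ring \<Rightarrow> ('k, 'a) module \<Rightarrow> ('k, 'a, 'm) rmodule \<Rightarrow> 'm set \<Rightarrow> bool"
  where "essential_submodule K A M N \<longleftrightarrow>
    rsubmodule K A M N \<and>
    (\<forall>L. rsubmodule K A M L \<and> N \<inter> L = {\<zero>\<^bsub>M\<^esub>} \<longrightarrow> L = {\<zero>\<^bsub>M\<^esub>})"

text \<open>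
  \<open>0 \<rightarrow> M \<rightarrow> I 0 \<rightarrow> I 1 \<rightarrow> \<dots>\<close> with augmentation \<open>e\<close> and differentials \<open>d i : I i \<rightarrow> I (i + 1)\<close>;
  a finite resolution ends in zero modules.
\<close>

definition injective_resolution ::
    "'k ring \<Rightarrow> ('k, 'a) module \<Rightarrow> ('k, 'a, 'n) rmodule \<Rightarrow>
     ('n \<Rightarrow> 'm) \<Rightarrow> (nat \<Rightarrow> ('k, 'a, 'm) rmodule) \<Rightarrow> (nat \<Rightarrow> 'm \<Rightarrow> 'm) \<Rightarrow> bool"
  where "injective_resolution K A M e I d \<longleftrightarrow>
    fd_right_module K A M \<and>
    (\<forall>i. injective_module K A (I i)) \<and>
    e \<in> rmod_hom K A M (I 0) \<and> inj_on e (carrier M) \<and>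
    (\<forall>i. d i \<in> rmod_hom K A (I i) (I (Suc i))) \<and>
    rmod_ker (I 0) (I 1) (d 0) = e ` carrier M \<and>
    (\<forall>i. rmod_ker (I (Suc i)) (I (Suc (Suc i))) (d (Suc i)) = d i ` carrier (I i))"

text \<open>
  Minimality: \<open>I 0\<close> is an injective envelope of \<open>M\<close>, and \<open>I (i + 1)\<close> is an injective envelope of
  the image of \<open>d i\<close>, i.e. of the cokernel of the preceding map.
\<close>

definition minimal_injective_resolution ::
    "'k ring \<Rightarrow> ('k, 'a) module \<Rightarrow> ('k, 'a, 'n) rmodule \<Rightarrow>
     ('n \<Rightarrow> 'm) \<Rightarrow> (nat \<Rightarrow> ('k, 'a, 'm) rmodule) \<Rightarrow> (nat \<Rightarrow> 'm \<Rightarrow> 'm) \<Rightarrow> bool"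
  where "minimal_injective_resolution K A M e I d \<longleftrightarrow>
    injective_resolution K A M e I d \<and>
    essential_submodule K A (I 0) (e ` carrier M) \<and>
    (\<forall>i. essential_submodule K A (I (Suc i)) (d i ` carrier (I i)))"

definition projective_resolution ::
    "'k ring \<Rightarrow> ('k, 'a) module \<Rightarrow> ('k, 'a, 'n) rmodule \<Rightarrow>
     ('m \<Rightarrow> 'n) \<Rightarrow> (nat \<Rightarrow> ('k, 'a, 'm) rmodule) \<Rightarrow> (nat \<Rightarrow> 'm \<Rightarrow> 'm) \<Rightarrow> bool"
  where "projective_resolution K A M p P d \<longleftrightarrow>
    fd_right_module K A M \<and>
    (\<forall>i. projective_module K A (P i)) \<and>
    p \<in> rmod_hom K A (P 0) M \<and> p ` carrier (P 0) = carrier M \<and>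
    (\<forall>i. d i \<in> rmod_hom K A (P (Suc i)) (P i)) \<and>
    rmod_ker (P 0) M p = d 0 ` carrier (P 1) \<and>
    (\<forall>i. rmod_ker (P (Suc i)) (P i) (d i) = d (Suc i) ` carrier (P (Suc (Suc i))))"

definition injdim :: "'k ring \<Rightarrow> ('k, 'a) module \<Rightarrow> ('k, 'a, 'm) rmodule \<Rightarrow> enat"
  where "injdim K A M =
    Inf {enat n | n. \<exists>e (I :: nat \<Rightarrow> ('k, 'a) fd_mod) d.
      injective_resolution K A M e I d \<and> (\<forall>i>n. carrier (I i) = {\<zero>\<^bsub>I i\<^esub>})}"

definition projdim :: "'k ring \<Rightarrow> ('k, 'a) module \<Rightarrow> ('k, 'a, 'm) rmodule \<Rightarrow> enat"
  where "projdim K A M =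
    Inf {enat n | n. \<exists>p (P :: nat \<Rightarrow> ('k, 'a) fd_mod) d.
      projective_resolution K A M p P d \<and> (\<forall>i>n. carrier (P i) = {\<zero>\<^bsub>P i\<^esub>})}"

text \<open>
  Minimal injective resolutions exist and are unique up to isomorphism, so it does not matter which one
  the choice operator picks.
\<close>

definition domdim :: "'k ring \<Rightarrow> ('k, 'a) module \<Rightarrow> ('k, 'a, 'm) rmodule \<Rightarrow> enat"
  where "domdim K A M =
    (let I = (SOME I :: nat \<Rightarrow> ('k, 'a) fd_mod. \<exists>e d. minimal_injective_resolution K A M e I d)
     in if \<not> projective_module K A (I 0) then 0
        else Sup {enat n | n. \<forall>i\<le>n. projective_module K A (I i)} + 1)"

definition algebra_domdim :: "'k ring \<Rightarrow> ('k, 'a) module \<Rightarrow> enat"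
  where "algebra_domdim K A = domdim K A (regular_module A)"

definition gorenstein_algebra :: "'k ring \<Rightarrow> ('k, 'a) module \<Rightarrow> bool"
  where "gorenstein_algebra K A \<longleftrightarrow>
    injdim K A (regular_module A) = projdim K A (dual_module K A) \<and>
    injdim K A (regular_module A) < \<infinity>"

text \<open>
  The usual definition of \<open>Gdim\<close> says nothing about algebras with \<open>injdim(A) < \<infinity>\<close> that are not
  Gorenstein (conjecturally there are none); they get \<open>\<infinity>\<close>, so that \<open>Gdim(A) < \<infinity>\<close> holds exactly for
  Gorenstein algebras.
\<close>

definition Gdim :: "'k ring \<Rightarrow> ('k, 'a) module \<Rightarrow> enat"
  where "Gdim K A =
    (if gorenstein_algebra K A then injdim K A (regular_module A) else \<infinity>)"

text \<open>
  \<open>\<Omega>\<^bsup>-n\<^esup>\<close> for \<open>n \<ge> 2\<close>: the cokernel of \<open>I (n - 2) \<rightarrow> I (n - 1)\<close>.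
\<close>

definition cosyzygy ::
    "(nat \<Rightarrow> ('k, 'a, 'm) rmodule) \<Rightarrow> (nat \<Rightarrow> 'm \<Rightarrow> 'm) \<Rightarrow> nat \<Rightarrow> ('k, 'a, 'm set) rmodule"
  where "cosyzygy I d n = rmod_quot (I (n - 1)) (d (n - 2) ` carrier (I (n - 2)))"

end

theory Submission
  imports Defs
begin

text \<open>Let \<open>T = I\<^sub>0 \<oplus> \<Omega>\<^bsup>-n\<^esup>(A)\<close>. Since \<open>injdim(A) = n\<close>, the minimal injective resolution stops at \<open>I\<^sub>n\<close>, so
  \<open>\<Omega>\<^bsup>-n\<^esup>(A) \<cong> I\<^sub>n\<close> and \<open>T\<close> is injective: it is a summand of a sum of copies of \<open>D(A)\<close>. The main point is
  the converse, that \<open>D(A)\<close> is a summand of a sum of copies of \<open>T\<close> (\<open>dual_in_add\<close>). Then \<open>B = End(T)\<close>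
  is Morita equivalent to \<open>End(D(A)) \<cong> A\<close>, and the dominant dimension is a Morita invariant
  (\<open>domdim_End\<close>).

  For the converse, consider surjections onto \<open>D(A)\<close> and then onto the successive kernels. As
  \<open>I\<^sub>0, \<dots>, I\<^bsub>n-1\<^esub>\<close> are projective, a dimension shift shows that maps from \<open>A\<close> to the first \<open>n\<close> of these
  modules extend to \<open>I\<^sub>0\<close>; hence the surjections can start in \<open>add(I\<^sub>0)\<close>, and there is an exact sequence
  \<open>0 \<rightarrow> X \<rightarrow> P\<^bsub>n-1\<^esub> \<rightarrow> \<dots> \<rightarrow> P\<^sub>0 \<rightarrow> D(A) \<rightarrow> 0\<close> whose terms \<open>P\<^sub>i\<close> are both projective and injective
  (\<open>syzygy_exists\<close>; this is one half of the left-right symmetry of the dominant dimension). By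
  Schanuel's lemma and \<open>projdim(D(A)) = n\<close>, the module \<open>X\<close> is projective (\<open>stable_retract_syzygy\<close>). So the
  sequence is an injective resolution of a module in \<open>add(A)\<close>. Comparing it with the resolution of \<open>A\<close>
  writes the identity of \<open>D(A)\<close>, up to homotopy, as a map through copies of \<open>I\<^sub>n\<close>, and the homotopy
  contributes a map through copies of \<open>P\<^sub>0\<close> (\<open>syzygy_descend\<close>). Both are maps through copies of \<open>T\<close>.

  The Morita equivalence enters through the exact functor \<open>G(X) = D(Hom\<^sub>A(X, T))\<close> from right \<open>A\<close>-modules to
  right \<open>B\<close>-modules. It sends \<open>T\<close> to \<open>D(B)\<close>, so it preserves injectives, and
  \<open>G(A) \<cong> Hom\<^sub>A(T, D(A))\<close> has the same indecomposable summands as \<open>Hom\<^sub>A(T, T) = B\<close>, so it preserves projectives.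
  Thus \<open>G(I\<^sub>0) \<rightarrow> G(I\<^sub>1) \<rightarrow> \<dots>\<close> is an injective resolution of \<open>G(A)\<close>, and comparison with a minimal resolution
  \<open>J\<close> of \<open>B\<close> shows that \<open>J\<^sub>0, \<dots>, J\<^bsub>n-1\<^esub>\<close> are projective and that \<open>J\<^bsub>n+1\<^esub> = 0\<close>. If \<open>J\<^sub>n\<close> were projective
  too, the resolution \<open>J\<close> would split from the right and \<open>B\<close> would be injective. Then \<open>G(I)\<close> would split from
  the left, and fullness of \<open>G\<close> on \<open>add(T)\<close> would make \<open>I\<^sub>n\<close> a summand of the projective module \<open>I\<^bsub>n-1\<^esub>\<close>, but
  \<open>I\<^sub>n\<close> is not projective.

  Membership in \<open>add(T)\<close> is expressed without direct sums: \<open>X\<close> belongs to \<open>add(T)\<close> iff the identity of \<open>X\<close> is a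
  sum of composites \<open>X \<rightarrow> T \<rightarrow> X\<close>. Statements about \<open>add(T)\<close> then follow by induction on such sums.\<close>

section \<open>Linear algebra\<close>

definition functionals :: "('k, 'r) ring_scheme \<Rightarrow> ('k, 'v, 'e) module_scheme \<Rightarrow> ('v \<Rightarrow> 'k) set"
  where "functionals K V = {f \<in> carrier V \<rightarrow>\<^sub>E carrier K.
        (\<forall>x\<in>carrier V. \<forall>y\<in>carrier V. f (x \<oplus>\<^bsub>V\<^esub> y) = f x \<oplus>\<^bsub>K\<^esub> f y) \<and>
        (\<forall>c\<in>carrier K. \<forall>x\<in>carrier V. f (c \<odot>\<^bsub>V\<^esub> x) = c \<otimes>\<^bsub>K\<^esub> f x)}"

lemma functionalsI:
  assumes "\<And>x. x \<in> carrier V \<Longrightarrow> f x \<in> carrier K"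
    and "\<And>x. x \<notin> carrier V \<Longrightarrow> f x = undefined"
    and "\<And>x y. x \<in> carrier V \<Longrightarrow> y \<in> carrier V \<Longrightarrow> f (x \<oplus>\<^bsub>V\<^esub> y) = f x \<oplus>\<^bsub>K\<^esub> f y"
    and "\<And>c x. c \<in> carrier K \<Longrightarrow> x \<in> carrier V \<Longrightarrow> f (c \<odot>\<^bsub>V\<^esub> x) = c \<otimes>\<^bsub>K\<^esub> f x"
  shows "f \<in> functionals K V"
  using assms by (auto simp: functionals_def PiE_def extensional_def)

lemma functionalsD:
  assumes "f \<in> functionals K V"
  shows "\<And>x. x \<in> carrier V \<Longrightarrow> f x \<in> carrier K"
    and "\<And>x. x \<notin> carrier V \<Longrightarrow> f x = undefined"
    and "\<And>x y. x \<in> carrier V \<Longrightarrow> y \<in> carrier V \<Longrightarrow> f (x \<oplus>\<^bsub>V\<^esub> y) = f x \<oplus>\<^bsub>K\<^esub> f y"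
    and "\<And>c x. c \<in> carrier K \<Longrightarrow> x \<in> carrier V \<Longrightarrow> f (c \<odot>\<^bsub>V\<^esub> x) = c \<otimes>\<^bsub>K\<^esub> f x"
    and "f \<in> extensional (carrier V)"
  using assms by (auto simp: functionals_def PiE_def extensional_def)

text \<open>The field as a vector space over itself, so that functionals are homomorphisms of vector spaces.\<close>
definition scalar_space :: "('k, 'r) ring_scheme \<Rightarrow> ('k, 'k) module"
  where "scalar_space K = \<lparr>carrier = carrier K, mult = mult K, one = \<one>\<^bsub>K\<^esub>, zero = \<zero>\<^bsub>K\<^esub>,
    add = add K, smult = mult K\<rparr>"

lemma scalar_space_simps [simp]:
  "carrier (scalar_space K) = carrier K" "zero (scalar_space K) = \<zero>\<^bsub>K\<^esub>"
  "add (scalar_space K) = add K" "smult (scalar_space K) = mult K"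
  by (simp_all add: scalar_space_def)

lemma functionals_hom: "f \<in> functionals K V \<Longrightarrow> f \<in> LinearCombinations.module_hom K V (scalar_space K)"
  by (auto simp: functionals_def LinearCombinations.module_hom_def)

lemma linear_submoduleI:
  assumes "Module.module K V" "S \<subseteq> carrier V" "\<zero>\<^bsub>V\<^esub> \<in> S"
    "\<And>x y. x \<in> S \<Longrightarrow> y \<in> S \<Longrightarrow> x \<oplus>\<^bsub>V\<^esub> y \<in> S"
    "\<And>c x. c \<in> carrier K \<Longrightarrow> x \<in> S \<Longrightarrow> c \<odot>\<^bsub>V\<^esub> x \<in> S"
  shows "LinearCombinations.submodule K S V"
  using assms by (intro submodule.intro)

context vectorspace
begin

lemma vectorspace_scalar_space: "vectorspace K (scalar_space K)"
proof (rule vs_criteria)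
  show "\<forall>v\<in>carrier (scalar_space K). \<exists>w\<in>carrier (scalar_space K). v \<oplus>\<^bsub>scalar_space K\<^esub> w = \<zero>\<^bsub>scalar_space K\<^esub>"
    using R.r_neg R.a_inv_closed by fastforce
qed (auto simp: field_axioms R.m_assoc R.l_distr R.r_distr R.a_assoc
      intro: R.a_comm)

lemma fin_dim_scalar_space: "vectorspace.fin_dim K (scalar_space K)"
proof -
  interpret S: vectorspace K "scalar_space K" by (rule vectorspace_scalar_space)
  have "x \<in> S.span {\<one>\<^bsub>K\<^esub>}" if "x \<in> carrier K" for x
  proof -
    have "S.span {\<one>\<^bsub>K\<^esub>} \<supseteq> {\<one>\<^bsub>K\<^esub>}" by (rule S.in_own_span) simp
    then have "x \<odot>\<^bsub>scalar_space K\<^esub> \<one>\<^bsub>K\<^esub> \<in> S.span {\<one>\<^bsub>K\<^esub>}"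
      using S.span_is_submodule[of "{\<one>\<^bsub>K\<^esub>}"] that by (simp add: submodule.smult_closed del: scalar_space_simps(4))
    then show ?thesis using that by simp
  qed
  then have "S.gen_set {\<one>\<^bsub>K\<^esub>}"
    using S.span_is_subset2[of "{\<one>\<^bsub>K\<^esub>}"] by auto
  then show ?thesis unfolding S.fin_dim_def by (intro exI[of _ "{\<one>\<^bsub>K\<^esub>}"]) auto
qed

lemma functional_zero: "f \<in> functionals K V \<Longrightarrow> f \<zero>\<^bsub>V\<^esub> = \<zero>\<^bsub>K\<^esub>"
proof -
  assume f: "f \<in> functionals K V"
  interpret S: vectorspace K "scalar_space K" by (rule vectorspace_scalar_space)
  interpret linear_map K V "scalar_space K" f
    by unfold_locales (rule functionals_hom[OF f])
  show ?thesis using f0_is_0 by simp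
qed

lemma subspace_vs:
  assumes "LinearCombinations.submodule K X V"
  shows "vectorspace K (V\<lparr>carrier := X\<rparr>)"
  by (intro subspace_is_vs subspace.intro assms vectorspace_axioms)

lemma basis_of_subspace:
  assumes fd: fin_dim and X: "LinearCombinations.submodule K X V"
  obtains b where "finite b" "b \<subseteq> X" "lin_indpt b" "span b = X" "vectorspace.basis K (V\<lparr>carrier := X\<rparr>) b"
proof -
  interpret X: vectorspace K "V\<lparr>carrier := X\<rparr>" by (rule subspace_vs[OF X])
  have sub: "X \<subseteq> carrier V" using X by (rule submodule.subset)
  have *: "finite S \<and> card S \<le> dim" if "S \<subseteq> X \<and> X.lin_indpt S" for S
    using that sub span_li_not_depend(2)[OF _ X, of S] li_le_dim[OF fd, of S] by auto
  have "X.lin_indpt {}" unfolding X.lin_dep_def by auto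
  then obtain b where b: "finite b" "maximal b (\<lambda>S. S \<subseteq> X \<and> X.lin_indpt S)"
    using maximal_exists[of "\<lambda>S. S \<subseteq> X \<and> X.lin_indpt S" dim "{}"] * by blast
  then have bas: "X.basis b" using X.max_li_is_basis[of b] by simp
  then have bX: "b \<subseteq> X" and li: "X.lin_indpt b" and g: "X.span b = X" by (auto simp: X.basis_def)
  show thesis
    by (rule that[OF b(1) bX _ _ bas]) (use span_li_not_depend[OF bX X] li g in auto)
qed

lemma subspace_fin_dim:
  assumes fd: fin_dim and X: "LinearCombinations.submodule K X V"
  shows "vectorspace.fin_dim K (V\<lparr>carrier := X\<rparr>)"
proof -
  interpret X: vectorspace K "V\<lparr>carrier := X\<rparr>" by (rule subspace_vs[OF X])
  obtain b where "finite b" "X.basis b" using basis_of_subspace[OF fd X] by blast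
  then show ?thesis unfolding X.fin_dim_def X.basis_def by auto
qed

lemma proper_subspace_dim:
  assumes fd: fin_dim and X: "LinearCombinations.submodule K X V" and ne: "X \<noteq> carrier V"
  shows "vectorspace.dim K (V\<lparr>carrier := X\<rparr>) < dim"
proof -
  interpret X: vectorspace K "V\<lparr>carrier := X\<rparr>" by (rule subspace_vs[OF X])
  obtain b where b: "finite b" "b \<subseteq> X" "lin_indpt b" "span b = X" "X.basis b"
    using basis_of_subspace[OF fd X] .
  have sub: "X \<subseteq> carrier V" using X by (rule submodule.subset)
  have "\<not> dim \<le> card b"
  proof
    assume "dim \<le> card b"
    then have "basis b" using dim_li_is_basis[OF fd b(1)] b sub by auto
    then show False using b(4) ne by (auto simp: basis_def)
  qed
  then show ?thesis using X.dim_basis[OF b(1,5)] by simp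
qed

lemma functional_on_basis:
  assumes A: "finite A" "basis A" and f: "f \<in> A \<rightarrow> carrier K"
  obtains \<mu> where "\<mu> \<in> functionals K V" "\<And>s. s \<in> A \<Longrightarrow> \<mu> s = f s"
proof -
  have AV: "A \<subseteq> carrier V" using A by (simp add: basis_def)
  have ex1: "\<exists>!a. a \<in> A \<rightarrow>\<^sub>E carrier K \<and> lincomb a A = v" if "v \<in> carrier V" for v
    using basis_criterion[OF A(1) AV, THEN iffD1, OF A(2)] that by simp
  define c where "c v = (THE a. a \<in> A \<rightarrow>\<^sub>E carrier K \<and> lincomb a A = v)" for v
  have c: "c v \<in> A \<rightarrow>\<^sub>E carrier K" "lincomb (c v) A = v" if "v \<in> carrier V" for v
    using theI'[OF ex1[OF that]] unfolding c_def by simp_all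
  have cE: "c v s \<in> carrier K" if "v \<in> carrier V" "s \<in> A" for v s
    using c(1)[OF that(1)] that(2) by auto
  have eq: "c v s = a s" if "a \<in> A \<rightarrow> carrier K" "lincomb a A = v" "s \<in> A" for v a s
  proof -
    have v: "v \<in> carrier V" using that AV by auto
    have "lincomb (restrict a A) A = v"
      unfolding that(2)[symmetric] lincomb_def using that(1) AV by (intro M.finsum_cong') auto
    moreover have "restrict a A \<in> A \<rightarrow>\<^sub>E carrier K" using that(1) by auto
    ultimately have "c v = restrict a A" using c[OF v] ex1[OF v] by metis
    then show ?thesis using that by simp
  qed
  define \<mu> where "\<mu> = (\<lambda>v\<in>carrier V. \<Oplus>\<^bsub>K\<^esub>s\<in>A. c v s \<otimes>\<^bsub>K\<^esub> f s)"
  have cf: "(\<lambda>s. c v s \<otimes>\<^bsub>K\<^esub> f s) \<in> A \<rightarrow> carrier K" if "v \<in> carrier V" for v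
    using cE[OF that] f by auto
  have "\<mu> \<in> functionals K V"
  proof (rule functionalsI)
    fix x y assume x: "x \<in> carrier V" and y: "y \<in> carrier V"
    have "c (x \<oplus>\<^bsub>V\<^esub> y) s = c x s \<oplus>\<^bsub>K\<^esub> c y s" if "s \<in> A" for s
    proof (rule eq[OF _ _ that])
      show "(\<lambda>s. c x s \<oplus>\<^bsub>K\<^esub> c y s) \<in> A \<rightarrow> carrier K" using cE x y by blast
      have "c x \<in> A \<rightarrow> carrier K" "c y \<in> A \<rightarrow> carrier K" using cE x y by blast+
      then show "lincomb (\<lambda>s. c x s \<oplus>\<^bsub>K\<^esub> c y s) A = x \<oplus>\<^bsub>V\<^esub> y"
        using lincomb_sum[OF A(1) AV] c(2) x y by presburger
    qed
    then have "(\<Oplus>\<^bsub>K\<^esub>s\<in>A. c (x \<oplus>\<^bsub>V\<^esub> y) s \<otimes>\<^bsub>K\<^esub> f s) =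
       (\<Oplus>\<^bsub>K\<^esub>s\<in>A. c x s \<otimes>\<^bsub>K\<^esub> f s \<oplus>\<^bsub>K\<^esub> c y s \<otimes>\<^bsub>K\<^esub> f s)"
      using f cE x y by (intro R.finsum_cong') (auto simp: R.l_distr Pi_iff)
    also have "\<dots> = (\<Oplus>\<^bsub>K\<^esub>s\<in>A. c x s \<otimes>\<^bsub>K\<^esub> f s) \<oplus>\<^bsub>K\<^esub> (\<Oplus>\<^bsub>K\<^esub>s\<in>A. c y s \<otimes>\<^bsub>K\<^esub> f s)"
      using cf x y by (intro R.finsum_addf) auto
    finally show "\<mu> (x \<oplus>\<^bsub>V\<^esub> y) = \<mu> x \<oplus>\<^bsub>K\<^esub> \<mu> y" using x y by (simp add: \<mu>_def)
  next
    fix k x assume k: "k \<in> carrier K" and x: "x \<in> carrier V"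
    have "c (k \<odot>\<^bsub>V\<^esub> x) s = k \<otimes>\<^bsub>K\<^esub> c x s" if "s \<in> A" for s
    proof (rule eq[OF _ _ that])
      show "(\<lambda>s. k \<otimes>\<^bsub>K\<^esub> c x s) \<in> A \<rightarrow> carrier K" using cE x k by blast
      have "c x \<in> A \<rightarrow> carrier K" using cE x by blast
      then show "lincomb (\<lambda>s. k \<otimes>\<^bsub>K\<^esub> c x s) A = k \<odot>\<^bsub>V\<^esub> x"
        using lincomb_smult[OF AV _ k] c(2) x by presburger
    qed
    then have "(\<Oplus>\<^bsub>K\<^esub>s\<in>A. c (k \<odot>\<^bsub>V\<^esub> x) s \<otimes>\<^bsub>K\<^esub> f s) = (\<Oplus>\<^bsub>K\<^esub>s\<in>A. k \<otimes>\<^bsub>K\<^esub> (c x s \<otimes>\<^bsub>K\<^esub> f s))"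
      using f cE x k by (intro R.finsum_cong') (auto simp: R.m_assoc Pi_iff)
    also have "\<dots> = k \<otimes>\<^bsub>K\<^esub> (\<Oplus>\<^bsub>K\<^esub>s\<in>A. c x s \<otimes>\<^bsub>K\<^esub> f s)"
      using cf x k A(1) by (intro R.finsum_rdistr[symmetric]) auto
    finally show "\<mu> (k \<odot>\<^bsub>V\<^esub> x) = k \<otimes>\<^bsub>K\<^esub> \<mu> x" using x k by (simp add: \<mu>_def)
  qed (use cf in \<open>auto simp: \<mu>_def\<close>)
  moreover have "\<mu> s = f s" if s: "s \<in> A" for s
  proof -
    have "lincomb (\<lambda>t. if t = s then \<one>\<^bsub>K\<^esub> else \<zero>\<^bsub>K\<^esub>) A = s"
    proof -
      have "lincomb (\<lambda>t. if t = s then \<one>\<^bsub>K\<^esub> else \<zero>\<^bsub>K\<^esub>) A =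
        (\<Oplus>\<^bsub>V\<^esub>t\<in>A. if s = t then t else \<zero>\<^bsub>V\<^esub>)"
        unfolding lincomb_def using AV by (intro M.finsum_cong') auto
      also have "\<dots> = s" using s A(1) AV by (intro M.finsum_singleton) auto
      finally show ?thesis .
    qed
    then have "c s t = (if t = s then \<one>\<^bsub>K\<^esub> else \<zero>\<^bsub>K\<^esub>)" if "t \<in> A" for t
      using that by (intro eq) auto
    then have "(\<Oplus>\<^bsub>K\<^esub>t\<in>A. c s t \<otimes>\<^bsub>K\<^esub> f t) = (\<Oplus>\<^bsub>K\<^esub>t\<in>A. if s = t then f t else \<zero>\<^bsub>K\<^esub>)"
      using f by (intro R.finsum_cong') (auto simp: Pi_iff)
    also have "\<dots> = f s" using s A(1) f by (intro R.finsum_singleton) auto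
    finally show ?thesis using s AV by (auto simp: \<mu>_def)
  qed
  ultimately show thesis by (rule that)
qed

text \<open>A basis of the subspace extends to a basis of the whole space, and the new basis vectors may be sent
  to zero.\<close>
lemma functional_extension:
  assumes fd: fin_dim and X: "LinearCombinations.submodule K X V"
    and l: "\<nu> \<in> functionals K (V\<lparr>carrier := X\<rparr>)"
  obtains \<mu> where "\<mu> \<in> functionals K V" "\<And>x. x \<in> X \<Longrightarrow> \<mu> x = \<nu> x"
proof -
  interpret X: vectorspace K "V\<lparr>carrier := X\<rparr>" by (rule subspace_vs[OF X])
  obtain b where b: "finite b" "b \<subseteq> X" "lin_indpt b" "span b = X"
    using basis_of_subspace[OF fd X] .
  have sub: "X \<subseteq> carrier V" using X by (rule submodule.subset)
  let ?P = "\<lambda>S. b \<subseteq> S \<and> S \<subseteq> carrier V \<and> lin_indpt S"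
  have "?P b" using b sub by auto
  moreover have "finite S \<and> card S \<le> dim" if "?P S" for S
    using li_le_dim[OF fd, of S] that by simp
  ultimately have "\<exists>A. finite A \<and> maximal A ?P" by (intro maximal_exists)
  then obtain A where A: "finite A" "maximal A ?P" by (elim exE conjE)
  have mA: "?P A" "\<And>B. A \<subseteq> B \<Longrightarrow> ?P B \<Longrightarrow> B = A"
    using A(2) unfolding maximal_def by simp_all
  have "maximal A (\<lambda>S. S \<subseteq> carrier V \<and> lin_indpt S)"
    unfolding maximal_def
  proof (intro conjI allI impI)
    fix B assume "A \<subseteq> B \<and> B \<subseteq> carrier V \<and> lin_indpt B"
    then show "B = A" using mA(1) order_trans[of b A B] by (intro mA(2)) simp_all
  qed (use mA(1) in simp_all)
  then have bas: "basis A" by (rule max_li_is_basis)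
  have bA: "b \<subseteq> A" using mA(1) by simp
  have "(\<lambda>s. if s \<in> b then \<nu> s else \<zero>\<^bsub>K\<^esub>) \<in> A \<rightarrow> carrier K"
    using functionalsD(1)[OF l] b by auto
  then obtain \<mu> where \<mu>: "\<mu> \<in> functionals K V" "\<And>s. s \<in> A \<Longrightarrow> \<mu> s = (if s \<in> b then \<nu> s else \<zero>\<^bsub>K\<^esub>)"
    using functional_on_basis[OF A(1) bas] by blast
  let ?E = "{x \<in> X. \<mu> x = \<nu> x}"
  have Xz: "\<zero>\<^bsub>V\<^esub> \<in> X" and Xa: "\<And>x y. x \<in> X \<Longrightarrow> y \<in> X \<Longrightarrow> x \<oplus>\<^bsub>V\<^esub> y \<in> X"
    and Xs: "\<And>c x. c \<in> carrier K \<Longrightarrow> x \<in> X \<Longrightarrow> c \<odot>\<^bsub>V\<^esub> x \<in> X"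
    using X unfolding submodule_def by auto
  have "LinearCombinations.submodule K ?E V"
  proof (rule linear_submoduleI)
    show "\<zero>\<^bsub>V\<^esub> \<in> ?E" using Xz functional_zero[OF \<mu>(1)] X.functional_zero[OF l] by simp
    show "x \<oplus>\<^bsub>V\<^esub> y \<in> ?E" if "x \<in> ?E" "y \<in> ?E" for x y
      using that sub Xa functionalsD(3)[OF \<mu>(1), of x y] functionalsD(3)[OF l, of x y] by auto
    show "c \<odot>\<^bsub>V\<^esub> x \<in> ?E" if "c \<in> carrier K" "x \<in> ?E" for c x
      using that sub Xs functionalsD(4)[OF \<mu>(1), of c x] functionalsD(4)[OF l, of c x] by auto
  qed (use sub module_axioms in auto)
  moreover have "b \<subseteq> ?E" using b bA \<mu>(2) by auto
  ultimately have "X \<subseteq> ?E" using span_is_subset b(4) by metis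
  then show thesis using that[OF \<mu>(1)] by auto
qed

lemma functional_extension_inj:
  assumes fd: fin_dim and U: "vectorspace K U"
    and f: "f \<in> LinearCombinations.module_hom K U V" "inj_on f (carrier U)"
    and l: "\<nu> \<in> functionals K U"
  obtains \<mu> where "\<mu> \<in> functionals K V" "\<And>x. x \<in> carrier U \<Longrightarrow> \<mu> (f x) = \<nu> x"
proof -
  interpret U: vectorspace K U by (rule U)
  interpret f: linear_map K U V f by unfold_locales (rule f(1))
  let ?X = "f ` carrier U" and ?g = "inv_into (carrier U) f"
  have X: "LinearCombinations.submodule K ?X V"
    using f.im_is_submodule unfolding f.im_def .
  have g: "?g (f x) = x" if "x \<in> carrier U" for x using that f(2) by simp
  let ?h = "\<lambda>y\<in>?X. \<nu> (?g y)"
  have h: "?h (f x) = \<nu> x" if "x \<in> carrier U" for x using g[OF that] that by simp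
  have "?h \<in> functionals K (V\<lparr>carrier := ?X\<rparr>)"
  proof (rule functionalsI)
    fix x y assume "x \<in> carrier (V\<lparr>carrier := ?X\<rparr>)" "y \<in> carrier (V\<lparr>carrier := ?X\<rparr>)"
    then obtain u v where uv: "u \<in> carrier U" "x = f u" "v \<in> carrier U" "y = f v" by auto
    have e: "x \<oplus>\<^bsub>V\<lparr>carrier := ?X\<rparr>\<^esub> y = f (u \<oplus>\<^bsub>U\<^esub> v)" using uv by simp
    show "?h (x \<oplus>\<^bsub>V\<lparr>carrier := ?X\<rparr>\<^esub> y) = ?h x \<oplus>\<^bsub>K\<^esub> ?h y"
      using functionalsD(3)[OF l uv(1,3)]
      by (simp only: e h[OF U.M.a_closed[OF uv(1,3)]]) (simp only: uv(2,4) h[OF uv(1)] h[OF uv(3)])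
  next
    fix c x assume "c \<in> carrier K" "x \<in> carrier (V\<lparr>carrier := ?X\<rparr>)"
    then obtain u where u: "c \<in> carrier K" "u \<in> carrier U" "x = f u" by auto
    have e: "c \<odot>\<^bsub>V\<lparr>carrier := ?X\<rparr>\<^esub> x = f (c \<odot>\<^bsub>U\<^esub> u)" using u by simp
    show "?h (c \<odot>\<^bsub>V\<lparr>carrier := ?X\<rparr>\<^esub> x) = c \<otimes>\<^bsub>K\<^esub> ?h x"
      using functionalsD(4)[OF l u(1,2)]
      by (simp only: e h[OF U.smult_closed[OF u(1,2)]]) (simp only: u(3) h[OF u(2)])
  qed (use functionalsD(1)[OF l] g in auto)
  then obtain \<mu> where \<mu>: "\<mu> \<in> functionals K V" "\<And>x. x \<in> ?X \<Longrightarrow> \<mu> x = ?h x"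
    using functional_extension[OF fd X] by metis
  have "\<mu> (f x) = \<nu> x" if "x \<in> carrier U" for x
    using \<mu>(2)[of "f x"] h[OF that] that by simp
  then show thesis by (rule that[OF \<mu>(1)])
qed

end

text \<open>The common reason why dual spaces and spaces of homomorphisms are vector spaces.\<close>
lemma pointwise_vectorspace:
  assumes W: "vectorspace K W"
    and X: "\<And>f x. f \<in> carrier V \<Longrightarrow> x \<in> X \<Longrightarrow> f x \<in> carrier W"
    and E: "\<And>f. f \<in> carrier V \<Longrightarrow> f \<in> extensional X"
    and z: "\<zero>\<^bsub>V\<^esub> = (\<lambda>x\<in>X. \<zero>\<^bsub>W\<^esub>)" "\<zero>\<^bsub>V\<^esub> \<in> carrier V"
    and a: "\<And>f g. f \<oplus>\<^bsub>V\<^esub> g = (\<lambda>x\<in>X. f x \<oplus>\<^bsub>W\<^esub> g x)"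
      "\<And>f g. f \<in> carrier V \<Longrightarrow> g \<in> carrier V \<Longrightarrow> f \<oplus>\<^bsub>V\<^esub> g \<in> carrier V"
    and s: "\<And>c f. c \<odot>\<^bsub>V\<^esub> f = (\<lambda>x\<in>X. c \<odot>\<^bsub>W\<^esub> f x)"
      "\<And>c f. c \<in> carrier K \<Longrightarrow> f \<in> carrier V \<Longrightarrow> c \<odot>\<^bsub>V\<^esub> f \<in> carrier V"
  shows "vectorspace K V"
proof -
  interpret W: vectorspace K W by (rule W)
  show ?thesis
  proof (rule vs_criteria)
    show "field K" by (rule W.field_axioms)
    show "\<forall>f\<in>carrier V. \<exists>g\<in>carrier V. f \<oplus>\<^bsub>V\<^esub> g = \<zero>\<^bsub>V\<^esub>"
    proof
      fix f assume f: "f \<in> carrier V"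
      have "f \<oplus>\<^bsub>V\<^esub> (\<ominus>\<^bsub>K\<^esub> \<one>\<^bsub>K\<^esub>) \<odot>\<^bsub>V\<^esub> f = \<zero>\<^bsub>V\<^esub>"
        unfolding a s z by (rule restrict_ext) (simp add: X[OF f] W.smult_minus_1 W.M.r_neg)
      then show "\<exists>g\<in>carrier V. f \<oplus>\<^bsub>V\<^esub> g = \<zero>\<^bsub>V\<^esub>"
        using s(2)[OF W.R.a_inv_closed[OF W.R.one_closed] f] by (rule bexI)
    qed
    show "\<forall>f\<in>carrier V. f \<oplus>\<^bsub>V\<^esub> \<zero>\<^bsub>V\<^esub> = f"
      unfolding a z by (intro ballI, rule extensionalityI[OF restrict_extensional E]) (simp_all add: X)
    show "\<forall>f\<in>carrier V. \<one>\<^bsub>K\<^esub> \<odot>\<^bsub>V\<^esub> f = f"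
      unfolding s by (intro ballI, rule extensionalityI[OF restrict_extensional E]) (simp_all add: X)
    show "\<forall>f g. f \<in> carrier V \<and> g \<in> carrier V \<longrightarrow> f \<oplus>\<^bsub>V\<^esub> g = g \<oplus>\<^bsub>V\<^esub> f"
      unfolding a by (intro allI impI restrict_ext; elim conjE; rule W.M.a_comm; erule (1) X)
    show "\<zero>\<^bsub>V\<^esub> \<in> carrier V" by (rule z(2))
    show "\<forall>f g. f \<in> carrier V \<and> g \<in> carrier V \<longrightarrow> f \<oplus>\<^bsub>V\<^esub> g \<in> carrier V"
      by (intro allI impI a(2)) simp_all
    show "\<forall>c f. c \<in> carrier K \<and> f \<in> carrier V \<longrightarrow> c \<odot>\<^bsub>V\<^esub> f \<in> carrier V"
      by (intro allI impI s(2)) simp_all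
  qed (unfold a s, (intro allI impI restrict_ext, elim conjE,
      simp add: X W.M.a_assoc W.smult_assoc1 W.smult_l_distr W.smult_r_distr)+)
qed

text \<open>The endomorphisms of finite rank, generated by those of rank one: statements about them are proved by
  induction over sums.\<close>
inductive_set finite_rank :: "('k, 'r) ring_scheme \<Rightarrow> ('k, 'v, 'e) module_scheme \<Rightarrow> ('v \<Rightarrow> 'v) set"
  for K and V where
  zero: "(\<lambda>v. \<zero>\<^bsub>V\<^esub>) \<in> finite_rank K V"
| rank_one: "\<mu> \<in> functionals K V \<Longrightarrow> b \<in> carrier V \<Longrightarrow> (\<lambda>v. \<mu> v \<odot>\<^bsub>V\<^esub> b) \<in> finite_rank K V"
| add: "\<phi> \<in> finite_rank K V \<Longrightarrow> \<psi> \<in> finite_rank K V \<Longrightarrow> (\<lambda>v. \<phi> v \<oplus>\<^bsub>V\<^esub> \<psi> v) \<in> finite_rank K V"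
| cong: "\<phi> \<in> finite_rank K V \<Longrightarrow> (\<And>v. v \<in> carrier V \<Longrightarrow> \<psi> v = \<phi> v) \<Longrightarrow> \<psi> \<in> finite_rank K V"

definition dual_space :: "('k, 'r) ring_scheme \<Rightarrow> ('k, 'v, 'e) module_scheme \<Rightarrow> ('k, 'v \<Rightarrow> 'k) module"
  where "dual_space K V =
    \<lparr>carrier = functionals K V, mult = undefined, one = undefined,
     zero = (\<lambda>x\<in>carrier V. \<zero>\<^bsub>K\<^esub>),
     add = (\<lambda>f g. \<lambda>x\<in>carrier V. f x \<oplus>\<^bsub>K\<^esub> g x),
     smult = (\<lambda>c f. \<lambda>x\<in>carrier V. c \<otimes>\<^bsub>K\<^esub> f x)\<rparr>"

lemma dual_space_simps [simp]:
  "carrier (dual_space K V) = functionals K V"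
  "\<zero>\<^bsub>dual_space K V\<^esub> = (\<lambda>x\<in>carrier V. \<zero>\<^bsub>K\<^esub>)"
  "f \<oplus>\<^bsub>dual_space K V\<^esub> g = (\<lambda>x\<in>carrier V. f x \<oplus>\<^bsub>K\<^esub> g x)"
  "c \<odot>\<^bsub>dual_space K V\<^esub> f = (\<lambda>x\<in>carrier V. c \<otimes>\<^bsub>K\<^esub> f x)"
  by (simp_all add: dual_space_def)

context vectorspace
begin

text \<open>The dual basis lemma: \<open>v = \<Sum>\<^bsub>s\<^esub> \<mu>\<^sub>s(v) s\<close> for a basis and its coordinate functionals \<open>\<mu>\<^sub>s\<close>.\<close>
lemma identity_finite_rank:
  assumes fd: fin_dim
  shows "(\<lambda>v. v) \<in> finite_rank K V"
proof -
  obtain A where A: "finite A" "basis A" using finite_basis_exists[OF fd] by blast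
  have AV: "A \<subseteq> carrier V" using A by (simp add: basis_def)
  have "\<exists>\<mu>\<in>functionals K V. \<forall>t\<in>A. \<mu> t = (if t = s then \<one>\<^bsub>K\<^esub> else \<zero>\<^bsub>K\<^esub>)" for s
    by (rule functional_on_basis[OF A, of "\<lambda>t. if t = s then \<one>\<^bsub>K\<^esub> else \<zero>\<^bsub>K\<^esub>"])
      (simp, blast)
  then obtain \<mu> where \<mu>: "\<And>s. \<mu> s \<in> functionals K V"
    "\<And>s t. t \<in> A \<Longrightarrow> \<mu> s t = (if t = s then \<one>\<^bsub>K\<^esub> else \<zero>\<^bsub>K\<^esub>)" by metis
  let ?h = "\<lambda>S v. \<Oplus>\<^bsub>V\<^esub>s\<in>S. \<mu> s v \<odot>\<^bsub>V\<^esub> s"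
  have \<mu>c: "\<mu> s v \<in> carrier K" if "v \<in> carrier V" for s v using functionalsD(1)[OF \<mu>(1) that] .
  have "finite S \<Longrightarrow> S \<subseteq> A \<Longrightarrow> ?h S \<in> finite_rank K V" for S
  proof (induction S rule: finite_induct)
    case empty
    then show ?case by (simp add: finite_rank.zero)
  next
    case (insert s S)
    then have S: "S \<subseteq> A" "s \<in> A" by auto
    show ?case
    proof (rule finite_rank.cong[OF finite_rank.add[OF finite_rank.rank_one[OF \<mu>(1), of s s] insert.IH[OF S(1)]]])
      show "s \<in> carrier V" using S AV by auto
      show "?h (insert s S) v = \<mu> s v \<odot>\<^bsub>V\<^esub> s \<oplus>\<^bsub>V\<^esub> ?h S v" if "v \<in> carrier V" for v
      proof (rule M.finsum_insert)
        show "(\<lambda>s. \<mu> s v \<odot>\<^bsub>V\<^esub> s) \<in> S \<rightarrow> carrier V" using S AV \<mu>c[OF that] by auto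
        show "\<mu> s v \<odot>\<^bsub>V\<^esub> s \<in> carrier V" using S AV \<mu>c[OF that] by auto
      qed (use insert in auto)
    qed
  qed
  then have h: "?h A \<in> finite_rank K V" using A by blast
  have "?h A v = v" if v: "v \<in> carrier V" for v
  proof -
    let ?E = "{v \<in> carrier V. ?h A v = v}"
    have "LinearCombinations.submodule K ?E V"
    proof (rule linear_submoduleI)
      have "?h A \<zero>\<^bsub>V\<^esub> = (\<Oplus>\<^bsub>V\<^esub>s\<in>A. \<zero>\<^bsub>V\<^esub>)"
        using AV functional_zero[OF \<mu>(1)] by (intro M.finsum_cong') auto
      then show "\<zero>\<^bsub>V\<^esub> \<in> ?E" by simp
      show "x \<oplus>\<^bsub>V\<^esub> y \<in> ?E" if "x \<in> ?E" "y \<in> ?E" for x y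
      proof -
        have xy: "x \<in> carrier V" "y \<in> carrier V" "?h A x = x" "?h A y = y" using that by auto
        have "?h A (x \<oplus>\<^bsub>V\<^esub> y) = (\<Oplus>\<^bsub>V\<^esub>s\<in>A. \<mu> s x \<odot>\<^bsub>V\<^esub> s \<oplus>\<^bsub>V\<^esub> \<mu> s y \<odot>\<^bsub>V\<^esub> s)"
        proof (rule M.finsum_cong')
          fix s assume "s \<in> A"
          then have "s \<in> carrier V" using AV by auto
          then show "\<mu> s (x \<oplus>\<^bsub>V\<^esub> y) \<odot>\<^bsub>V\<^esub> s = \<mu> s x \<odot>\<^bsub>V\<^esub> s \<oplus>\<^bsub>V\<^esub> \<mu> s y \<odot>\<^bsub>V\<^esub> s"
            using xy \<mu>c by (simp add: functionalsD(3)[OF \<mu>(1)] smult_l_distr)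
        qed (use xy AV \<mu>c in auto)
        also have "\<dots> = ?h A x \<oplus>\<^bsub>V\<^esub> ?h A y"
          using xy AV \<mu>c by (intro M.finsum_addf) auto
        finally show ?thesis using xy by simp
      qed
      show "c \<odot>\<^bsub>V\<^esub> x \<in> ?E" if c: "c \<in> carrier K" and x: "x \<in> ?E" for c x
      proof -
        have x: "x \<in> carrier V" "?h A x = x" using x by auto
        have "?h A (c \<odot>\<^bsub>V\<^esub> x) = (\<Oplus>\<^bsub>V\<^esub>s\<in>A. c \<odot>\<^bsub>V\<^esub> (\<mu> s x \<odot>\<^bsub>V\<^esub> s))"
        proof (rule M.finsum_cong')
          fix s assume "s \<in> A"
          then have "s \<in> carrier V" using AV by auto
          then show "\<mu> s (c \<odot>\<^bsub>V\<^esub> x) \<odot>\<^bsub>V\<^esub> s = c \<odot>\<^bsub>V\<^esub> (\<mu> s x \<odot>\<^bsub>V\<^esub> s)"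
            using x c \<mu>c by (simp add: functionalsD(4)[OF \<mu>(1)] smult_assoc1)
        qed (use x c AV \<mu>c in auto)
        also have "\<dots> = c \<odot>\<^bsub>V\<^esub> ?h A x"
          using x c AV \<mu>c A(1) by (intro finsum_smult[symmetric]) auto
        finally show ?thesis using x c by simp
      qed
    qed (use module_axioms in auto)
    moreover have "A \<subseteq> ?E"
    proof
      fix t assume t: "t \<in> A"
      have "?h A t = (\<Oplus>\<^bsub>V\<^esub>s\<in>A. if t = s then s else \<zero>\<^bsub>V\<^esub>)"
        using t AV \<mu>(2) by (intro M.finsum_cong') auto
      also have "\<dots> = t" using t A(1) AV by (intro M.finsum_singleton) auto
      finally show "t \<in> ?E" using t AV by auto
    qed
    ultimately have "span A \<subseteq> ?E" by (intro span_is_subset)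
    then show ?thesis using A(2) v by (auto simp: basis_def)
  qed
  then show ?thesis by (intro finite_rank.cong[OF h]) simp
qed

text \<open>A vector that all functionals kill is killed by all maps of finite rank, among them the identity.\<close>
lemma separating_functional:
  assumes fd: fin_dim and v: "v \<in> carrier V" "v \<noteq> \<zero>\<^bsub>V\<^esub>"
  shows "\<exists>\<mu>\<in>functionals K V. \<mu> v \<noteq> \<zero>\<^bsub>K\<^esub>"
proof (rule ccontr)
  assume n: "\<not> ?thesis"
  have "\<phi> v = \<zero>\<^bsub>V\<^esub>" if "\<phi> \<in> finite_rank K V" for \<phi>
    using that by induction (use v n in auto)
  then show False using identity_finite_rank[OF fd] v by blast
qed

lemma functionals_separate:
  assumes fd: fin_dim and u: "u \<in> carrier V" "w \<in> carrier V"
    and eq: "\<And>\<xi>. \<xi> \<in> functionals K V \<Longrightarrow> \<xi> u = \<xi> w"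
  shows "u = w"
proof (rule ccontr)
  assume "u \<noteq> w"
  then have "u \<ominus>\<^bsub>V\<^esub> w \<noteq> \<zero>\<^bsub>V\<^esub>" using u M.minus_other_side by metis
  then obtain \<xi> where \<xi>: "\<xi> \<in> functionals K V" "\<xi> (u \<ominus>\<^bsub>V\<^esub> w) \<noteq> \<zero>\<^bsub>K\<^esub>"
    using separating_functional[OF fd] u by (meson M.minus_closed)
  have c: "\<xi> (u \<ominus>\<^bsub>V\<^esub> w) \<in> carrier K" "\<xi> w \<in> carrier K"
    using functionalsD(1)[OF \<xi>(1)] u by simp_all
  have "\<xi> ((u \<ominus>\<^bsub>V\<^esub> w) \<oplus>\<^bsub>V\<^esub> w) = \<xi> (u \<ominus>\<^bsub>V\<^esub> w) \<oplus>\<^bsub>K\<^esub> \<xi> w"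
    using u by (intro functionalsD(3)[OF \<xi>(1)]) simp_all
  moreover have "(u \<ominus>\<^bsub>V\<^esub> w) \<oplus>\<^bsub>V\<^esub> w = u" using u by (simp add: M.minus_eq M.a_assoc M.l_neg)
  ultimately have "\<xi> (u \<ominus>\<^bsub>V\<^esub> w) \<oplus>\<^bsub>K\<^esub> \<xi> w = \<xi> w" using eq[OF \<xi>(1)] by simp
  then show False using c \<xi>(2) R.add.r_cancel_one by blast
qed

lemma dual_add_closed:
  assumes f: "f \<in> functionals K V" and g: "g \<in> functionals K V"
  shows "(\<lambda>x\<in>carrier V. f x \<oplus>\<^bsub>K\<^esub> g x) \<in> functionals K V"
  by (rule functionalsI)
    (simp_all add: functionalsD(1,3,4)[OF f] functionalsD(1,3,4)[OF g] R.r_distr R.a_ac)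

lemma dual_smult_closed:
  assumes c: "c \<in> carrier K" and f: "f \<in> functionals K V"
  shows "(\<lambda>x\<in>carrier V. c \<otimes>\<^bsub>K\<^esub> f x) \<in> functionals K V"
  by (rule functionalsI) (simp_all add: c functionalsD(1,3,4)[OF f] R.r_distr R.m_ac)

lemma vectorspace_dual_space: "vectorspace K (dual_space K V)"
proof (rule pointwise_vectorspace[OF vectorspace_scalar_space])
  show "\<zero>\<^bsub>dual_space K V\<^esub> \<in> carrier (dual_space K V)"
    unfolding dual_space_simps by (rule functionalsI) auto
qed (simp_all add: functionalsD(1) functionalsD(5) dual_add_closed dual_smult_closed)

text \<open>If \<open>\<phi>(v) = \<mu>(v) b\<close>, then \<open>F(\<xi> \<circ> \<phi>) = \<xi>(F(\<mu>) b)\<close> for all functionals \<open>\<xi>\<close>. So \<open>\<xi> \<mapsto> F(\<xi> \<circ> \<phi>)\<close> is an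
  evaluation for every \<open>\<phi>\<close> of finite rank, and the identity has finite rank.\<close>
lemma dual_space_reflexive:
  assumes fd: fin_dim and F: "F \<in> functionals K (dual_space K V)"
  obtains v where "v \<in> carrier V" "\<And>\<xi>. \<xi> \<in> functionals K V \<Longrightarrow> F \<xi> = \<xi> v"
proof -
  note FD = functionalsD[OF F, simplified]
  have *: "\<exists>v\<in>carrier V. \<forall>\<xi>\<in>functionals K V. F (\<lambda>x\<in>carrier V. \<xi> (\<phi> x)) = \<xi> v \<and> (\<lambda>x\<in>carrier V. \<xi> (\<phi> x)) \<in> functionals K V"
    if "\<phi> \<in> finite_rank K V" for \<phi>
    using that
  proof induction
    case zero
    have "F (\<lambda>x\<in>carrier V. \<zero>\<^bsub>K\<^esub>) = \<zero>\<^bsub>K\<^esub>"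
      using vectorspace.functional_zero[OF vectorspace_dual_space F] by simp
    moreover have "(\<lambda>x\<in>carrier V. \<zero>\<^bsub>K\<^esub>) \<in> functionals K V" by (rule functionalsI) auto
    ultimately show ?case
      by (intro bexI[of _ "\<zero>\<^bsub>V\<^esub>"] ballI) (simp_all only: functional_zero M.zero_closed)
  next
    case (rank_one \<mu> b)
    have Fc: "F \<mu> \<in> carrier K" using FD(1) rank_one by auto
    have "F (\<lambda>x\<in>carrier V. \<xi> (\<mu> x \<odot>\<^bsub>V\<^esub> b)) = \<xi> (F \<mu> \<odot>\<^bsub>V\<^esub> b) \<and> (\<lambda>x\<in>carrier V. \<xi> (\<mu> x \<odot>\<^bsub>V\<^esub> b)) \<in> functionals K V"
      if x: "\<xi> \<in> functionals K V" for \<xi>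
    proof -
      have xb: "\<xi> b \<in> carrier K" using functionalsD(1)[OF x] rank_one by auto
      have e: "(\<lambda>x\<in>carrier V. \<xi> (\<mu> x \<odot>\<^bsub>V\<^esub> b)) = (\<lambda>x\<in>carrier V. \<xi> b \<otimes>\<^bsub>K\<^esub> \<mu> x)"
        using rank_one x xb functionalsD[OF x] functionalsD(1)[OF rank_one(1)] by (auto simp: R.m_comm)
      have "F (\<lambda>x\<in>carrier V. \<xi> b \<otimes>\<^bsub>K\<^esub> \<mu> x) = \<xi> b \<otimes>\<^bsub>K\<^esub> F \<mu>" using FD(4)[OF xb rank_one(1)] .
      then show ?thesis
        unfolding e functionalsD(4)[OF x Fc rank_one(2)]
        using dual_smult_closed[OF xb rank_one(1)] R.m_comm[OF Fc xb] by (simp only: simp_thms)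
    qed
    then show ?case using smult_closed[OF Fc rank_one(2)] by (intro bexI[of _ "F \<mu> \<odot>\<^bsub>V\<^esub> b"] ballI)
  next
    case (add \<phi> \<psi>)
    have cl: "\<phi> x \<in> carrier V" if "\<phi> \<in> finite_rank K V" "x \<in> carrier V" for \<phi> x
      using that by induction (simp_all add: functionalsD(1))
    from add.IH obtain v w where v: "v \<in> carrier V" "w \<in> carrier V"
      "\<And>\<xi>. \<xi> \<in> functionals K V \<Longrightarrow> F (\<lambda>x\<in>carrier V. \<xi> (\<phi> x)) = \<xi> v"
      "\<And>\<xi>. \<xi> \<in> functionals K V \<Longrightarrow> (\<lambda>x\<in>carrier V. \<xi> (\<phi> x)) \<in> functionals K V"
      "\<And>\<xi>. \<xi> \<in> functionals K V \<Longrightarrow> F (\<lambda>x\<in>carrier V. \<xi> (\<psi> x)) = \<xi> w"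
      "\<And>\<xi>. \<xi> \<in> functionals K V \<Longrightarrow> (\<lambda>x\<in>carrier V. \<xi> (\<psi> x)) \<in> functionals K V" by metis
    have "F (\<lambda>x\<in>carrier V. \<xi> (\<phi> x \<oplus>\<^bsub>V\<^esub> \<psi> x)) = \<xi> (v \<oplus>\<^bsub>V\<^esub> w) \<and>
        (\<lambda>x\<in>carrier V. \<xi> (\<phi> x \<oplus>\<^bsub>V\<^esub> \<psi> x)) \<in> functionals K V" if x: "\<xi> \<in> functionals K V" for \<xi>
    proof -
      have e: "(\<lambda>x\<in>carrier V. \<xi> (\<phi> x \<oplus>\<^bsub>V\<^esub> \<psi> x)) =
        (\<lambda>x\<in>carrier V. (\<lambda>x\<in>carrier V. \<xi> (\<phi> x)) x \<oplus>\<^bsub>K\<^esub> (\<lambda>x\<in>carrier V. \<xi> (\<psi> x)) x)"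
        using cl add.hyps functionalsD(3)[OF x] by auto
      show ?thesis
        unfolding e functionalsD(3)[OF x v(1,2)]
        using FD(3)[OF v(4)[OF x] v(6)[OF x]] dual_add_closed[OF v(4)[OF x] v(6)[OF x]]
        unfolding v(3)[OF x] v(5)[OF x] by (simp only: simp_thms)
    qed
    then show ?case using M.a_closed[OF v(1,2)] by (intro bexI[of _ "v \<oplus>\<^bsub>V\<^esub> w"] ballI)
  next
    case (cong \<phi> \<psi>)
    have "(\<lambda>x\<in>carrier V. \<xi> (\<psi> x)) = (\<lambda>x\<in>carrier V. \<xi> (\<phi> x))" for \<xi> :: "_ \<Rightarrow> 'a" using cong(2) by auto
    then show ?case using cong.IH by simp
  qed
  from *[OF identity_finite_rank[OF fd]] obtain v where v: "v \<in> carrier V"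
    "\<And>\<xi>. \<xi> \<in> functionals K V \<Longrightarrow> F (\<lambda>x\<in>carrier V. \<xi> x) = \<xi> v" by blast
  have "(\<lambda>x\<in>carrier V. \<xi> x) = \<xi>" if "\<xi> \<in> functionals K V" for \<xi>
    using functionalsD(5)[OF that] by (rule extensional_restrict)
  then show thesis using that v by metis
qed

end

text \<open>Generators of the kernel together with preimages of generators of the image generate.\<close>
lemma fin_dim_extension:
  assumes V: "vectorspace K V" and W: "vectorspace K W" "vectorspace.fin_dim K W"
    and f: "f \<in> LinearCombinations.module_hom K V W"
    and ker: "vectorspace.fin_dim K (V\<lparr>carrier := {v \<in> carrier V. f v = \<zero>\<^bsub>W\<^esub>}\<rparr>)"
  shows "vectorspace.fin_dim K V"
proof -
  interpret V: vectorspace K V by fact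
  interpret W: vectorspace K W by fact
  interpret f: linear_map K V W f by unfold_locales (rule f)
  let ?N = "{v \<in> carrier V. f v = \<zero>\<^bsub>W\<^esub>}"
  have N: "LinearCombinations.submodule K ?N V" using f.ker_is_submodule unfolding f.ker_def .
  interpret N: vectorspace K "V\<lparr>carrier := ?N\<rparr>" by (rule V.subspace_vs[OF N])
  have I: "LinearCombinations.submodule K (f ` carrier V) W"
    using f.im_is_submodule unfolding f.im_def .
  obtain S where S: "finite S" "S \<subseteq> ?N" "N.span S = ?N" using ker unfolding N.fin_dim_def by auto
  obtain R where R: "finite R" "R \<subseteq> f ` carrier V" "W.span R = f ` carrier V"
    by (rule W.basis_of_subspace[OF W(2) I])
  obtain R' where R': "finite R'" "R' \<subseteq> carrier V" "R = f ` R'"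
    using finite_subset_image[OF R(1,2)] by blast
  let ?U = "V.span (S \<union> R')"
  have SR: "S \<union> R' \<subseteq> carrier V" using S R' by auto
  have U: "LinearCombinations.submodule K ?U V" by (rule V.span_is_submodule[OF SR])
  have own: "S \<union> R' \<subseteq> ?U" by (rule V.in_own_span[OF SR])
  have NU: "?N \<subseteq> ?U"
    using V.span_li_not_depend(1)[OF S(2) N] S(3) V.span_is_subset[OF _ U, of S] own by simp
  have "LinearCombinations.submodule K (f ` ?U) W"
  proof (rule linear_submoduleI)
    show "f ` ?U \<subseteq> carrier W" using submodule.subset[OF U] by auto
    show "\<zero>\<^bsub>W\<^esub> \<in> f ` ?U" using submodule.zero_closed[OF U] f.f0_is_0 by (metis imageI)
    show "x \<oplus>\<^bsub>W\<^esub> y \<in> f ` ?U" if xy: "x \<in> f ` ?U" "y \<in> f ` ?U" for x y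
    proof -
      obtain u v where uv: "u \<in> ?U" "v \<in> ?U" "x = f u" "y = f v" using xy by (elim imageE)
      have "x \<oplus>\<^bsub>W\<^esub> y = f (u \<oplus>\<^bsub>V\<^esub> v)"
        unfolding uv(3,4) by (rule f.f_add[symmetric]) (use uv submodule.subset[OF U] in auto)
      then show ?thesis using submodule.m_closed[OF U uv(1,2)] by (simp only: imageI)
    qed
    show "c \<odot>\<^bsub>W\<^esub> x \<in> f ` ?U" if c: "c \<in> carrier K" and x: "x \<in> f ` ?U" for c x
    proof -
      obtain u where u: "u \<in> ?U" "x = f u" using x by (elim imageE)
      have "c \<odot>\<^bsub>W\<^esub> x = f (c \<odot>\<^bsub>V\<^esub> u)"
        unfolding u(2) by (rule f.f_smult[symmetric]) (use c u submodule.subset[OF U] in auto)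
      then show ?thesis using submodule.smult_closed[OF U c u(1)] by (simp only: imageI)
    qed
  qed (rule W.module_axioms)
  moreover have "R \<subseteq> f ` ?U" using own R'(3) by auto
  ultimately have im: "f ` carrier V \<subseteq> f ` ?U" using W.span_is_subset R(3) by metis
  have "v \<in> ?U" if v: "v \<in> carrier V" for v
  proof -
    obtain u where u: "u \<in> ?U" "f v = f u" using im v by blast
    have uc: "u \<in> carrier V" using u submodule.subset[OF U] by blast
    have "v \<ominus>\<^bsub>V\<^esub> u \<in> ?N" using u uc v by (simp add: W.M.minus_eq W.M.r_neg)
    then have "(v \<ominus>\<^bsub>V\<^esub> u) \<oplus>\<^bsub>V\<^esub> u \<in> ?U" using NU u submodule.m_closed[OF U] by blast
    then show ?thesis using v uc by (simp add: V.M.minus_eq V.M.a_assoc V.M.l_neg)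
  qed
  then have "V.gen_set (S \<union> R')" using submodule.subset[OF U] by blast
  then show ?thesis unfolding V.fin_dim_def using S(1) R'(1) SR by blast
qed

text \<open>The form of finite dimensionality that suits spaces of maps: evaluations at finitely many generators
  are jointly injective.\<close>
lemma fin_dim_jointly_injective:
  assumes V: "vectorspace K V" and W: "vectorspace K W" "vectorspace.fin_dim K W"
    and F: "finite F" "F \<subseteq> LinearCombinations.module_hom K V W"
    and inj: "\<And>v. v \<in> carrier V \<Longrightarrow> (\<And>f. f \<in> F \<Longrightarrow> f v = \<zero>\<^bsub>W\<^esub>) \<Longrightarrow> v = \<zero>\<^bsub>V\<^esub>"
  shows "vectorspace.fin_dim K V"
  using F(1) V F(2) inj
proof (induction F arbitrary: V rule: finite_induct)
  case (empty V)
  interpret V: vectorspace K V by fact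
  have "carrier V = {\<zero>\<^bsub>V\<^esub>}" using empty by auto
  then have "V.gen_set {}" using V.span_empty by simp
  then show ?case unfolding V.fin_dim_def by blast
next
  case (insert f F V)
  interpret V: vectorspace K V by (rule insert.prems)
  interpret W: vectorspace K W by (rule W)
  interpret f: linear_map K V W f by unfold_locales (use insert.prems in auto)
  let ?N = "{v \<in> carrier V. f v = \<zero>\<^bsub>W\<^esub>}"
  have N: "LinearCombinations.submodule K ?N V" using f.ker_is_submodule unfolding f.ker_def .
  show ?case
  proof (rule fin_dim_extension[OF insert.prems(1) W f.f_hom])
    show "vectorspace.fin_dim K (V\<lparr>carrier := ?N\<rparr>)"
    proof (rule insert.IH)
      show "vectorspace K (V\<lparr>carrier := ?N\<rparr>)" by (rule V.subspace_vs[OF N])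
      show "F \<subseteq> LinearCombinations.module_hom K (V\<lparr>carrier := ?N\<rparr>) W"
        using insert.prems(2) by (auto simp: LinearCombinations.module_hom_def)
      show "v = \<zero>\<^bsub>V\<lparr>carrier := ?N\<rparr>\<^esub>" if "v \<in> carrier (V\<lparr>carrier := ?N\<rparr>)" "\<And>g. g \<in> F \<Longrightarrow> g v = \<zero>\<^bsub>W\<^esub>" for v
        using that insert.prems(3)[of v] by auto
    qed
  qed
qed

lemma fin_dim_dual_space:
  assumes V: "vectorspace K V" and fd: "vectorspace.fin_dim K V"
  shows "vectorspace.fin_dim K (dual_space K V)"
proof -
  interpret V: vectorspace K V by fact
  obtain A where A: "finite A" "A \<subseteq> carrier V" "V.gen_set A" using fd unfolding V.fin_dim_def by blast
  show ?thesis
  proof (rule fin_dim_jointly_injective[OF V.vectorspace_dual_space V.vectorspace_scalar_space V.fin_dim_scalar_space])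
    show "finite ((\<lambda>a f. f a) ` A)" using A by simp
    show "(\<lambda>a f. f a) ` A \<subseteq> LinearCombinations.module_hom K (dual_space K V) (scalar_space K)"
      by (rule subsetI, elim imageE)
        (simp add: LinearCombinations.module_hom_def Pi_iff functionalsD(1) subsetD[OF A(2)])
    fix f assume f: "f \<in> carrier (dual_space K V)" and z: "\<And>g. g \<in> (\<lambda>a f. f a) ` A \<Longrightarrow> g f = \<zero>\<^bsub>scalar_space K\<^esub>"
    have f: "f \<in> functionals K V" using f by simp
    interpret S: vectorspace K "scalar_space K" by (rule V.vectorspace_scalar_space)
    interpret f: linear_map K V "scalar_space K" f by unfold_locales (rule functionals_hom[OF f])
    have "A \<subseteq> f.ker" using z A(2) by (auto simp: f.ker_def)
    then have "V.span A \<subseteq> f.ker" by (rule V.span_is_subset[OF _ f.ker_is_submodule])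
    then have "f x = \<zero>\<^bsub>K\<^esub>" if "x \<in> carrier V" for x using that A(3) by (auto simp: f.ker_def)
    then show "f = \<zero>\<^bsub>dual_space K V\<^esub>"
      using functionalsD(2)[OF f] by (auto simp: fun_eq_iff restrict_def)
  qed
qed

section \<open>Homomorphisms, submodules and short exact sequences\<close>

lemma rmod_homI:
  assumes "\<And>x. x \<in> carrier M \<Longrightarrow> f x \<in> carrier N"
    and "\<And>x y. x \<in> carrier M \<Longrightarrow> y \<in> carrier M \<Longrightarrow> f (x \<oplus>\<^bsub>M\<^esub> y) = f x \<oplus>\<^bsub>N\<^esub> f y"
    and "\<And>c x. c \<in> carrier K \<Longrightarrow> x \<in> carrier M \<Longrightarrow> f (c \<odot>\<^bsub>M\<^esub> x) = c \<odot>\<^bsub>N\<^esub> f x"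
    and "\<And>x a. x \<in> carrier M \<Longrightarrow> a \<in> carrier A \<Longrightarrow> f (x \<cdot>\<^bsub>M\<^esub> a) = f x \<cdot>\<^bsub>N\<^esub> a"
  shows "f \<in> rmod_hom K A M N"
  using assms by (auto simp: rmod_hom_def LinearCombinations.module_hom_def)

lemma rmod_homD:
  assumes "f \<in> rmod_hom K A M N"
  shows "\<And>x. x \<in> carrier M \<Longrightarrow> f x \<in> carrier N"
    and "\<And>x y. x \<in> carrier M \<Longrightarrow> y \<in> carrier M \<Longrightarrow> f (x \<oplus>\<^bsub>M\<^esub> y) = f x \<oplus>\<^bsub>N\<^esub> f y"
    and "\<And>c x. c \<in> carrier K \<Longrightarrow> x \<in> carrier M \<Longrightarrow> f (c \<odot>\<^bsub>M\<^esub> x) = c \<odot>\<^bsub>N\<^esub> f x"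
    and "\<And>x a. x \<in> carrier M \<Longrightarrow> a \<in> carrier A \<Longrightarrow> f (x \<cdot>\<^bsub>M\<^esub> a) = f x \<cdot>\<^bsub>N\<^esub> a"
    and "f \<in> LinearCombinations.module_hom K M N"
  using assms by (auto simp: rmod_hom_def LinearCombinations.module_hom_def)

lemma fdm_closed:
  assumes "fd_right_module K A M"
  shows "\<zero>\<^bsub>M\<^esub> \<in> carrier M"
    and "\<And>x y. x \<in> carrier M \<Longrightarrow> y \<in> carrier M \<Longrightarrow> x \<oplus>\<^bsub>M\<^esub> y \<in> carrier M"
    and "\<And>x y. x \<in> carrier M \<Longrightarrow> y \<in> carrier M \<Longrightarrow> x \<ominus>\<^bsub>M\<^esub> y \<in> carrier M"
    and "\<And>c x. c \<in> carrier K \<Longrightarrow> x \<in> carrier M \<Longrightarrow> c \<odot>\<^bsub>M\<^esub> x \<in> carrier M"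
    and "\<And>x a. x \<in> carrier M \<Longrightarrow> a \<in> carrier A \<Longrightarrow> x \<cdot>\<^bsub>M\<^esub> a \<in> carrier M"
proof -
  interpret M: fd_right_module K A M by fact
  show "\<zero>\<^bsub>M\<^esub> \<in> carrier M"
    and "\<And>x y. x \<in> carrier M \<Longrightarrow> y \<in> carrier M \<Longrightarrow> x \<oplus>\<^bsub>M\<^esub> y \<in> carrier M"
    and "\<And>x y. x \<in> carrier M \<Longrightarrow> y \<in> carrier M \<Longrightarrow> x \<ominus>\<^bsub>M\<^esub> y \<in> carrier M"
    and "\<And>c x. c \<in> carrier K \<Longrightarrow> x \<in> carrier M \<Longrightarrow> c \<odot>\<^bsub>M\<^esub> x \<in> carrier M"
    and "\<And>x a. x \<in> carrier M \<Longrightarrow> a \<in> carrier A \<Longrightarrow> x \<cdot>\<^bsub>M\<^esub> a \<in> carrier M"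
    by (auto intro: M.ract_closed)
qed

lemma fdm_zero_ract:
  assumes "fd_right_module K A M" "a \<in> carrier A"
  shows "\<zero>\<^bsub>M\<^esub> \<cdot>\<^bsub>M\<^esub> a = \<zero>\<^bsub>M\<^esub>"
proof -
  interpret M: fd_right_module K A M by fact
  have "(\<zero>\<^bsub>K\<^esub> \<odot>\<^bsub>M\<^esub> \<zero>\<^bsub>M\<^esub>) \<cdot>\<^bsub>M\<^esub> a = \<zero>\<^bsub>K\<^esub> \<odot>\<^bsub>M\<^esub> (\<zero>\<^bsub>M\<^esub> \<cdot>\<^bsub>M\<^esub> a)"
    using assms(2) by (intro M.smult_ract) auto
  then show ?thesis using M.ract_closed[OF M.M.zero_closed assms(2)] by simp
qed

lemma fdm_diff_eq_zero:
  assumes "fd_right_module K A M" "x \<in> carrier M" "y \<in> carrier M"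
  shows "x \<ominus>\<^bsub>M\<^esub> y = \<zero>\<^bsub>M\<^esub> \<longleftrightarrow> x = y"
proof -
  interpret M: fd_right_module K A M by fact
  show ?thesis using assms by (metis M.M.minus_eq M.M.minus_equality M.M.minus_minus M.M.r_neg M.M.a_inv_closed)
qed

lemma fdm_diff_add_cancel:
  assumes "fd_right_module K A M" "x \<in> carrier M" "y \<in> carrier M"
  shows "y \<oplus>\<^bsub>M\<^esub> (x \<ominus>\<^bsub>M\<^esub> y) = x"
proof -
  interpret M: fd_right_module K A M by fact
  show ?thesis using assms
    by (simp add: M.M.minus_eq M.M.a_lcomm[of y x] M.M.r_neg)
qed

lemma hom_linear_map:
  assumes "fd_right_module K A M" "fd_right_module K A N" "f \<in> rmod_hom K A M N"
  shows "linear_map K M N f"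
proof -
  interpret M: fd_right_module K A M by fact
  interpret N: fd_right_module K A N by fact
  show ?thesis by unfold_locales (rule rmod_homD(5)[OF assms(3)])
qed

lemma hom_zero:
  assumes "fd_right_module K A M" "fd_right_module K A N" "f \<in> rmod_hom K A M N"
  shows "f \<zero>\<^bsub>M\<^esub> = \<zero>\<^bsub>N\<^esub>"
proof -
  interpret f: linear_map K M N f by (rule hom_linear_map[OF assms])
  show ?thesis by simp
qed

lemma hom_minus:
  assumes "fd_right_module K A M" "fd_right_module K A N" "f \<in> rmod_hom K A M N"
    and "x \<in> carrier M" "y \<in> carrier M"
  shows "f (x \<ominus>\<^bsub>M\<^esub> y) = f x \<ominus>\<^bsub>N\<^esub> f y"
proof -
  interpret f: linear_map K M N f by (rule hom_linear_map[OF assms(1-3)])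
  show ?thesis using assms(4,5) by simp
qed

lemma hom_injI:
  assumes M: "fd_right_module K A M" and N: "fd_right_module K A N" and f: "f \<in> rmod_hom K A M N"
    and ker: "\<And>x. x \<in> carrier M \<Longrightarrow> f x = \<zero>\<^bsub>N\<^esub> \<Longrightarrow> x = \<zero>\<^bsub>M\<^esub>"
  shows "inj_on f (carrier M)"
proof
  fix x y assume xy: "x \<in> carrier M" "y \<in> carrier M" "f x = f y"
  have "f (x \<ominus>\<^bsub>M\<^esub> y) = \<zero>\<^bsub>N\<^esub>"
    using hom_minus[OF M N f xy(1,2)] xy fdm_diff_eq_zero[OF N rmod_homD(1)[OF f xy(1)] rmod_homD(1)[OF f xy(2)]]
    by simp
  then have "x \<ominus>\<^bsub>M\<^esub> y = \<zero>\<^bsub>M\<^esub>" using ker fdm_closed(3)[OF M xy(1,2)] by blast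
  then show "x = y" using fdm_diff_eq_zero[OF M xy(1,2)] by simp
qed

lemma hom_id: "(\<lambda>x. x) \<in> rmod_hom K A M M"
  by (rule rmod_homI) auto

lemma hom_comp:
  assumes "f \<in> rmod_hom K A M N" "g \<in> rmod_hom K A N L"
  shows "(\<lambda>x. g (f x)) \<in> rmod_hom K A M L"
  by (rule rmod_homI)
    (simp_all add: rmod_homD(1-4)[OF assms(1)] rmod_homD(1-4)[OF assms(2)])

lemma hom_cong:
  assumes M: "fd_right_module K A M" and f: "f \<in> rmod_hom K A M N"
    and eq: "\<And>x. x \<in> carrier M \<Longrightarrow> g x = f x"
  shows "g \<in> rmod_hom K A M N"
  by (rule rmod_homI) (simp_all add: eq fdm_closed[OF M] rmod_homD(1-4)[OF f])

lemma hom_zero_map: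
  assumes "fd_right_module K A N"
  shows "(\<lambda>x. \<zero>\<^bsub>N\<^esub>) \<in> rmod_hom K A M N"
proof -
  interpret N: fd_right_module K A N by fact
  show ?thesis by (rule rmod_homI) (simp_all add: fdm_zero_ract[OF assms])
qed

lemma hom_add:
  assumes N: "fd_right_module K A N" and f: "f \<in> rmod_hom K A M N" and g: "g \<in> rmod_hom K A M N"
  shows "(\<lambda>x. f x \<oplus>\<^bsub>N\<^esub> g x) \<in> rmod_hom K A M N"
proof -
  interpret N: fd_right_module K A N by fact
  show ?thesis
    by (rule rmod_homI)
      (simp_all add: rmod_homD(1-4)[OF f] rmod_homD(1-4)[OF g] N.ract_add_left N.smult_r_distr N.M.a_ac)
qed

lemma hom_diff:
  assumes M: "fd_right_module K A M" and N: "fd_right_module K A N"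
    and f: "f \<in> rmod_hom K A M N" and g: "g \<in> rmod_hom K A M N"
  shows "(\<lambda>x. f x \<ominus>\<^bsub>N\<^esub> g x) \<in> rmod_hom K A M N"
proof -
  interpret N: fd_right_module K A N by fact
  have "(\<lambda>x. (\<ominus>\<^bsub>K\<^esub> \<one>\<^bsub>K\<^esub>) \<odot>\<^bsub>N\<^esub> g x) \<in> rmod_hom K A M N"
    by (rule rmod_homI) (simp_all add: rmod_homD(1-4)[OF g] N.smult_r_distr N.smult_ract
        N.smult_assoc1[symmetric] N.R.m_comm del: N.smult_minus_1)
  from hom_add[OF N f this] show ?thesis
    by (rule hom_cong[OF M]) (simp add: N.M.minus_eq N.smult_minus_1 rmod_homD(1)[OF g])
qed

lemma hom_inv:
  assumes f: "f \<in> rmod_hom K A M N" and bij: "bij_betw f (carrier M) (carrier N)"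
    and M: "fd_right_module K A M"
  obtains g where "g \<in> rmod_hom K A N M" "\<And>x. x \<in> carrier M \<Longrightarrow> g (f x) = x"
    "\<And>y. y \<in> carrier N \<Longrightarrow> f (g y) = y"
proof -
  let ?g = "inv_into (carrier M) f"
  have inj: "inj_on f (carrier M)" and im: "f ` carrier M = carrier N"
    using bij by (simp_all add: bij_betw_def)
  have gc: "?g y \<in> carrier M" if "y \<in> carrier N" for y using that im by (metis inv_into_into)
  have fg: "f (?g y) = y" if "y \<in> carrier N" for y using that im by (metis f_inv_into_f)
  have gf: "?g (f x) = x" if "x \<in> carrier M" for x using that inj by simp
  have "?g \<in> rmod_hom K A N M"
  proof (rule rmod_homI)
    fix x y assume "x \<in> carrier N" "y \<in> carrier N"
    then show "?g (x \<oplus>\<^bsub>N\<^esub> y) = ?g x \<oplus>\<^bsub>M\<^esub> ?g y"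
      using gf[of "?g x \<oplus>\<^bsub>M\<^esub> ?g y"] rmod_homD(2)[OF f, of "?g x" "?g y"] gc fg fdm_closed(2)[OF M] by simp
  next
    fix c x assume "c \<in> carrier K" "x \<in> carrier N"
    then show "?g (c \<odot>\<^bsub>N\<^esub> x) = c \<odot>\<^bsub>M\<^esub> ?g x"
      using gf[of "c \<odot>\<^bsub>M\<^esub> ?g x"] rmod_homD(3)[OF f, of c "?g x"] gc fg fdm_closed(4)[OF M] by simp
  next
    fix x a assume "x \<in> carrier N" "a \<in> carrier A"
    then show "?g (x \<cdot>\<^bsub>N\<^esub> a) = ?g x \<cdot>\<^bsub>M\<^esub> a"
      using gf[of "?g x \<cdot>\<^bsub>M\<^esub> a"] rmod_homD(4)[OF f, of "?g x" a] gc fg fdm_closed(5)[OF M] by simp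
  qed (rule gc)
  then show thesis using that gf fg by blast
qed

lemma rsubmoduleI:
  assumes M: "fd_right_module K A M" and "S \<subseteq> carrier M" "\<zero>\<^bsub>M\<^esub> \<in> S"
    "\<And>x y. x \<in> S \<Longrightarrow> y \<in> S \<Longrightarrow> x \<oplus>\<^bsub>M\<^esub> y \<in> S"
    "\<And>c x. c \<in> carrier K \<Longrightarrow> x \<in> S \<Longrightarrow> c \<odot>\<^bsub>M\<^esub> x \<in> S"
    "\<And>x a. x \<in> S \<Longrightarrow> a \<in> carrier A \<Longrightarrow> x \<cdot>\<^bsub>M\<^esub> a \<in> S"
  shows "rsubmodule K A M S"
proof -
  interpret M: fd_right_module K A M by fact
  show ?thesis unfolding rsubmodule_def
    using assms(2-) by (intro conjI linear_submoduleI ballI) (auto intro: M.module_axioms)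
qed

lemma rsubmoduleD:
  assumes "rsubmodule K A M S"
  shows "S \<subseteq> carrier M" "\<zero>\<^bsub>M\<^esub> \<in> S"
    "\<And>x y. x \<in> S \<Longrightarrow> y \<in> S \<Longrightarrow> x \<oplus>\<^bsub>M\<^esub> y \<in> S"
    "\<And>c x. c \<in> carrier K \<Longrightarrow> x \<in> S \<Longrightarrow> c \<odot>\<^bsub>M\<^esub> x \<in> S"
    "\<And>x a. x \<in> S \<Longrightarrow> a \<in> carrier A \<Longrightarrow> x \<cdot>\<^bsub>M\<^esub> a \<in> S"
    "LinearCombinations.submodule K S M"
  using assms unfolding rsubmodule_def submodule_def by auto

lemma submodule_fdm:
  assumes M: "fd_right_module K A M" and S: "rsubmodule K A M S"
  shows "fd_right_module K A (M\<lparr>carrier := S\<rparr>)"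
proof -
  interpret M: fd_right_module K A M by fact
  note S' = rsubmoduleD[OF S]
  show ?thesis
  proof (intro fd_right_module.intro fd_right_module_axioms.intro)
    show "vectorspace K (M\<lparr>carrier := S\<rparr>)" by (rule M.subspace_vs[OF S'(6)])
    show "vectorspace.fin_dim K (M\<lparr>carrier := S\<rparr>)" by (rule M.subspace_fin_dim[OF M.fin_dim_module S'(6)])
    show "fd_algebra K A" by (rule M.fd_algebra)
  qed (use S' in \<open>auto simp: M.ract_add_left M.ract_add_right M.ract_mult M.ract_one M.ract_smult M.smult_ract subset_iff\<close>)
qed

lemma hom_from_submodule:
  "f \<in> rmod_hom K A M N \<Longrightarrow> S \<subseteq> carrier M \<Longrightarrow> f \<in> rmod_hom K A (M\<lparr>carrier := S\<rparr>) N"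
  by (rule rmod_homI) (auto simp: rmod_homD(1-4) subset_iff)

lemma hom_to_submodule:
  assumes f: "f \<in> rmod_hom K A M N" and "\<And>x. x \<in> carrier M \<Longrightarrow> f x \<in> S"
  shows "f \<in> rmod_hom K A M (N\<lparr>carrier := S\<rparr>)"
  using assms(2) by (intro rmod_homI) (simp_all add: rmod_homD(2-4)[OF f])

lemma hom_inclusion: "S \<subseteq> carrier M \<Longrightarrow> (\<lambda>x. x) \<in> rmod_hom K A (M\<lparr>carrier := S\<rparr>) M"
  by (rule hom_from_submodule[OF hom_id])

lemma ker_rsubmodule:
  assumes M: "fd_right_module K A M" and N: "fd_right_module K A N" and f: "f \<in> rmod_hom K A M N"
  shows "rsubmodule K A M {x \<in> carrier M. f x = \<zero>\<^bsub>N\<^esub>}"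
proof -
  interpret N: fd_right_module K A N by fact
  show ?thesis
    by (rule rsubmoduleI[OF M]) (auto simp: hom_zero[OF M N f] rmod_homD(1-4)[OF f] fdm_closed[OF M]
        fdm_zero_ract[OF N])
qed

lemma im_rsubmodule:
  assumes M: "fd_right_module K A M" and N: "fd_right_module K A N" and f: "f \<in> rmod_hom K A M N"
    and S: "rsubmodule K A M S"
  shows "rsubmodule K A N (f ` S)"
proof (rule rsubmoduleI[OF N])
  note S' = rsubmoduleD[OF S]
  have SM: "x \<in> carrier M" if "x \<in> S" for x using S'(1) that by blast
  show "\<zero>\<^bsub>N\<^esub> \<in> f ` S" using hom_zero[OF M N f] S'(2) by (metis imageI)
  show "f ` S \<subseteq> carrier N" using rmod_homD(1)[OF f] SM by auto
  show "x \<oplus>\<^bsub>N\<^esub> y \<in> f ` S" if "x \<in> f ` S" "y \<in> f ` S" for x y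
    using that S'(3) by (auto simp: SM rmod_homD(2)[OF f, symmetric])
  show "c \<odot>\<^bsub>N\<^esub> x \<in> f ` S" if "c \<in> carrier K" "x \<in> f ` S" for c x
    using that S'(4) by (auto simp: SM rmod_homD(3)[OF f, symmetric])
  show "x \<cdot>\<^bsub>N\<^esub> a \<in> f ` S" if "x \<in> f ` S" "a \<in> carrier A" for x a
    using that S'(5) by (auto simp: SM rmod_homD(4)[OF f, symmetric])
qed

lemma carrier_rsubmodule: "fd_right_module K A M \<Longrightarrow> rsubmodule K A M (carrier M)"
  by (rule rsubmoduleI) (auto simp: fdm_closed)

definition ses ::
    "'k ring \<Rightarrow> ('k, 'a) module \<Rightarrow> ('k, 'a, 'y) rmodule \<Rightarrow> ('k, 'a, 'p) rmodule \<Rightarrow> ('k, 'a, 'w) rmodule \<Rightarrow>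
     ('y \<Rightarrow> 'p) \<Rightarrow> ('p \<Rightarrow> 'w) \<Rightarrow> bool"
  where "ses K A Y P W i p \<longleftrightarrow>
    fd_right_module K A Y \<and> fd_right_module K A P \<and> fd_right_module K A W \<and>
    i \<in> rmod_hom K A Y P \<and> inj_on i (carrier Y) \<and>
    p \<in> rmod_hom K A P W \<and> p ` carrier P = carrier W \<and>
    (\<forall>x\<in>carrier P. p x = \<zero>\<^bsub>W\<^esub> \<longleftrightarrow> x \<in> i ` carrier Y)"

lemma sesD:
  assumes "ses K A Y P W i p"
  shows "fd_right_module K A Y" "fd_right_module K A P" "fd_right_module K A W"
    "i \<in> rmod_hom K A Y P" "inj_on i (carrier Y)" "p \<in> rmod_hom K A P W" "p ` carrier P = carrier W"
    "\<And>x. x \<in> carrier P \<Longrightarrow> p x = \<zero>\<^bsub>W\<^esub> \<longleftrightarrow> x \<in> i ` carrier Y"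
    "\<And>y. y \<in> carrier Y \<Longrightarrow> p (i y) = \<zero>\<^bsub>W\<^esub>"
  using assms unfolding ses_def by (auto dest: rmod_homD(1))

text \<open>The universal property of the cokernel.\<close>
lemma ses_factor:
  assumes s: "ses K A Y P W i p" and Z: "fd_right_module K A Z" and h: "h \<in> rmod_hom K A P Z"
    and z: "\<And>y. y \<in> carrier Y \<Longrightarrow> h (i y) = \<zero>\<^bsub>Z\<^esub>"
  obtains t where "t \<in> rmod_hom K A W Z" "\<And>x. x \<in> carrier P \<Longrightarrow> t (p x) = h x"
proof -
  note S = sesD[OF s]
  have eq: "h x = h x'" if "x \<in> carrier P" "x' \<in> carrier P" "p x = p x'" for x x'
  proof -
    have "p (x \<ominus>\<^bsub>P\<^esub> x') = \<zero>\<^bsub>W\<^esub>"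
      using hom_minus[OF S(2,3,6) that(1,2)] that rmod_homD(1)[OF S(6)] fdm_diff_eq_zero[OF S(3)] by simp
    then have "h (x \<ominus>\<^bsub>P\<^esub> x') = \<zero>\<^bsub>Z\<^esub>"
      using S(8) z fdm_closed(3)[OF S(2) that(1,2)] by fastforce
    then show ?thesis
      using hom_minus[OF S(2) Z h that(1,2)] that rmod_homD(1)[OF h] fdm_diff_eq_zero[OF Z] by simp
  qed
  define r where "r = inv_into (carrier P) p"
  have r: "r w \<in> carrier P" "p (r w) = w" if "w \<in> carrier W" for w
    using that S(7) unfolding r_def by (metis inv_into_into, metis f_inv_into_f)
  have t: "h (r (p x)) = h x" if "x \<in> carrier P" for x
    by (rule eq) (use that r rmod_homD(1)[OF S(6)] in auto)
  have "(\<lambda>w. h (r w)) \<in> rmod_hom K A W Z"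
  proof (rule rmod_homI)
    fix x y assume "x \<in> carrier W" "y \<in> carrier W"
    then show "h (r (x \<oplus>\<^bsub>W\<^esub> y)) = h (r x) \<oplus>\<^bsub>Z\<^esub> h (r y)"
      using t[of "r x \<oplus>\<^bsub>P\<^esub> r y"] r fdm_closed[OF S(2)] by (simp add: rmod_homD(2)[OF S(6)] rmod_homD(2)[OF h])
  next
    fix c x assume "c \<in> carrier K" "x \<in> carrier W"
    then show "h (r (c \<odot>\<^bsub>W\<^esub> x)) = c \<odot>\<^bsub>Z\<^esub> h (r x)"
      using t[of "c \<odot>\<^bsub>P\<^esub> r x"] r fdm_closed[OF S(2)] by (simp add: rmod_homD(3)[OF S(6)] rmod_homD(3)[OF h])
  next
    fix x a assume "x \<in> carrier W" "a \<in> carrier A"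
    then show "h (r (x \<cdot>\<^bsub>W\<^esub> a)) = h (r x) \<cdot>\<^bsub>Z\<^esub> a"
      using t[of "r x \<cdot>\<^bsub>P\<^esub> a"] r fdm_closed[OF S(2)] by (simp add: rmod_homD(4)[OF S(6)] rmod_homD(4)[OF h])
  qed (use r rmod_homD(1)[OF h] in auto)
  then show thesis using that t by blast
qed

lemma hom_lift_inj:
  assumes Y: "fd_right_module K A Y" and i: "i \<in> rmod_hom K A Y P" "inj_on i (carrier Y)"
    and h: "h \<in> rmod_hom K A Z P" "\<And>z. z \<in> carrier Z \<Longrightarrow> h z \<in> i ` carrier Y"
  obtains k where "k \<in> rmod_hom K A Z Y" "\<And>z. z \<in> carrier Z \<Longrightarrow> i (k z) = h z"
proof -
  define k where "k z = inv_into (carrier Y) i (h z)" for z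
  have k: "k z \<in> carrier Y" "i (k z) = h z" if "z \<in> carrier Z" for z
    using h(2)[OF that] unfolding k_def by (auto intro: inv_into_into f_inv_into_f)
  note c = fdm_closed[OF Y]
  note iD = rmod_homD[OF i(1)] note hD = rmod_homD[OF h(1)]
  have "k \<in> rmod_hom K A Z Y"
  proof (rule rmod_homI)
    fix x y assume "x \<in> carrier Z" "y \<in> carrier Z"
    then have "i (k x \<oplus>\<^bsub>Y\<^esub> k y) = h (x \<oplus>\<^bsub>Z\<^esub> y)" by (simp add: iD(2) hD(2) k)
    then have "i (k x \<oplus>\<^bsub>Y\<^esub> k y) = h (x \<oplus>\<^bsub>Z\<^esub> y)" "k x \<oplus>\<^bsub>Y\<^esub> k y \<in> carrier Y"
      using k c \<open>x \<in> carrier Z\<close> \<open>y \<in> carrier Z\<close> by auto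
    then show "k (x \<oplus>\<^bsub>Z\<^esub> y) = k x \<oplus>\<^bsub>Y\<^esub> k y"
      unfolding k_def using i(2) by (metis inv_into_f_f)
  next
    fix a x assume "a \<in> carrier K" "x \<in> carrier Z"
    then have "i (a \<odot>\<^bsub>Y\<^esub> k x) = h (a \<odot>\<^bsub>Z\<^esub> x)" "a \<odot>\<^bsub>Y\<^esub> k x \<in> carrier Y"
      using c k by (simp_all add: iD(3) hD(3))
    then show "k (a \<odot>\<^bsub>Z\<^esub> x) = a \<odot>\<^bsub>Y\<^esub> k x"
      unfolding k_def using i(2) by (metis inv_into_f_f)
  next
    fix x a assume "x \<in> carrier Z" "a \<in> carrier A"
    then have "i (k x \<cdot>\<^bsub>Y\<^esub> a) = h (x \<cdot>\<^bsub>Z\<^esub> a)" "k x \<cdot>\<^bsub>Y\<^esub> a \<in> carrier Y"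
      using c k by (simp_all add: iD(4) hD(4))
    then show "k (x \<cdot>\<^bsub>Z\<^esub> a) = k x \<cdot>\<^bsub>Y\<^esub> a"
      unfolding k_def using i(2) by (metis inv_into_f_f)
  qed (rule k)
  then show thesis using that k by blast
qed

text \<open>The universal property of the kernel.\<close>
lemma ses_corestrict:
  assumes s: "ses K A Y P W i p" and h: "h \<in> rmod_hom K A Z P"
    and z: "\<And>z. z \<in> carrier Z \<Longrightarrow> p (h z) = \<zero>\<^bsub>W\<^esub>"
  obtains k where "k \<in> rmod_hom K A Z Y" "\<And>z. z \<in> carrier Z \<Longrightarrow> i (k z) = h z"
proof -
  note S = sesD[OF s]
  show thesis
    by (rule hom_lift_inj[OF S(1,4,5) h _ that]) (use S(8) z rmod_homD(1)[OF h] in auto)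
qed

lemma ses_kernel:
  assumes M: "fd_right_module K A M" and N: "fd_right_module K A N" and f: "f \<in> rmod_hom K A M N"
    and surj: "f ` carrier M = carrier N"
  shows "ses K A (M\<lparr>carrier := {x \<in> carrier M. f x = \<zero>\<^bsub>N\<^esub>}\<rparr>) M N (\<lambda>x. x) f"
  unfolding ses_def
  using submodule_fdm[OF M ker_rsubmodule[OF M N f]] M N f surj
  by (auto intro!: hom_inclusion)

lemma endo_inj_imp_surj:
  assumes M: "fd_right_module K A M" and f: "f \<in> rmod_hom K A M M" and inj: "inj_on f (carrier M)"
  shows "f ` carrier M = carrier M"
proof (rule ccontr)
  interpret M: fd_right_module K A M by fact
  interpret f: linear_map K M M f by (rule hom_linear_map[OF M M f])
  assume "f ` carrier M \<noteq> carrier M"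
  then have "f.imT \<noteq> carrier M" unfolding f.im_def .
  then have "vectorspace.dim K (M.vs f.imT) < M.dim"
    by (rule M.proper_subspace_dim[OF M.fin_dim_module f.im_is_submodule])
  then show False
    using f.rank_nullity[OF M.fin_dim_module] f.inj_imp_dim_ker0[OF inj] by simp
qed

lemma endo_surj_imp_inj:
  assumes M: "fd_right_module K A M" and f: "f \<in> rmod_hom K A M M" and surj: "f ` carrier M = carrier M"
  shows "inj_on f (carrier M)"
proof -
  interpret M: fd_right_module K A M by fact
  interpret f: linear_map K M M f by (rule hom_linear_map[OF M M f])
  have "vectorspace.dim K (M.vs f.kerT) = 0"
    using f.rank_nullity[OF M.fin_dim_module] f.surj_imp_imT_carrier[OF surj] by simp
  moreover have kfd: "vectorspace.fin_dim K (M.vs f.kerT)"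
    by (rule M.subspace_fin_dim[OF M.fin_dim_module f.ker_is_submodule])
  moreover interpret k: vectorspace K "M.vs f.kerT" by (rule M.subspace_vs[OF f.ker_is_submodule])
  have z: "LinearCombinations.submodule K {\<zero>\<^bsub>M\<^esub>} (M.vs f.kerT)"
    by (rule linear_submoduleI[OF k.module_axioms]) (auto simp: f.ker_def)
  ultimately have "{\<zero>\<^bsub>M\<^esub>} = carrier (M.vs f.kerT)"
    using k.proper_subspace_dim[OF kfd z] by auto
  then show ?thesis using f.Ke0_imp_inj by metis
qed

section \<open>Injective and projective modules\<close>

text \<open>The test modules in the definitions of injectivity and projectivity are of one fixed type; an
  isomorphic copy carries the test over to modules of any type.\<close>

lemma obtain_fd_copy:
  assumes "fd_right_module K A (M :: ('k, 'a, 'm) rmodule)"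
  obtains N :: "('k, 'a) fd_mod" and f g where "fd_right_module K A N"
    "f \<in> rmod_hom K A M N" "g \<in> rmod_hom K A N M"
    "\<And>x. x \<in> carrier M \<Longrightarrow> g (f x) = x" "\<And>y. y \<in> carrier N \<Longrightarrow> f (g y) = y"
proof -
  obtain N :: "('k, 'a) fd_mod" and f where N: "fd_right_module K A N"
    and f: "f \<in> rmod_hom K A M N" "bij_betw f (carrier M) (carrier N)"
    using ex_isomorphic_fd_module[OF assms] unfolding rmod_iso_def by blast
  show thesis by (rule hom_inv[OF f assms]) (rule that[OF N f(1)])
qed

lemma injective_fdm: "injective_module K A I \<Longrightarrow> fd_right_module K A I"
  by (simp add: injective_module_def)

lemma projective_fdm: "projective_module K A P \<Longrightarrow> fd_right_module K A P"
  by (simp add: projective_module_def)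

lemma injective_extend:
  assumes I: "injective_module K A I" and M: "fd_right_module K A M" and N: "fd_right_module K A N"
    and f: "f \<in> rmod_hom K A M N" "inj_on f (carrier M)" and g: "g \<in> rmod_hom K A M I"
  obtains h where "h \<in> rmod_hom K A N I" "\<And>x. x \<in> carrier M \<Longrightarrow> h (f x) = g x"
proof -
  obtain M' :: "('a, 'b) fd_mod" and a b where M': "fd_right_module K A M'"
    "a \<in> rmod_hom K A M M'" "b \<in> rmod_hom K A M' M"
    "\<And>x. x \<in> carrier M \<Longrightarrow> b (a x) = x" "\<And>y. y \<in> carrier M' \<Longrightarrow> a (b y) = y"
    using obtain_fd_copy[OF M] by metis
  obtain N' :: "('a, 'b) fd_mod" and a' b' where N': "fd_right_module K A N'"
    "a' \<in> rmod_hom K A N N'" "b' \<in> rmod_hom K A N' N"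
    "\<And>x. x \<in> carrier N \<Longrightarrow> b' (a' x) = x" "\<And>y. y \<in> carrier N' \<Longrightarrow> a' (b' y) = y"
    using obtain_fd_copy[OF N] by metis
  have 1: "(\<lambda>x. a' (f (b x))) \<in> rmod_hom K A M' N'"
    by (rule hom_comp[OF hom_comp[OF M'(3) f(1)] N'(2)])
  have 2: "inj_on (\<lambda>x. a' (f (b x))) (carrier M')"
    by (rule inj_onI) (metis M'(5) N'(4) f(2) inj_onD rmod_homD(1)[OF M'(3)] rmod_homD(1)[OF f(1)])
  have 3: "(\<lambda>x. g (b x)) \<in> rmod_hom K A M' I" by (rule hom_comp[OF M'(3) g])
  obtain h where h: "h \<in> rmod_hom K A N' I" "\<forall>x\<in>carrier M'. h (a' (f (b x))) = g (b x)"
    using I M'(1) N'(1) 1 2 3 unfolding injective_module_def by blast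
  show thesis
  proof (rule that[of "\<lambda>x. h (a' x)"])
    show "(\<lambda>x. h (a' x)) \<in> rmod_hom K A N I" by (rule hom_comp[OF N'(2) h(1)])
    show "h (a' (f x)) = g x" if "x \<in> carrier M" for x
      using h(2) rmod_homD(1)[OF M'(2) that] M'(4)[OF that] by metis
  qed
qed

lemma projective_lift:
  assumes P: "projective_module K A P" and M: "fd_right_module K A M" and N: "fd_right_module K A N"
    and f: "f \<in> rmod_hom K A M N" "f ` carrier M = carrier N" and g: "g \<in> rmod_hom K A P N"
  obtains h where "h \<in> rmod_hom K A P M" "\<And>x. x \<in> carrier P \<Longrightarrow> f (h x) = g x"
proof -
  obtain M' :: "('a, 'b) fd_mod" and a b where M': "fd_right_module K A M'"
    "a \<in> rmod_hom K A M M'" "b \<in> rmod_hom K A M' M"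
    "\<And>x. x \<in> carrier M \<Longrightarrow> b (a x) = x" "\<And>y. y \<in> carrier M' \<Longrightarrow> a (b y) = y"
    using obtain_fd_copy[OF M] by metis
  obtain N' :: "('a, 'b) fd_mod" and a' b' where N': "fd_right_module K A N'"
    "a' \<in> rmod_hom K A N N'" "b' \<in> rmod_hom K A N' N"
    "\<And>x. x \<in> carrier N \<Longrightarrow> b' (a' x) = x" "\<And>y. y \<in> carrier N' \<Longrightarrow> a' (b' y) = y"
    using obtain_fd_copy[OF N] by metis
  have 1: "(\<lambda>x. a' (f (b x))) \<in> rmod_hom K A M' N'"
    by (rule hom_comp[OF hom_comp[OF M'(3) f(1)] N'(2)])
  have 2: "(\<lambda>x. a' (f (b x))) ` carrier M' = carrier N'"
  proof
    show "(\<lambda>x. a' (f (b x))) ` carrier M' \<subseteq> carrier N'" using rmod_homD(1)[OF 1] by auto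
    show "carrier N' \<subseteq> (\<lambda>x. a' (f (b x))) ` carrier M'"
    proof
      fix y assume y: "y \<in> carrier N'"
      then have "b' y \<in> f ` carrier M" using f(2) rmod_homD(1)[OF N'(3)] by auto
      then obtain x where x: "x \<in> carrier M" "b' y = f x" by auto
      then have "a' (f (b (a x))) = y" using N'(5)[OF y] M'(4)[OF x(1)] by simp
      then show "y \<in> (\<lambda>x. a' (f (b x))) ` carrier M'" using rmod_homD(1)[OF M'(2) x(1)] by force
    qed
  qed
  have 3: "(\<lambda>x. a' (g x)) \<in> rmod_hom K A P N'" by (rule hom_comp[OF g N'(2)])
  obtain h where h: "h \<in> rmod_hom K A P M'" "\<forall>x\<in>carrier P. a' (f (b (h x))) = a' (g x)"
    using P M'(1) N'(1) 1 2 3 unfolding projective_module_def by blast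
  show thesis
  proof (rule that[of "\<lambda>x. b (h x)"])
    show "(\<lambda>x. b (h x)) \<in> rmod_hom K A P M" by (rule hom_comp[OF h(1) M'(3)])
    show "f (b (h x)) = g x" if "x \<in> carrier P" for x
      using h(2) that N'(4) rmod_homD(1)[OF M'(3) rmod_homD(1)[OF h(1) that]] rmod_homD(1)[OF f(1)]
        rmod_homD(1)[OF g that] by metis
  qed
qed

section \<open>Maps that factor through sums of copies of a module\<close>

text \<open>The maps \<open>X \<rightarrow> Y\<close> that factor through some \<open>T\<^sup>k\<close>, with a sum of \<open>k\<close> composites in place of the module \<open>T\<^sup>k\<close>.\<close>
inductive_set factor_thru ::
    "'k ring \<Rightarrow> ('k, 'a) module \<Rightarrow> ('k, 'a, 't) rmodule \<Rightarrow> ('k, 'a, 'x) rmodule \<Rightarrow> ('k, 'a, 'y) rmodule \<Rightarrow>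
     ('x \<Rightarrow> 'y) set"
  for K A T X Y where
  comp: "f \<in> rmod_hom K A X T \<Longrightarrow> g \<in> rmod_hom K A T Y \<Longrightarrow> (\<lambda>x. g (f x)) \<in> factor_thru K A T X Y"
| add: "\<phi> \<in> factor_thru K A T X Y \<Longrightarrow> \<psi> \<in> factor_thru K A T X Y \<Longrightarrow>
    (\<lambda>x. \<phi> x \<oplus>\<^bsub>Y\<^esub> \<psi> x) \<in> factor_thru K A T X Y"
| cong: "\<phi> \<in> factor_thru K A T X Y \<Longrightarrow> (\<And>x. x \<in> carrier X \<Longrightarrow> \<psi> x = \<phi> x) \<Longrightarrow>
    \<psi> \<in> factor_thru K A T X Y"

text \<open>\<open>X\<close> is a direct summand of a finite direct sum of copies of \<open>T\<close>.\<close>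
definition in_add ::
    "'k ring \<Rightarrow> ('k, 'a) module \<Rightarrow> ('k, 'a, 'x) rmodule \<Rightarrow> ('k, 'a, 't) rmodule \<Rightarrow> bool"
  where "in_add K A X T \<longleftrightarrow>
    fd_right_module K A X \<and> fd_right_module K A T \<and> (\<lambda>x. x) \<in> factor_thru K A T X X"

lemma in_addD:
  assumes "in_add K A X T"
  shows "fd_right_module K A X" "fd_right_module K A T" "(\<lambda>x. x) \<in> factor_thru K A T X X"
  using assms by (auto simp: in_add_def)

lemma factor_thru_hom:
  assumes \<phi>: "\<phi> \<in> factor_thru K A T X Y" and X: "fd_right_module K A X" and Y: "fd_right_module K A Y"
  shows "\<phi> \<in> rmod_hom K A X Y"
  using \<phi>
proof induction
  case (comp f g) then show ?case by (rule hom_comp)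
next
  case (add \<phi> \<psi>) show ?case by (rule hom_add[OF Y add.IH])
next
  case (cong \<phi> \<psi>) show ?case by (rule hom_cong[OF X cong.IH cong.hyps(2)])
qed

lemma factor_thru_pre:
  assumes \<phi>: "\<phi> \<in> factor_thru K A T X Y" and g: "g \<in> rmod_hom K A Z X"
  shows "(\<lambda>z. \<phi> (g z)) \<in> factor_thru K A T Z Y"
  using \<phi>
proof induction
  case (comp f h)
  show ?case by (rule factor_thru.comp[OF hom_comp[OF g comp(1)] comp(2)])
next
  case (add \<phi> \<psi>)
  show ?case by (rule factor_thru.add[OF add.IH])
next
  case (cong \<phi> \<psi>)
  show ?case by (rule factor_thru.cong[OF cong.IH]) (simp add: cong.hyps(2) rmod_homD(1)[OF g])
qed

lemma factor_thru_post:
  assumes \<phi>: "\<phi> \<in> factor_thru K A T X Y" and g: "g \<in> rmod_hom K A Y Z"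
    and X: "fd_right_module K A X" and Y: "fd_right_module K A Y"
  shows "(\<lambda>x. g (\<phi> x)) \<in> factor_thru K A T X Z"
  using \<phi>
proof induction
  case (comp f h)
  show ?case by (rule factor_thru.comp[OF comp(1) hom_comp[OF comp(2) g]])
next
  case (add \<phi> \<psi>)
  show ?case
    by (rule factor_thru.cong[OF factor_thru.add[OF add.IH]])
      (simp add: rmod_homD(2)[OF g] rmod_homD(1)[OF factor_thru_hom[OF add.hyps(1) X Y]]
        rmod_homD(1)[OF factor_thru_hom[OF add.hyps(2) X Y]])
next
  case (cong \<phi> \<psi>)
  show ?case by (rule factor_thru.cong[OF cong.IH]) (simp add: cong.hyps(2))
qed

lemma factor_thru_trans:
  assumes TS: "in_add K A T S" and \<phi>: "\<phi> \<in> factor_thru K A T X Y"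
    and X: "fd_right_module K A X"
  shows "\<phi> \<in> factor_thru K A S X Y"
  using \<phi>
proof induction
  case (comp f g)
  note T = in_addD[OF TS]
  show ?case
    by (rule factor_thru_post[OF factor_thru_pre[OF T(3) comp(1)] comp(2) X T(1)])
next
  case (add \<phi> \<psi>)
  show ?case by (rule factor_thru.add[OF add.IH])
next
  case (cong \<phi> \<psi>)
  show ?case by (rule factor_thru.cong[OF cong.IH cong.hyps(2)])
qed

lemma factor_thru_zero:
  assumes "fd_right_module K A T" "fd_right_module K A Y"
  shows "(\<lambda>x. \<zero>\<^bsub>Y\<^esub>) \<in> factor_thru K A T X Y"
  by (rule factor_thru.comp[OF hom_zero_map[OF assms(1)] hom_zero_map[OF assms(2)]])

lemma in_add_trans: "in_add K A X T \<Longrightarrow> in_add K A T S \<Longrightarrow> in_add K A X S"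
  using factor_thru_trans unfolding in_add_def by blast

lemma in_add_retract:
  assumes "fd_right_module K A X" "fd_right_module K A T"
    and "f \<in> rmod_hom K A X T" "g \<in> rmod_hom K A T X" "\<And>x. x \<in> carrier X \<Longrightarrow> g (f x) = x"
  shows "in_add K A X T"
  unfolding in_add_def
  using assms(1,2) factor_thru.cong[OF factor_thru.comp[OF assms(3,4)], of "\<lambda>x. x"] assms(5) by simp

lemma in_add_refl: "fd_right_module K A X \<Longrightarrow> in_add K A X X"
  by (rule in_add_retract[of _ _ X X "\<lambda>x. x" "\<lambda>x. x"]) (auto intro: hom_id)

lemma in_add_bij:
  assumes X: "fd_right_module K A X" and T: "fd_right_module K A T"
    and f: "f \<in> rmod_hom K A X T" "bij_betw f (carrier X) (carrier T)"
  shows "in_add K A X T" "in_add K A T X"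
proof -
  obtain g where g: "g \<in> rmod_hom K A T X" "\<And>x. x \<in> carrier X \<Longrightarrow> g (f x) = x"
    "\<And>y. y \<in> carrier T \<Longrightarrow> f (g y) = y" using hom_inv[OF f X] by metis
  show "in_add K A X T" by (rule in_add_retract[OF X T f(1) g(1,2)])
  show "in_add K A T X" by (rule in_add_retract[OF T X g(1) f(1) g(3)])
qed

lemma in_add_endo_bij:
  assumes X: "fd_right_module K A X" and T: "fd_right_module K A T"
    and \<phi>: "\<phi> \<in> factor_thru K A T X X" and bij: "bij_betw \<phi> (carrier X) (carrier X)"
  shows "in_add K A X T"
proof -
  obtain g where g: "g \<in> rmod_hom K A X X" "\<And>x. x \<in> carrier X \<Longrightarrow> g (\<phi> x) = x"
    using hom_inv[OF factor_thru_hom[OF \<phi> X X] bij X] by metis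
  show ?thesis
    unfolding in_add_def
    using X T factor_thru.cong[OF factor_thru_post[OF \<phi> g(1) X X], of "\<lambda>x. x"] g(2) by simp
qed

lemma in_add_zero:
  assumes XT: "in_add K A X T" and T0: "carrier T = {\<zero>\<^bsub>T\<^esub>}"
  shows "carrier X = {\<zero>\<^bsub>X\<^esub>}"
proof -
  note XT' = in_addD[OF XT]
  interpret X: fd_right_module K A X by (rule XT'(1))
  have "\<phi> x = \<zero>\<^bsub>X\<^esub>" if "\<phi> \<in> factor_thru K A T X X" "x \<in> carrier X" for \<phi> x
    using that
  proof induction
    case (comp f g)
    then have "f x = \<zero>\<^bsub>T\<^esub>" using rmod_homD(1)[OF comp(1)] T0 by blast
    then show ?case using hom_zero[OF XT'(2,1) comp(2)] by simp
  qed auto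
  then show ?thesis using XT'(3) by blast
qed

lemma factor_thru_extend:
  assumes I: "injective_module K A I" and M: "fd_right_module K A M" and N: "fd_right_module K A N"
    and f: "f \<in> rmod_hom K A M N" "inj_on f (carrier M)" and \<phi>: "\<phi> \<in> factor_thru K A I M Y"
  obtains \<psi> where "\<psi> \<in> factor_thru K A I N Y" "\<And>x. x \<in> carrier M \<Longrightarrow> \<psi> (f x) = \<phi> x"
proof -
  have "\<exists>\<psi>\<in>factor_thru K A I N Y. \<forall>x\<in>carrier M. \<psi> (f x) = \<phi> x"
    using \<phi>
  proof induction
    case (comp h g)
    obtain h' where h': "h' \<in> rmod_hom K A N I" "\<And>x. x \<in> carrier M \<Longrightarrow> h' (f x) = h x"
      using injective_extend[OF I M N f comp(1)] by metis
    show ?case by (rule bexI[OF _ factor_thru.comp[OF h'(1) comp(2)]]) (simp add: h'(2))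
  next
    case (add \<phi> \<psi>)
    then obtain \<phi>' \<psi>' where "\<phi>' \<in> factor_thru K A I N Y" "\<forall>x\<in>carrier M. \<phi>' (f x) = \<phi> x"
      "\<psi>' \<in> factor_thru K A I N Y" "\<forall>x\<in>carrier M. \<psi>' (f x) = \<psi> x" by blast
    then show ?case by (intro bexI[OF _ factor_thru.add[of \<phi>' K A I N Y \<psi>']]) simp_all
  qed auto
  then show thesis using that by blast
qed

lemma factor_thru_lift:
  assumes P: "projective_module K A P" and M: "fd_right_module K A M" and N: "fd_right_module K A N"
    and f: "f \<in> rmod_hom K A M N" "f ` carrier M = carrier N"
    and \<phi>: "\<phi> \<in> factor_thru K A P X N" and X: "fd_right_module K A X"
  obtains \<psi> where "\<psi> \<in> factor_thru K A P X M" "\<And>x. x \<in> carrier X \<Longrightarrow> f (\<psi> x) = \<phi> x"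
proof -
  have "\<exists>\<psi>\<in>factor_thru K A P X M. \<forall>x\<in>carrier X. f (\<psi> x) = \<phi> x"
    using \<phi>
  proof induction
    case (comp h g)
    obtain g' where g': "g' \<in> rmod_hom K A P M" "\<And>x. x \<in> carrier P \<Longrightarrow> f (g' x) = g x"
      using projective_lift[OF P M N f comp(2)] by metis
    show ?case
      by (rule bexI[OF _ factor_thru.comp[OF comp(1) g'(1)]]) (simp add: g'(2) rmod_homD(1)[OF comp(1)])
  next
    case (add \<phi> \<psi>)
    then obtain \<phi>' \<psi>' where *: "\<phi>' \<in> factor_thru K A P X M" "\<forall>x\<in>carrier X. f (\<phi>' x) = \<phi> x"
      "\<psi>' \<in> factor_thru K A P X M" "\<forall>x\<in>carrier X. f (\<psi>' x) = \<psi> x" by blast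
    then show ?case
      by (intro bexI[OF _ factor_thru.add[OF *(1,3)]])
        (simp add: rmod_homD(2)[OF f(1)] rmod_homD(1)[OF factor_thru_hom[OF *(1) X M]]
          rmod_homD(1)[OF factor_thru_hom[OF *(3) X M]])
  qed auto
  then show thesis using that by blast
qed

lemma in_add_injective:
  assumes XI: "in_add K A X I" and I: "injective_module K A I"
  shows "injective_module K A X"
  unfolding injective_module_def
proof (intro conjI allI impI)
  note X = in_addD[OF XI]
  show "fd_right_module K A X" by (rule X(1))
  fix M N :: "('a, 'b) fd_mod" and f g
  assume *: "fd_right_module K A M \<and> fd_right_module K A N \<and> f \<in> rmod_hom K A M N \<and>
    inj_on f (carrier M) \<and> g \<in> rmod_hom K A M X"
  then have MN: "fd_right_module K A M" "fd_right_module K A N" "f \<in> rmod_hom K A M N"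
    "inj_on f (carrier M)" "g \<in> rmod_hom K A M X" by auto
  obtain h where h: "h \<in> factor_thru K A I N X" "\<And>x. x \<in> carrier M \<Longrightarrow> h (f x) = g x"
    using factor_thru_extend[OF I MN(1-4) factor_thru_pre[OF X(3) MN(5)]] by metis
  then show "\<exists>h\<in>rmod_hom K A N X. \<forall>x\<in>carrier M. h (f x) = g x"
    using factor_thru_hom[OF h(1) MN(2) X(1)] by blast
qed

lemma in_add_projective:
  assumes XP: "in_add K A X P" and P: "projective_module K A P"
  shows "projective_module K A X"
  unfolding projective_module_def
proof (intro conjI allI impI)
  note X = in_addD[OF XP]
  show "fd_right_module K A X" by (rule X(1))
  fix M N :: "('a, 'b) fd_mod" and f g
  assume *: "fd_right_module K A M \<and> fd_right_module K A N \<and> f \<in> rmod_hom K A M N \<and>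
    f ` carrier M = carrier N \<and> g \<in> rmod_hom K A X N"
  then have MN: "fd_right_module K A M" "fd_right_module K A N" "f \<in> rmod_hom K A M N"
    "f ` carrier M = carrier N" "g \<in> rmod_hom K A X N" by auto
  obtain h where h: "h \<in> factor_thru K A P X M" "\<And>x. x \<in> carrier X \<Longrightarrow> f (h x) = g x"
    using factor_thru_lift[OF P MN(1-4) factor_thru_post[OF X(3) MN(5) X(1,1)] X(1)] by metis
  then show "\<exists>h\<in>rmod_hom K A X M. \<forall>x\<in>carrier X. f (h x) = g x"
    using factor_thru_hom[OF h(1) X(1) MN(1)] by blast
qed

text \<open>Both factors of a composite \<open>Y \<rightarrow> Y' \<rightarrow> Y\<close> extend to the injective middle terms and therefore induce maps
  between the cokernels.\<close>
lemma lift_factorization: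
  assumes s: "ses K A Y J W i p" and J: "injective_module K A J"
    and s': "ses K A Y' J' W' i' p'" and J': "injective_module K A J'"
    and \<phi>: "\<phi> \<in> factor_thru K A Y' Y Y"
  obtains \<Phi> \<Phi>' where "\<Phi> \<in> factor_thru K A J' J J" "\<Phi>' \<in> factor_thru K A W' W W"
    "\<And>y. y \<in> carrier Y \<Longrightarrow> \<Phi> (i y) = i (\<phi> y)" "\<And>x. x \<in> carrier J \<Longrightarrow> p (\<Phi> x) = \<Phi>' (p x)"
proof -
  note S = sesD[OF s] and S' = sesD[OF s']
  have "\<exists>\<Phi>\<in>factor_thru K A J' J J. \<exists>\<Phi>'\<in>factor_thru K A W' W W.
    (\<forall>y\<in>carrier Y. \<Phi> (i y) = i (\<phi> y)) \<and> (\<forall>x\<in>carrier J. p (\<Phi> x) = \<Phi>' (p x))"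
    using \<phi>
  proof induction
    case (comp f g)
    obtain F where F: "F \<in> rmod_hom K A J J'" "\<And>y. y \<in> carrier Y \<Longrightarrow> F (i y) = i' (f y)"
      using injective_extend[OF J' S(1,2,4,5) hom_comp[OF comp(1) S'(4)]] by metis
    obtain G where G: "G \<in> rmod_hom K A J' J" "\<And>y. y \<in> carrier Y' \<Longrightarrow> G (i' y) = i (g y)"
      using injective_extend[OF J S'(1,2,4,5) hom_comp[OF comp(2) S(4)]] by metis
    obtain F' where F': "F' \<in> rmod_hom K A W W'" "\<And>x. x \<in> carrier J \<Longrightarrow> F' (p x) = p' (F x)"
      by (rule ses_factor[OF s S'(3) hom_comp[OF F(1) S'(6)]])
        (simp_all add: F(2) S'(9) rmod_homD(1)[OF comp(1)])
    obtain G' where G': "G' \<in> rmod_hom K A W' W" "\<And>x. x \<in> carrier J' \<Longrightarrow> G' (p' x) = p (G x)"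
      by (rule ses_factor[OF s' S(3) hom_comp[OF G(1) S(6)]])
        (simp_all add: G(2) S(9) rmod_homD(1)[OF comp(2)])
    show ?case
      by (rule bexI[OF bexI[OF _ factor_thru.comp[OF F'(1) G'(1)]] factor_thru.comp[OF F(1) G(1)]])
        (simp add: F(2) G(2) F'(2) G'(2) rmod_homD(1)[OF comp(1)] rmod_homD(1)[OF F(1)])
  next
    case (add \<phi> \<psi>)
    then obtain \<Phi> \<Phi>' \<Psi> \<Psi>' where *: "\<Phi> \<in> factor_thru K A J' J J" "\<Phi>' \<in> factor_thru K A W' W W"
      "\<Psi> \<in> factor_thru K A J' J J" "\<Psi>' \<in> factor_thru K A W' W W"
      and e: "\<forall>y\<in>carrier Y. \<Phi> (i y) = i (\<phi> y)" "\<forall>x\<in>carrier J. p (\<Phi> x) = \<Phi>' (p x)"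
      "\<forall>y\<in>carrier Y. \<Psi> (i y) = i (\<psi> y)" "\<forall>x\<in>carrier J. p (\<Psi> x) = \<Psi>' (p x)" by blast
    show ?case
      by (rule bexI[OF bexI[OF _ factor_thru.add[OF *(2,4)]] factor_thru.add[OF *(1,3)]])
        (simp add: e rmod_homD(2)[OF S(4)] rmod_homD(2)[OF S(6)]
          rmod_homD(1)[OF factor_thru_hom[OF add.hyps(1) S(1,1)]]
          rmod_homD(1)[OF factor_thru_hom[OF add.hyps(2) S(1,1)]]
          rmod_homD(1)[OF factor_thru_hom[OF *(1) S(2,2)]]
          rmod_homD(1)[OF factor_thru_hom[OF *(3) S(2,2)]])
  next
    case (cong \<phi> \<psi>)
    then show ?case by simp
  qed
  then show thesis using that by blast
qed

text \<open>The identity of \<open>Y\<close> extends to an endomorphism \<open>\<Phi>\<close> of \<open>J\<close> that factors through copies of \<open>J'\<close>. By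
  essentiality \<open>\<Phi>\<close> is injective, hence bijective for dimension reasons, and so is the map it induces on
  \<open>W\<close>.\<close>
lemma minimal_cosyzygy_in_add:
  assumes s: "ses K A Y J W i p" and J: "injective_module K A J"
    and ess: "essential_submodule K A J (i ` carrier Y)"
    and s': "ses K A Y' J' W' i' p'" and J': "injective_module K A J'"
    and Y: "in_add K A Y Y'"
  shows "in_add K A J J'" "in_add K A W W'"
proof -
  note S = sesD[OF s] and S' = sesD[OF s']
  obtain \<Phi> \<Phi>' where \<Phi>: "\<Phi> \<in> factor_thru K A J' J J" "\<Phi>' \<in> factor_thru K A W' W W"
    "\<And>y. y \<in> carrier Y \<Longrightarrow> \<Phi> (i y) = i y" "\<And>x. x \<in> carrier J \<Longrightarrow> p (\<Phi> x) = \<Phi>' (p x)"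
    using lift_factorization[OF s J s' J' in_addD(3)[OF Y]] by metis
  note \<Phi>h = factor_thru_hom[OF \<Phi>(1) S(2,2)] and \<Phi>'h = factor_thru_hom[OF \<Phi>(2) S(3,3)]
  let ?N = "{x \<in> carrier J. \<Phi> x = \<zero>\<^bsub>J\<^esub>}"
  have "rsubmodule K A J ?N" by (rule ker_rsubmodule[OF S(2,2) \<Phi>h])
  moreover have "i ` carrier Y \<inter> ?N = {\<zero>\<^bsub>J\<^esub>}"
  proof -
    have "x = \<zero>\<^bsub>J\<^esub>" if "x \<in> i ` carrier Y \<inter> ?N" for x using that \<Phi>(3) by auto
    moreover have "\<zero>\<^bsub>J\<^esub> \<in> ?N" using fdm_closed(1)[OF S(2)] hom_zero[OF S(2,2) \<Phi>h] by simp
    moreover have "\<zero>\<^bsub>J\<^esub> \<in> i ` carrier Y" using hom_zero[OF S(1,2,4)] fdm_closed(1)[OF S(1)] by (metis imageI)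
    ultimately show ?thesis by blast
  qed
  ultimately have N: "?N = {\<zero>\<^bsub>J\<^esub>}" using ess unfolding essential_submodule_def by blast
  have inj: "inj_on \<Phi> (carrier J)" by (rule hom_injI[OF S(2,2) \<Phi>h]) (use N in blast)
  have surj: "\<Phi> ` carrier J = carrier J" by (rule endo_inj_imp_surj[OF S(2) \<Phi>h inj])
  show "in_add K A J J'"
    by (rule in_add_endo_bij[OF S(2) S'(2) \<Phi>(1)]) (simp add: bij_betw_def inj surj)
  have "carrier W \<subseteq> \<Phi>' ` carrier W"
  proof
    fix w assume "w \<in> carrier W"
    then obtain x where x: "x \<in> carrier J" "w = p x" using S(7) by blast
    then obtain x' where "x' \<in> carrier J" "x = \<Phi> x'" using surj by blast
    then show "w \<in> \<Phi>' ` carrier W" using x \<Phi>(4) rmod_homD(1)[OF S(6)] by auto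
  qed
  then have surj': "\<Phi>' ` carrier W = carrier W" using rmod_homD(1)[OF \<Phi>'h] by blast
  show "in_add K A W W'"
    by (rule in_add_endo_bij[OF S(3) S'(3) \<Phi>(2)])
      (simp add: bij_betw_def surj' endo_surj_imp_inj[OF S(3) \<Phi>'h surj'])
qed

lemma ses_split_injective:
  assumes s: "ses K A Y P W i p" and Y: "injective_module K A Y"
  shows "in_add K A W P" "\<exists>r\<in>rmod_hom K A W P. \<forall>w\<in>carrier W. p (r w) = w"
proof -
  note S = sesD[OF s]
  obtain h where h: "h \<in> rmod_hom K A P Y" "\<And>y. y \<in> carrier Y \<Longrightarrow> h (i y) = y"
    using injective_extend[OF Y S(1,2,4,5) hom_id] by metis
  have hi: "(\<lambda>x. i (h x)) \<in> rmod_hom K A P P" by (rule hom_comp[OF h(1) S(4)])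
  note d = hom_diff[OF S(2,2) hom_id hi]
  interpret P: fd_right_module K A P by (rule S(2))
  obtain t where t: "t \<in> rmod_hom K A W P" "\<And>x. x \<in> carrier P \<Longrightarrow> t (p x) = x \<ominus>\<^bsub>P\<^esub> i (h x)"
    by (rule ses_factor[OF s S(2) d]) (simp_all add: h(2) rmod_homD(1)[OF S(4)] P.M.minus_eq P.M.r_neg)
  have r: "p (t w) = w" if "w \<in> carrier W" for w
  proof -
    have "w \<in> p ` carrier P" using that S(7) by simp
    then obtain x where x: "x \<in> carrier P" "w = p x" by (elim imageE)
    have hx: "h x \<in> carrier Y" using x rmod_homD(1)[OF h(1)] by auto
    interpret W: fd_right_module K A W by (rule S(3))
    have "p (x \<ominus>\<^bsub>P\<^esub> i (h x)) = p x"
      using hom_minus[OF S(2,3,6) x(1) rmod_homD(1)[OF S(4) hx]] S(9)[OF hx] rmod_homD(1)[OF S(6) x(1)]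
      by (simp add: W.M.minus_eq)
    then show ?thesis using x t(2) by simp
  qed
  then show "\<exists>r\<in>rmod_hom K A W P. \<forall>w\<in>carrier W. p (r w) = w" using t(1) by blast
  show "in_add K A W P" by (rule in_add_retract[OF S(3,2) t(1) S(6) r])
qed

lemma ses_split_projective:
  assumes s: "ses K A Y P W i p" and W: "projective_module K A W"
  shows "in_add K A Y P"
proof -
  note S = sesD[OF s]
  obtain r where r: "r \<in> rmod_hom K A W P" "\<And>w. w \<in> carrier W \<Longrightarrow> p (r w) = w"
    using projective_lift[OF W S(2,3,6,7) hom_id] by metis
  interpret P: fd_right_module K A P by (rule S(2))
  have rp: "(\<lambda>x. r (p x)) \<in> rmod_hom K A P P" by (rule hom_comp[OF S(6) r(1)])
  have pc: "p x \<in> carrier W" "r (p x) \<in> carrier P" if "x \<in> carrier P" for x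
    using that rmod_homD(1)[OF S(6)] rmod_homD(1)[OF r(1)] by auto
  obtain k where k: "k \<in> rmod_hom K A P Y" "\<And>x. x \<in> carrier P \<Longrightarrow> i (k x) = x \<ominus>\<^bsub>P\<^esub> r (p x)"
    by (rule ses_corestrict[OF s hom_diff[OF S(2,2) hom_id rp]])
      (simp_all add: hom_minus[OF S(2,3,6)] pc r(2) fdm_diff_eq_zero[OF S(3)])
  have "k (i y) = y" if y: "y \<in> carrier Y" for y
  proof -
    have iy: "i y \<in> carrier P" using rmod_homD(1)[OF S(4) y] .
    have "i (k (i y)) = i y"
      unfolding k(2)[OF iy] S(9)[OF y] hom_zero[OF S(3,2) r(1)] using iy by (simp add: P.M.minus_eq)
    then show ?thesis using S(5) y rmod_homD(1)[OF k(1) iy] by (metis inj_onD)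
  qed
  then show ?thesis by (rule in_add_retract[OF S(1,2,4) k(1)])
qed

section \<open>Sums, generators and cogenerators\<close>

lemma vectorspace_cong:
  assumes V: "vectorspace K V" and e: "carrier W = carrier V" "\<zero>\<^bsub>W\<^esub> = \<zero>\<^bsub>V\<^esub>" "add W = add V"
    "module.smult W = module.smult V"
  shows "vectorspace K W" "vectorspace.fin_dim K V \<Longrightarrow> vectorspace.fin_dim K W"
proof -
  interpret V: vectorspace K V by fact
  show W: "vectorspace K W"
  proof (rule vs_criteria)
    show "field K" by (rule V.field_axioms)
    show "\<forall>v\<in>carrier W. \<exists>w\<in>carrier W. v \<oplus>\<^bsub>W\<^esub> w = \<zero>\<^bsub>W\<^esub>"
      using V.M.r_neg V.M.a_inv_closed unfolding e by blast
  qed (auto simp: e V.M.a_assoc V.smult_assoc1 V.smult_l_distr V.smult_r_distr intro: V.M.a_comm)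
  assume fd: "V.fin_dim"
  interpret W: vectorspace K W by (rule W)
  interpret l: linear_map K V W "\<lambda>x. x"
    by unfold_locales (auto simp: LinearCombinations.module_hom_def e)
  show "W.fin_dim" by (rule l.surj_fin_dim[OF fd]) (simp add: e)
qed

lemma rmod_sum_simps [simp]:
  "carrier (rmod_sum M N) = carrier M \<times> carrier N"
  "\<zero>\<^bsub>rmod_sum M N\<^esub> = (\<zero>\<^bsub>M\<^esub>, \<zero>\<^bsub>N\<^esub>)"
  "(x, y) \<oplus>\<^bsub>rmod_sum M N\<^esub> (x', y') = (x \<oplus>\<^bsub>M\<^esub> x', y \<oplus>\<^bsub>N\<^esub> y')"
  "c \<odot>\<^bsub>rmod_sum M N\<^esub> (x, y) = (c \<odot>\<^bsub>M\<^esub> x, c \<odot>\<^bsub>N\<^esub> y)"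
  "(x, y) \<cdot>\<^bsub>rmod_sum M N\<^esub> a = (x \<cdot>\<^bsub>M\<^esub> a, y \<cdot>\<^bsub>N\<^esub> a)"
  by (simp_all add: rmod_sum_def)

lemma rmod_sum_fdm:
  assumes M: "fd_right_module K A M" and N: "fd_right_module K A N"
  shows "fd_right_module K A (rmod_sum M N)"
proof -
  interpret M: fd_right_module K A M by fact
  interpret N: fd_right_module K A N by fact
  let ?S = "rmod_sum M N"
  have vs: "vectorspace K ?S"
  proof (rule vs_criteria)
    show "field K" by (rule M.field_axioms)
    show "\<forall>v\<in>carrier ?S. \<exists>w\<in>carrier ?S. v \<oplus>\<^bsub>?S\<^esub> w = \<zero>\<^bsub>?S\<^esub>"
    proof
      fix v assume "v \<in> carrier ?S"
      then obtain x y where v: "v = (x, y)" "x \<in> carrier M" "y \<in> carrier N" by auto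
      then have "v \<oplus>\<^bsub>?S\<^esub> (\<ominus>\<^bsub>M\<^esub> x, \<ominus>\<^bsub>N\<^esub> y) = \<zero>\<^bsub>?S\<^esub>" "(\<ominus>\<^bsub>M\<^esub> x, \<ominus>\<^bsub>N\<^esub> y) \<in> carrier ?S"
        by (simp_all add: M.M.r_neg N.M.r_neg)
      then show "\<exists>w\<in>carrier ?S. v \<oplus>\<^bsub>?S\<^esub> w = \<zero>\<^bsub>?S\<^esub>" by blast
    qed
    show "\<forall>v w. v \<in> carrier ?S \<and> w \<in> carrier ?S \<longrightarrow> v \<oplus>\<^bsub>?S\<^esub> w = w \<oplus>\<^bsub>?S\<^esub> v"
      by (auto intro: M.M.a_comm N.M.a_comm)
  qed (auto simp: M.M.a_assoc N.M.a_assoc M.smult_assoc1 N.smult_assoc1 M.smult_l_distr N.smult_l_distr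
      M.smult_r_distr N.smult_r_distr)
  interpret S: vectorspace K ?S by (rule vs)
  have fst: "fst \<in> LinearCombinations.module_hom K ?S M"
    by (auto simp: LinearCombinations.module_hom_def)
  interpret f: linear_map K ?S M fst by unfold_locales (rule fst)
  let ?N = "{v \<in> carrier ?S. fst v = \<zero>\<^bsub>M\<^esub>}"
  have sub: "LinearCombinations.submodule K ?N ?S" using f.ker_is_submodule unfolding f.ker_def .
  interpret k: vectorspace K "?S\<lparr>carrier := ?N\<rparr>" by (rule S.subspace_vs[OF sub])
  interpret j: linear_map K N "?S\<lparr>carrier := ?N\<rparr>" "\<lambda>y. (\<zero>\<^bsub>M\<^esub>, y)"
    by unfold_locales (auto simp: LinearCombinations.module_hom_def)
  have "k.fin_dim" by (rule j.surj_fin_dim[OF N.fin_dim_module]) auto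
  then have fd: "S.fin_dim" by (rule fin_dim_extension[OF vs M.vectorspace_axioms M.fin_dim_module fst])
  show ?thesis
  proof (intro fd_right_module.intro fd_right_module_axioms.intro)
    show "vectorspace K ?S" "fd_algebra K A" "S.fin_dim" by (fact vs M.fd_algebra fd)+
  qed (auto simp: M.ract_closed N.ract_closed M.ract_add_left M.ract_add_right M.ract_mult M.ract_one
      M.ract_smult M.smult_ract N.ract_add_left N.ract_add_right N.ract_mult N.ract_one
      N.ract_smult N.smult_ract)
qed

lemma rmod_sum_homs:
  assumes M: "fd_right_module K A M" and N: "fd_right_module K A N"
  shows "fst \<in> rmod_hom K A (rmod_sum M N) M" "snd \<in> rmod_hom K A (rmod_sum M N) N"
    "(\<lambda>x. (x, \<zero>\<^bsub>N\<^esub>)) \<in> rmod_hom K A M (rmod_sum M N)"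
    "(\<lambda>y. (\<zero>\<^bsub>M\<^esub>, y)) \<in> rmod_hom K A N (rmod_sum M N)"
proof -
  interpret M: fd_right_module K A M by fact
  interpret N: fd_right_module K A N by fact
  show "fst \<in> rmod_hom K A (rmod_sum M N) M" "snd \<in> rmod_hom K A (rmod_sum M N) N"
    "(\<lambda>x. (x, \<zero>\<^bsub>N\<^esub>)) \<in> rmod_hom K A M (rmod_sum M N)"
    "(\<lambda>y. (\<zero>\<^bsub>M\<^esub>, y)) \<in> rmod_hom K A N (rmod_sum M N)"
    by (rule rmod_homI; auto simp: fdm_zero_ract[OF M] fdm_zero_ract[OF N])+
qed

lemma in_add_sum:
  assumes M: "in_add K A M T" and N: "in_add K A N T"
  shows "in_add K A (rmod_sum M N) T"
proof -
  note M' = in_addD[OF M] and N' = in_addD[OF N]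
  interpret M: fd_right_module K A M by (rule M')
  interpret N: fd_right_module K A N by (rule N')
  note S = rmod_sum_fdm[OF M'(1) N'(1)] and h = rmod_sum_homs[OF M'(1) N'(1)]
  have 1: "(\<lambda>v. (fst v, \<zero>\<^bsub>N\<^esub>)) \<in> factor_thru K A T (rmod_sum M N) (rmod_sum M N)"
    by (rule factor_thru_pre[OF factor_thru_post[OF M'(3) h(3) M'(1,1)] h(1)])
  have 2: "(\<lambda>v. (\<zero>\<^bsub>M\<^esub>, snd v)) \<in> factor_thru K A T (rmod_sum M N) (rmod_sum M N)"
    by (rule factor_thru_pre[OF factor_thru_post[OF N'(3) h(4) N'(1,1)] h(2)])
  have "(\<lambda>v. v) \<in> factor_thru K A T (rmod_sum M N) (rmod_sum M N)"
    by (rule factor_thru.cong[OF factor_thru.add[OF 1 2]]) auto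
  then show ?thesis unfolding in_add_def using S M'(2) by simp
qed

lemma submodule_dim_less:
  assumes M: "fd_right_module K A M" and S: "rsubmodule K A M S" and S': "rsubmodule K A M S'" and lt: "S \<subset> S'"
  shows "vectorspace.dim K (M\<lparr>carrier := S\<rparr>) < vectorspace.dim K (M\<lparr>carrier := S'\<rparr>)"
proof -
  interpret S': fd_right_module K A "M\<lparr>carrier := S'\<rparr>" by (rule submodule_fdm[OF M S'])
  have "LinearCombinations.submodule K S (M\<lparr>carrier := S'\<rparr>)"
    using rsubmoduleD[OF S] lt by (intro linear_submoduleI S'.module_axioms) auto
  from S'.proper_subspace_dim[OF S'.fin_dim_module this] show ?thesis using lt by simp
qed

text \<open>A homomorphism to a module in \<open>add(Y)\<close> whose kernel has minimal dimension is injective: a map to \<open>Y\<close> that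
  does not kill some element of the kernel could be added as a further component.\<close>
lemma embed_in_add:
  fixes K :: "'k ring" and A :: "('k, 'a) module"
  assumes X: "fd_right_module K A X" and Y: "fd_right_module K A Y"
    and cogen: "\<And>x. x \<in> carrier X \<Longrightarrow> x \<noteq> \<zero>\<^bsub>X\<^esub> \<Longrightarrow> \<exists>f\<in>rmod_hom K A X Y. f x \<noteq> \<zero>\<^bsub>Y\<^esub>"
  obtains E :: "('k, 'a) fd_mod" and j where "in_add K A E Y" "j \<in> rmod_hom K A X E" "inj_on j (carrier X)"
proof -
  let ?ker = "\<lambda>(E :: ('k, 'a) fd_mod) j. {x \<in> carrier X. j x = \<zero>\<^bsub>E\<^esub>}"
  let ?P = "\<lambda>n. \<exists>(E :: ('k, 'a) fd_mod) j. in_add K A E Y \<and> j \<in> rmod_hom K A X E \<and>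
    vectorspace.dim K (X\<lparr>carrier := ?ker E j\<rparr>) = n"
  obtain E0 :: "('k, 'a) fd_mod" and f0 g0 where E0: "fd_right_module K A E0"
    "f0 \<in> rmod_hom K A Y E0" "g0 \<in> rmod_hom K A E0 Y" "\<And>x. x \<in> carrier Y \<Longrightarrow> g0 (f0 x) = x"
    "\<And>y. y \<in> carrier E0 \<Longrightarrow> f0 (g0 y) = y"
    using obtain_fd_copy[OF Y] by metis
  have ex: "?P (vectorspace.dim K (X\<lparr>carrier := ?ker E0 (\<lambda>x. \<zero>\<^bsub>E0\<^esub>)\<rparr>))"
    using in_add_retract[OF E0(1) Y E0(3,2,5)] hom_zero_map[OF E0(1)] by blast
  define n where "n = (LEAST n. ?P n)"
  have Pn: "?P n" unfolding n_def by (rule LeastI[of ?P, OF ex])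
  have least: "n \<le> m" if "?P m" for m unfolding n_def by (rule Least_le[of ?P, OF that])
  obtain E :: "('k, 'a) fd_mod" and j where E: "in_add K A E Y" "j \<in> rmod_hom K A X E"
    "vectorspace.dim K (X\<lparr>carrier := ?ker E j\<rparr>) = n" using Pn by blast
  note EF = in_addD(1)[OF E(1)]
  have "inj_on j (carrier X)"
  proof (rule hom_injI[OF X EF E(2)], rule ccontr)
    fix x assume x: "x \<in> carrier X" "j x = \<zero>\<^bsub>E\<^esub>" "x \<noteq> \<zero>\<^bsub>X\<^esub>"
    obtain f where f: "f \<in> rmod_hom K A X Y" "f x \<noteq> \<zero>\<^bsub>Y\<^esub>" using cogen[OF x(1,3)] by blast
    interpret X: fd_right_module K A X by (rule X)
    interpret E: fd_right_module K A E by (rule EF)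
    interpret Y: fd_right_module K A Y by (rule Y)
    let ?S = "rmod_sum E Y"
    note S = rmod_sum_fdm[OF EF Y]
    have jf: "(\<lambda>x. (j x, f x)) \<in> rmod_hom K A X ?S"
      by (rule rmod_homI) (simp_all add: rmod_homD(1-4)[OF E(2)] rmod_homD(1-4)[OF f(1)])
    obtain E' :: "('k, 'a) fd_mod" and a b where E': "fd_right_module K A E'"
      "a \<in> rmod_hom K A ?S E'" "b \<in> rmod_hom K A E' ?S" "\<And>x. x \<in> carrier ?S \<Longrightarrow> b (a x) = x"
      "\<And>y. y \<in> carrier E' \<Longrightarrow> a (b y) = y"
      using obtain_fd_copy[OF S] by metis
    let ?j = "\<lambda>x. a (j x, f x)"
    have j': "?j \<in> rmod_hom K A X E'" by (rule hom_comp[OF jf E'(2)])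
    have add': "in_add K A E' Y"
      by (rule in_add_trans[OF in_add_retract[OF E'(1) S E'(3,2,5)] in_add_sum[OF E(1) in_add_refl[OF Y]]])
    have z: "(j y, f y) = (\<zero>\<^bsub>E\<^esub>, \<zero>\<^bsub>Y\<^esub>)" if "y \<in> carrier X" "?j y = \<zero>\<^bsub>E'\<^esub>" for y
    proof -
      have "(j y, f y) = b (?j y)" using E'(4) rmod_homD(1)[OF jf that(1)] by simp
      also have "\<dots> = \<zero>\<^bsub>?S\<^esub>" unfolding that(2) by (rule hom_zero[OF E'(1) S E'(3)])
      finally show ?thesis by simp
    qed
    have "?ker E' ?j \<subset> ?ker E j"
    proof
      show "?ker E' ?j \<subseteq> ?ker E j" using z by auto
      show "?ker E' ?j \<noteq> ?ker E j"
      proof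
        assume eq: "?ker E' ?j = ?ker E j"
        have "x \<in> ?ker E' ?j" by (subst eq) (simp add: x)
        then have "?j x = \<zero>\<^bsub>E'\<^esub>" by simp
        from z[OF x(1) this] f(2) show False by simp
      qed
    qed
    then have "vectorspace.dim K (X\<lparr>carrier := ?ker E' ?j\<rparr>) < n"
      using submodule_dim_less[OF X ker_rsubmodule[OF X E'(1) j'] ker_rsubmodule[OF X EF E(2)]] E(3) by simp
    moreover have "?P (vectorspace.dim K (X\<lparr>carrier := ?ker E' ?j\<rparr>))" using add' j' by blast
    ultimately show False using least by fastforce
  qed
  then show thesis by (rule that[OF E(1,2)])
qed

text \<open>Dually, a homomorphism from a module in \<open>add(Y)\<close> whose image has minimal codimension is onto.\<close>
lemma cover_by_add:
  fixes K :: "'k ring" and A :: "('k, 'a) module"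
  assumes X: "fd_right_module K A X" and Y: "fd_right_module K A Y"
    and gen: "\<And>x. x \<in> carrier X \<Longrightarrow> \<exists>f\<in>rmod_hom K A Y X. x \<in> f ` carrier Y"
  obtains E :: "('k, 'a) fd_mod" and q where "in_add K A E Y" "q \<in> rmod_hom K A E X" "q ` carrier E = carrier X"
proof -
  let ?im = "\<lambda>(E :: ('k, 'a) fd_mod) q. q ` carrier E"
  let ?d = "\<lambda>S. vectorspace.dim K (X\<lparr>carrier := S\<rparr>)"
  let ?P = "\<lambda>n. \<exists>(E :: ('k, 'a) fd_mod) q. in_add K A E Y \<and> q \<in> rmod_hom K A E X \<and>
    ?d (carrier X) - ?d (?im E q) = n"
  obtain E0 :: "('k, 'a) fd_mod" and f0 g0 where E0: "fd_right_module K A E0"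
    "f0 \<in> rmod_hom K A Y E0" "g0 \<in> rmod_hom K A E0 Y" "\<And>x. x \<in> carrier Y \<Longrightarrow> g0 (f0 x) = x"
    "\<And>y. y \<in> carrier E0 \<Longrightarrow> f0 (g0 y) = y"
    using obtain_fd_copy[OF Y] by metis
  have ex: "?P (?d (carrier X) - ?d (?im E0 (\<lambda>x. \<zero>\<^bsub>X\<^esub>)))"
    using in_add_retract[OF E0(1) Y E0(3,2,5)] hom_zero_map[OF X] by blast
  define n where "n = (LEAST n. ?P n)"
  have Pn: "?P n" unfolding n_def by (rule LeastI[of ?P, OF ex])
  have least: "n \<le> m" if "?P m" for m unfolding n_def by (rule Least_le[of ?P, OF that])
  obtain E :: "('k, 'a) fd_mod" and q where E: "in_add K A E Y" "q \<in> rmod_hom K A E X"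
    "?d (carrier X) - ?d (?im E q) = n" using Pn by blast
  note EF = in_addD(1)[OF E(1)]
  have "carrier X \<subseteq> ?im E q"
  proof (rule ccontr)
    assume "\<not> carrier X \<subseteq> ?im E q"
    then obtain x where x: "x \<in> carrier X" "x \<notin> ?im E q" by blast
    obtain f y where f: "f \<in> rmod_hom K A Y X" "y \<in> carrier Y" "x = f y" using gen[OF x(1)] by blast
    interpret X: fd_right_module K A X by (rule X)
    interpret E: fd_right_module K A E by (rule EF)
    interpret Y: fd_right_module K A Y by (rule Y)
    let ?S = "rmod_sum E Y"
    note S = rmod_sum_fdm[OF EF Y] and h = rmod_sum_homs[OF EF Y]
    have qf: "(\<lambda>v. q (fst v) \<oplus>\<^bsub>X\<^esub> f (snd v)) \<in> rmod_hom K A ?S X"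
      by (rule hom_add[OF X hom_comp[OF h(1) E(2)] hom_comp[OF h(2) f(1)]])
    obtain E' :: "('k, 'a) fd_mod" and a b where E': "fd_right_module K A E'"
      "a \<in> rmod_hom K A ?S E'" "b \<in> rmod_hom K A E' ?S" "\<And>x. x \<in> carrier ?S \<Longrightarrow> b (a x) = x"
      "\<And>y. y \<in> carrier E' \<Longrightarrow> a (b y) = y"
      using obtain_fd_copy[OF S] by metis
    let ?q = "\<lambda>v. q (fst (b v)) \<oplus>\<^bsub>X\<^esub> f (snd (b v))"
    have q': "?q \<in> rmod_hom K A E' X" by (rule hom_comp[OF E'(3) qf])
    have add': "in_add K A E' Y"
      by (rule in_add_trans[OF in_add_retract[OF E'(1) S E'(3,2,5)] in_add_sum[OF E(1) in_add_refl[OF Y]]])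
    have mem: "q u \<oplus>\<^bsub>X\<^esub> f v \<in> ?im E' ?q" if "u \<in> carrier E" "v \<in> carrier Y" for u v
    proof -
      have "(u, v) \<in> carrier ?S" using that by simp
      then have "q u \<oplus>\<^bsub>X\<^esub> f v = ?q (a (u, v))" "a (u, v) \<in> carrier E'"
        using E'(4) rmod_homD(1)[OF E'(2)] by simp_all
      then show ?thesis by (rule image_eqI)
    qed
    have im: "rsubmodule K A X (?im E q)" "rsubmodule K A X (?im E' ?q)"
      by (rule im_rsubmodule[OF EF X E(2) carrier_rsubmodule[OF EF]])
         (rule im_rsubmodule[OF E'(1) X q' carrier_rsubmodule[OF E'(1)]])
    have "?im E q \<subset> ?im E' ?q"
    proof
      show "?im E q \<subseteq> ?im E' ?q"
      proof
        fix z assume "z \<in> ?im E q"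
        then obtain u where u: "u \<in> carrier E" "z = q u" by blast
        have "q u \<oplus>\<^bsub>X\<^esub> f \<zero>\<^bsub>Y\<^esub> = q u"
          using hom_zero[OF Y X f(1)] rmod_homD(1)[OF E(2) u(1)] by simp
        then show "z \<in> ?im E' ?q" using mem[OF u(1) Y.M.zero_closed] u(2) by simp
      qed
      have "q \<zero>\<^bsub>E\<^esub> \<oplus>\<^bsub>X\<^esub> f y = x"
        using hom_zero[OF EF X E(2)] f x(1) by simp
      then have "x \<in> ?im E' ?q" using mem[OF E.M.zero_closed f(2)] by simp
      then show "?im E q \<noteq> ?im E' ?q" using x(2) by blast
    qed
    then have less: "?d (?im E q) < ?d (?im E' ?q)" by (rule submodule_dim_less[OF X im])
    have "?d (?im E' ?q) \<le> ?d (carrier X)"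
    proof (cases "?im E' ?q = carrier X")
      case False
      then have "?im E' ?q \<subset> carrier X" using rsubmoduleD(1)[OF im(2)] by blast
      then show ?thesis using submodule_dim_less[OF X im(2) carrier_rsubmodule[OF X]] by simp
    qed simp
    then have "?d (carrier X) - ?d (?im E' ?q) < n" using less E(3) by simp
    moreover have "?P (?d (carrier X) - ?d (?im E' ?q))" using add' q' by blast
    ultimately show False using least by fastforce
  qed
  then show thesis using that[OF E(1,2)] rmod_homD(1)[OF E(2)] by blast
qed

section \<open>Quotients\<close>

lemma fdm_surjective_image:
  assumes M: "fd_right_module K A M"
    and c: "carrier Q = p ` carrier M" and z: "\<zero>\<^bsub>Q\<^esub> = p \<zero>\<^bsub>M\<^esub>"
    and a: "\<And>x y. x \<in> carrier M \<Longrightarrow> y \<in> carrier M \<Longrightarrow> p x \<oplus>\<^bsub>Q\<^esub> p y = p (x \<oplus>\<^bsub>M\<^esub> y)"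
    and s: "\<And>k x. k \<in> carrier K \<Longrightarrow> x \<in> carrier M \<Longrightarrow> k \<odot>\<^bsub>Q\<^esub> p x = p (k \<odot>\<^bsub>M\<^esub> x)"
    and r: "\<And>x b. x \<in> carrier M \<Longrightarrow> b \<in> carrier A \<Longrightarrow> p x \<cdot>\<^bsub>Q\<^esub> b = p (x \<cdot>\<^bsub>M\<^esub> b)"
  shows "fd_right_module K A Q"
proof -
  interpret M: fd_right_module K A M by fact
  interpret A: fd_algebra K A by (rule M.fd_algebra)
  have vs: "vectorspace K Q"
  proof (rule vs_criteria)
    show "field K" by (rule M.field_axioms)
    show "\<forall>v\<in>carrier Q. \<exists>w\<in>carrier Q. v \<oplus>\<^bsub>Q\<^esub> w = \<zero>\<^bsub>Q\<^esub>"
      unfolding c z ball_simps bex_simps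
    proof
      fix x assume x: "x \<in> carrier M"
      have "p x \<oplus>\<^bsub>Q\<^esub> p (\<ominus>\<^bsub>M\<^esub> x) = p \<zero>\<^bsub>M\<^esub>"
        using x by (simp add: a M.M.r_neg)
      then show "\<exists>y\<in>carrier M. p x \<oplus>\<^bsub>Q\<^esub> p y = p \<zero>\<^bsub>M\<^esub>" using x by blast
    qed
    show "\<forall>v w. v \<in> carrier Q \<and> w \<in> carrier Q \<longrightarrow> v \<oplus>\<^bsub>Q\<^esub> w = w \<oplus>\<^bsub>Q\<^esub> v"
      by (clarsimp simp: c a) (simp add: M.M.a_comm)
  qed ((clarsimp simp: c z a s; simp add: M.M.a_assoc M.smult_assoc1 M.smult_l_distr M.smult_r_distr a s)+)
  interpret Q: vectorspace K Q by (rule vs)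
  have hom: "p \<in> LinearCombinations.module_hom K M Q"
    by (auto simp: LinearCombinations.module_hom_def c a s)
  have fd: "Q.fin_dim"
  proof -
    interpret T: linear_map K M Q p by unfold_locales (rule hom)
    show ?thesis by (rule T.surj_fin_dim[OF M.fin_dim_module]) (simp add: c)
  qed
  show ?thesis
  proof (intro fd_right_module.intro fd_right_module_axioms.intro)
    show "vectorspace K Q" "fd_algebra K A" "Q.fin_dim" by (fact vs M.fd_algebra fd)+
    show "m \<cdot>\<^bsub>Q\<^esub> \<one>\<^bsub>A\<^esub> = m" if m: "m \<in> carrier Q" for m
    proof -
      obtain x where x: "x \<in> carrier M" "m = p x" using m unfolding c by (elim imageE)
      show ?thesis unfolding x(2) r[OF x(1) A.A.one_closed] M.ract_one[OF x(1)] ..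
    qed
  next
    fix m b assume "m \<in> carrier Q" and b: "b \<in> carrier A"
    then obtain x where x: "x \<in> carrier M" "m = p x" unfolding c by (elim imageE)
    show "m \<cdot>\<^bsub>Q\<^esub> b \<in> carrier Q"
      unfolding x(2) r[OF x(1) b] c by (rule imageI[OF M.ract_closed[OF x(1) b]])
    show "m \<cdot>\<^bsub>Q\<^esub> (b \<oplus>\<^bsub>A\<^esub> b') = m \<cdot>\<^bsub>Q\<^esub> b \<oplus>\<^bsub>Q\<^esub> m \<cdot>\<^bsub>Q\<^esub> b'" if "b' \<in> carrier A" for b'
      using x b that by (simp add: r a M.ract_closed M.ract_add_right)
    show "m \<cdot>\<^bsub>Q\<^esub> (b \<otimes>\<^bsub>A\<^esub> b') = m \<cdot>\<^bsub>Q\<^esub> b \<cdot>\<^bsub>Q\<^esub> b'" if "b' \<in> carrier A" for b'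
      using x b that by (simp add: r M.ract_closed M.ract_mult)
    show "m \<cdot>\<^bsub>Q\<^esub> (k \<odot>\<^bsub>A\<^esub> b) = k \<odot>\<^bsub>Q\<^esub> (m \<cdot>\<^bsub>Q\<^esub> b)" if "k \<in> carrier K" for k
      using x b that by (simp add: r s M.ract_closed M.ract_smult)
    show "(k \<odot>\<^bsub>Q\<^esub> m) \<cdot>\<^bsub>Q\<^esub> b = k \<odot>\<^bsub>Q\<^esub> (m \<cdot>\<^bsub>Q\<^esub> b)" if "k \<in> carrier K" for k
      using x b that by (simp add: r s M.ract_closed M.smult_ract)
    fix m' assume "m' \<in> carrier Q"
    then obtain y where y: "y \<in> carrier M" "m' = p y" unfolding c by (elim imageE)
    show "(m \<oplus>\<^bsub>Q\<^esub> m') \<cdot>\<^bsub>Q\<^esub> b = m \<cdot>\<^bsub>Q\<^esub> b \<oplus>\<^bsub>Q\<^esub> m' \<cdot>\<^bsub>Q\<^esub> b"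
      using x y b by (simp add: r a M.ract_closed M.ract_add_left)
  qed
qed

text \<open>All representatives of a coset contribute the same coset to the unions that define the operations of
  \<open>rmod_quot\<close>, so the canonical projection is a homomorphism.\<close>
lemma ses_cokernel:
  assumes Y: "fd_right_module K A Y" and M: "fd_right_module K A M"
    and j: "j \<in> rmod_hom K A Y M" "inj_on j (carrier Y)"
  shows "ses K A Y M (rmod_quot M (j ` carrier Y)) j (\<lambda>x. (j ` carrier Y) +>\<^bsub>M\<^esub> x)"
proof -
  interpret M: fd_right_module K A M by (rule M)
  let ?N = "j ` carrier Y"
  let ?Q = "rmod_quot M ?N" and ?p = "\<lambda>x. ?N +>\<^bsub>M\<^esub> x"
  note N = rsubmoduleD[OF im_rsubmodule[OF Y M j(1) carrier_rsubmodule[OF Y]]]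
  have neg: "\<ominus>\<^bsub>M\<^esub> x \<in> ?N" if x: "x \<in> ?N" for x
  proof -
    have "(\<ominus>\<^bsub>K\<^esub> \<one>\<^bsub>K\<^esub>) \<odot>\<^bsub>M\<^esub> x \<in> ?N" by (rule N(4)[OF _ x]) simp
    moreover have "x \<in> carrier M" using x N(1) by (rule rev_subsetD)
    ultimately show ?thesis by (simp only: M.smult_minus_1)
  qed
  have "subgroup ?N (add_monoid M)"
  proof (rule M.M.add.subgroupI)
    show "?N \<subseteq> carrier M" by (rule N(1))
    show "?N \<noteq> {}" using N(2) by blast
    show "\<And>a. a \<in> ?N \<Longrightarrow> \<ominus>\<^bsub>M\<^esub> a \<in> ?N" by (rule neg)
    show "\<And>a b. a \<in> ?N \<Longrightarrow> b \<in> ?N \<Longrightarrow> a \<oplus>\<^bsub>M\<^esub> b \<in> ?N" by (rule N(3))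
  qed
  note sg = this
  then have "additive_subgroup ?N M" by (rule additive_subgroup.intro)
  then interpret N: abelian_subgroup ?N M
    by (rule abelian_subgroupI3[OF _ M.M.abelian_group_axioms])
  have self: "x \<in> ?p x" if "x \<in> carrier M" for x using N.a_rcos_self[OF that] .
  have absorb: "?p y = ?p x" if "x \<in> carrier M" "y \<in> ?p x" for x y
    using M.M.a_repr_independence[OF that(2,1) sg] by simp
  have mem: "h \<oplus>\<^bsub>M\<^esub> x \<in> ?p x" if "h \<in> ?N" for h x
    using that unfolding a_r_coset_def' by blast
  have pe: "\<exists>h\<in>?N. y = h \<oplus>\<^bsub>M\<^esub> x" if "y \<in> ?p x" for x y
    using that unfolding a_r_coset_def' by blast
  have c: "carrier ?Q = ?p ` carrier M"
    by (auto simp: rmod_quot_def A_RCOSETS_def')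
  have z: "\<zero>\<^bsub>?Q\<^esub> = ?p \<zero>\<^bsub>M\<^esub>"
    using M.M.a_coset_add_zero[OF N(1)] by (simp add: rmod_quot_def)
  have a: "?p x \<oplus>\<^bsub>?Q\<^esub> ?p y = ?p (x \<oplus>\<^bsub>M\<^esub> y)" if "x \<in> carrier M" "y \<in> carrier M" for x y
    using N.a_rcos_sum[OF that] by (simp add: rmod_quot_def)
  have s: "k \<odot>\<^bsub>?Q\<^esub> ?p x = ?p (k \<odot>\<^bsub>M\<^esub> x)" if k: "k \<in> carrier K" and x: "x \<in> carrier M" for k x
  proof -
    have "?p (k \<odot>\<^bsub>M\<^esub> y) = ?p (k \<odot>\<^bsub>M\<^esub> x)" if "y \<in> ?p x" for y
    proof -
      obtain h where h: "h \<in> ?N" "y = h \<oplus>\<^bsub>M\<^esub> x" using pe[OF \<open>y \<in> ?p x\<close>] by blast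
      have "k \<odot>\<^bsub>M\<^esub> y = k \<odot>\<^bsub>M\<^esub> h \<oplus>\<^bsub>M\<^esub> k \<odot>\<^bsub>M\<^esub> x"
        unfolding h(2) by (rule M.smult_r_distr[OF k _ x]) (use h N(1) in blast)
      then show ?thesis using absorb[OF _ mem[OF N(4)[OF k h(1)]]] M.smult_closed[OF k x] by simp
    qed
    then have "(\<Union>y\<in>?p x. ?p (k \<odot>\<^bsub>M\<^esub> y)) = ?p (k \<odot>\<^bsub>M\<^esub> x)" using self[OF x] by blast
    then show ?thesis by (simp add: rmod_quot_def)
  qed
  have r: "?p x \<cdot>\<^bsub>?Q\<^esub> b = ?p (x \<cdot>\<^bsub>M\<^esub> b)" if x: "x \<in> carrier M" and b: "b \<in> carrier A" for x b
  proof -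
    have "?p (y \<cdot>\<^bsub>M\<^esub> b) = ?p (x \<cdot>\<^bsub>M\<^esub> b)" if "y \<in> ?p x" for y
    proof -
      obtain h where h: "h \<in> ?N" "y = h \<oplus>\<^bsub>M\<^esub> x" using pe[OF \<open>y \<in> ?p x\<close>] by blast
      have "y \<cdot>\<^bsub>M\<^esub> b = h \<cdot>\<^bsub>M\<^esub> b \<oplus>\<^bsub>M\<^esub> x \<cdot>\<^bsub>M\<^esub> b"
        unfolding h(2) by (rule M.ract_add_left[OF _ x b]) (use h N(1) in blast)
      then show ?thesis using absorb[OF _ mem[OF N(5)[OF h(1) b]]] M.ract_closed[OF x b] by simp
    qed
    then have "(\<Union>y\<in>?p x. ?p (y \<cdot>\<^bsub>M\<^esub> b)) = ?p (x \<cdot>\<^bsub>M\<^esub> b)" using self[OF x] by blast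
    then show ?thesis by (simp add: rmod_quot_def)
  qed
  have Q: "fd_right_module K A ?Q" by (rule fdm_surjective_image[OF M c z a s r])
  have "?p x = \<zero>\<^bsub>?Q\<^esub> \<longleftrightarrow> x \<in> ?N" if x: "x \<in> carrier M" for x
  proof
    assume "?p x = \<zero>\<^bsub>?Q\<^esub>"
    then have "?p x = ?N" by (simp add: rmod_quot_def)
    then show "x \<in> ?N" using self[OF x] by simp
  next
    assume "x \<in> ?N"
    then have "x \<in> ?p \<zero>\<^bsub>M\<^esub>" using M.M.a_coset_add_zero[OF N(1)] by simp
    then show "?p x = \<zero>\<^bsub>?Q\<^esub>" unfolding z by (rule absorb[OF M.M.zero_closed])
  qed
  then show ?thesis
    unfolding ses_def using Y M Q j c
    by (auto intro!: rmod_homI simp: a s r)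
qed

lemma ses_iso_right:
  assumes s: "ses K A Y P W i p" and W': "fd_right_module K A W'"
    and f: "f \<in> rmod_hom K A W W'" "bij_betw f (carrier W) (carrier W')"
  shows "ses K A Y P W' i (\<lambda>x. f (p x))"
proof -
  note S = sesD[OF s]
  have z: "f w = \<zero>\<^bsub>W'\<^esub> \<longleftrightarrow> w = \<zero>\<^bsub>W\<^esub>" if "w \<in> carrier W" for w
    using that f(2) hom_zero[OF S(3) W' f(1)] fdm_closed(1)[OF S(3)] unfolding bij_betw_def inj_on_def by metis
  have "(\<lambda>x. f (p x)) ` carrier P = carrier W'"
    using S(7) f(2) unfolding bij_betw_def image_image[symmetric] by simp
  then show ?thesis
    unfolding ses_def using S W' hom_comp[OF S(6) f(1)] z rmod_homD(1)[OF S(6)] by simp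
qed

section \<open>The regular module and its dual\<close>

lemma regular_module_simps [simp]:
  "carrier (regular_module A) = carrier A" "zero (regular_module A) = zero A"
  "add (regular_module A) = add A" "module.smult (regular_module A) = module.smult A"
  "ract (regular_module A) = mult A"
  by (simp_all add: regular_module_def)

lemma regular_module_fdm:
  assumes "fd_algebra K A"
  shows "fd_right_module K A (regular_module A)"
proof -
  interpret A: fd_algebra K A by fact
  note v = vectorspace_cong[OF A.vectorspace_axioms, of "regular_module A"]
  show ?thesis
  proof (intro fd_right_module.intro fd_right_module_axioms.intro)
    show "vectorspace K (regular_module A)" "vectorspace.fin_dim K (regular_module A)"
      using v A.fin_dim_algebra by simp_all
  qed (use assms in \<open>auto simp: A.A.l_distr A.A.r_distr A.A.m_assoc A.smult_mult_left A.smult_mult_right\<close>)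
qed

lemma hom_from_regular:
  assumes M: "fd_right_module K A M" and x: "x \<in> carrier M"
  shows "(\<lambda>a. x \<cdot>\<^bsub>M\<^esub> a) \<in> rmod_hom K A (regular_module A) M"
proof -
  interpret M: fd_right_module K A M by (rule M)
  show ?thesis
    by (rule rmod_homI) (use x in \<open>simp_all add: M.ract_closed M.ract_add_right M.ract_mult M.ract_smult\<close>)
qed

lemma regular_module_projective:
  assumes "fd_algebra K A"
  shows "projective_module K A (regular_module A)"
  unfolding projective_module_def
proof (intro conjI allI impI)
  interpret A: fd_algebra K A by fact
  show R: "fd_right_module K A (regular_module A)" by (rule regular_module_fdm[OF assms])
  fix M N :: "('a, 'b) fd_mod" and f g
  assume "fd_right_module K A M \<and> fd_right_module K A N \<and> f \<in> rmod_hom K A M N \<and>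
    f ` carrier M = carrier N \<and> g \<in> rmod_hom K A (regular_module A) N"
  then have MN: "fd_right_module K A M" "f \<in> rmod_hom K A M N"
    "f ` carrier M = carrier N" "g \<in> rmod_hom K A (regular_module A) N" by auto
  have "g \<one>\<^bsub>A\<^esub> \<in> f ` carrier M" using rmod_homD(1)[OF MN(4)] MN(3) by simp
  then obtain m where m: "m \<in> carrier M" "g \<one>\<^bsub>A\<^esub> = f m" by auto
  have "f (m \<cdot>\<^bsub>M\<^esub> a) = g a" if "a \<in> carrier A" for a
    using rmod_homD(4)[OF MN(4), of "\<one>\<^bsub>A\<^esub>" a] rmod_homD(4)[OF MN(2) m(1) that] m(2) that by simp
  then show "\<exists>h\<in>rmod_hom K A (regular_module A) M. \<forall>x\<in>carrier (regular_module A). f (h x) = g x"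
    using hom_from_regular[OF MN(1) m(1)] by auto
qed

lemma projective_in_add_regular:
  fixes K :: "'k ring" and A :: "('k, 'a) module"
  assumes P: "projective_module K A P"
  shows "in_add K A P (regular_module A)"
proof -
  note PF = projective_fdm[OF P]
  interpret P: fd_right_module K A P by (rule PF)
  interpret A: fd_algebra K A by (rule P.fd_algebra)
  note R = regular_module_fdm[OF P.fd_algebra]
  obtain E :: "('k, 'a) fd_mod" and q where E: "in_add K A E (regular_module A)" "q \<in> rmod_hom K A E P"
    "q ` carrier E = carrier P"
  proof (rule cover_by_add[OF PF R])
    fix x assume x: "x \<in> carrier P"
    show "\<exists>f\<in>rmod_hom K A (regular_module A) P. x \<in> f ` carrier (regular_module A)"
      by (rule bexI[OF _ hom_from_regular[OF PF x]], rule image_eqI[of _ _ "\<one>\<^bsub>A\<^esub>"])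
         (simp_all add: P.ract_one x)
  qed blast
  obtain s where s: "s \<in> rmod_hom K A P E" "\<And>x. x \<in> carrier P \<Longrightarrow> q (s x) = x"
    using projective_lift[OF P in_addD(1)[OF E(1)] PF E(2,3) hom_id] by metis
  have "in_add K A P E" by (rule in_add_retract[OF PF in_addD(1)[OF E(1)] s(1) E(2)]) (rule s(2))
  then show ?thesis by (rule in_add_trans[OF _ E(1)])
qed

text \<open>The dual of a left module: \<open>l\<close> is the left action of \<open>B\<close> on the vector space \<open>V\<close>. Both \<open>D(A)\<close> and
  \<open>D(Hom\<^sub>A(X, T))\<close> have this form.\<close>
definition dual_rmodule ::
    "'k ring \<Rightarrow> ('k, 'v) module \<Rightarrow> ('b \<Rightarrow> 'v \<Rightarrow> 'v) \<Rightarrow> ('k, 'b, 'v \<Rightarrow> 'k) rmodule"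
  where "dual_rmodule K V l =
    \<lparr>carrier = functionals K V, mult = undefined, one = undefined,
     zero = (\<lambda>x\<in>carrier V. \<zero>\<^bsub>K\<^esub>),
     add = (\<lambda>f g. \<lambda>x\<in>carrier V. f x \<oplus>\<^bsub>K\<^esub> g x),
     smult = (\<lambda>c f. \<lambda>x\<in>carrier V. c \<otimes>\<^bsub>K\<^esub> f x),
     ract = (\<lambda>f b. \<lambda>x\<in>carrier V. f (l b x))\<rparr>"

lemma dual_rmodule_simps [simp]:
  "carrier (dual_rmodule K V l) = functionals K V"
  "\<zero>\<^bsub>dual_rmodule K V l\<^esub> = (\<lambda>x\<in>carrier V. \<zero>\<^bsub>K\<^esub>)"
  "f \<oplus>\<^bsub>dual_rmodule K V l\<^esub> g = (\<lambda>x\<in>carrier V. f x \<oplus>\<^bsub>K\<^esub> g x)"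
  "c \<odot>\<^bsub>dual_rmodule K V l\<^esub> f = (\<lambda>x\<in>carrier V. c \<otimes>\<^bsub>K\<^esub> f x)"
  "f \<cdot>\<^bsub>dual_rmodule K V l\<^esub> b = (\<lambda>x\<in>carrier V. f (l b x))"
  by (simp_all add: dual_rmodule_def)

lemma dual_module_eq: "dual_module K A = dual_rmodule K A (mult A)"
  by (simp add: dual_module_def dual_rmodule_def functionals_def)

lemma dual_rmodule_fdm:
  assumes B: "fd_algebra K B" and V: "vectorspace K V" "vectorspace.fin_dim K V"
    and l: "\<And>b x. b \<in> carrier B \<Longrightarrow> x \<in> carrier V \<Longrightarrow> l b x \<in> carrier V"
    and l_add: "\<And>b x y. b \<in> carrier B \<Longrightarrow> x \<in> carrier V \<Longrightarrow> y \<in> carrier V \<Longrightarrow>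
      l b (x \<oplus>\<^bsub>V\<^esub> y) = l b x \<oplus>\<^bsub>V\<^esub> l b y"
    and l_smult: "\<And>b c x. b \<in> carrier B \<Longrightarrow> c \<in> carrier K \<Longrightarrow> x \<in> carrier V \<Longrightarrow>
      l b (c \<odot>\<^bsub>V\<^esub> x) = c \<odot>\<^bsub>V\<^esub> l b x"
    and add_l: "\<And>b b' x. b \<in> carrier B \<Longrightarrow> b' \<in> carrier B \<Longrightarrow> x \<in> carrier V \<Longrightarrow>
      l (b \<oplus>\<^bsub>B\<^esub> b') x = l b x \<oplus>\<^bsub>V\<^esub> l b' x"
    and smult_l: "\<And>b c x. b \<in> carrier B \<Longrightarrow> c \<in> carrier K \<Longrightarrow> x \<in> carrier V \<Longrightarrow>
      l (c \<odot>\<^bsub>B\<^esub> b) x = c \<odot>\<^bsub>V\<^esub> l b x"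
    and mult_l: "\<And>b b' x. b \<in> carrier B \<Longrightarrow> b' \<in> carrier B \<Longrightarrow> x \<in> carrier V \<Longrightarrow>
      l (b \<otimes>\<^bsub>B\<^esub> b') x = l b (l b' x)"
    and one_l: "\<And>x. x \<in> carrier V \<Longrightarrow> l \<one>\<^bsub>B\<^esub> x = x"
  shows "fd_right_module K B (dual_rmodule K V l)"
proof -
  interpret B: fd_algebra K B by (rule B)
  interpret V: vectorspace K V by (rule V)
  let ?D = "dual_rmodule K V l"
  note vc = vectorspace_cong[OF V.vectorspace_dual_space, of ?D]
  have vs: "vectorspace K ?D" and fd: "vectorspace.fin_dim K ?D"
    using vc fin_dim_dual_space[OF V] by (simp_all add: fun_eq_iff)
  have ext: "restrict f (carrier V) = restrict g (carrier V)" if "\<And>x. x \<in> carrier V \<Longrightarrow> f x = g x"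
    for f g :: "'c \<Rightarrow> 'a" using that by (rule restrict_ext)
  note F = functionalsD(1) and Fa = functionalsD(3) and Fs = functionalsD(4)
  show ?thesis
  proof (intro fd_right_module.intro fd_right_module_axioms.intro)
    show "vectorspace K ?D" "fd_algebra K B" "vectorspace.fin_dim K ?D" by (fact vs B fd)+
  next
    fix m a assume m: "m \<in> carrier ?D" and a: "a \<in> carrier B"
    then have m: "m \<in> functionals K V" by simp
    show "m \<cdot>\<^bsub>?D\<^esub> a \<in> carrier ?D" unfolding dual_rmodule_simps
      by (rule functionalsI) (simp_all add: a l l_add l_smult F[OF m] Fa[OF m] Fs[OF m])
  next
    fix m m' a assume m: "m \<in> carrier ?D" "m' \<in> carrier ?D" and a: "a \<in> carrier B"
    then show "(m \<oplus>\<^bsub>?D\<^esub> m') \<cdot>\<^bsub>?D\<^esub> a = m \<cdot>\<^bsub>?D\<^esub> a \<oplus>\<^bsub>?D\<^esub> m' \<cdot>\<^bsub>?D\<^esub> a"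
      unfolding dual_rmodule_simps by (intro ext) (simp add: l)
  next
    fix m a b assume m: "m \<in> carrier ?D" and ab: "a \<in> carrier B" "b \<in> carrier B"
    then have m: "m \<in> functionals K V" by simp
    show "m \<cdot>\<^bsub>?D\<^esub> (a \<oplus>\<^bsub>B\<^esub> b) = m \<cdot>\<^bsub>?D\<^esub> a \<oplus>\<^bsub>?D\<^esub> m \<cdot>\<^bsub>?D\<^esub> b"
      unfolding dual_rmodule_simps by (intro ext) (simp add: ab l add_l Fa[OF m])
    show "m \<cdot>\<^bsub>?D\<^esub> (a \<otimes>\<^bsub>B\<^esub> b) = m \<cdot>\<^bsub>?D\<^esub> a \<cdot>\<^bsub>?D\<^esub> b"
      unfolding dual_rmodule_simps by (intro ext) (simp add: ab l mult_l)
  next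
    fix m assume "m \<in> carrier ?D"
    then have m: "m \<in> functionals K V" by simp
    show "m \<cdot>\<^bsub>?D\<^esub> \<one>\<^bsub>B\<^esub> = m"
      unfolding dual_rmodule_simps
      by (rule extensionalityI[of _ "carrier V"]) (simp_all add: one_l functionalsD(5)[OF m])
  next
    fix c m a assume c: "c \<in> carrier K" and m: "m \<in> carrier ?D" and a: "a \<in> carrier B"
    then have m: "m \<in> functionals K V" by simp
    show "m \<cdot>\<^bsub>?D\<^esub> (c \<odot>\<^bsub>B\<^esub> a) = c \<odot>\<^bsub>?D\<^esub> (m \<cdot>\<^bsub>?D\<^esub> a)"
      unfolding dual_rmodule_simps by (intro ext) (simp add: a c l smult_l Fs[OF m])
    show "(c \<odot>\<^bsub>?D\<^esub> m) \<cdot>\<^bsub>?D\<^esub> a = c \<odot>\<^bsub>?D\<^esub> (m \<cdot>\<^bsub>?D\<^esub> a)"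
      unfolding dual_rmodule_simps by (intro ext) (simp add: a c l)
  qed
qed

lemma dual_module_simps:
  "carrier (dual_module K A) = functionals K A"
  "\<zero>\<^bsub>dual_module K A\<^esub> = (\<lambda>x\<in>carrier A. \<zero>\<^bsub>K\<^esub>)"
  "f \<oplus>\<^bsub>dual_module K A\<^esub> g = (\<lambda>x\<in>carrier A. f x \<oplus>\<^bsub>K\<^esub> g x)"
  "c \<odot>\<^bsub>dual_module K A\<^esub> f = (\<lambda>x\<in>carrier A. c \<otimes>\<^bsub>K\<^esub> f x)"
  "f \<cdot>\<^bsub>dual_module K A\<^esub> b = (\<lambda>x\<in>carrier A. f (b \<otimes>\<^bsub>A\<^esub> x))"
  by (simp_all add: dual_module_eq)

lemma dual_module_fdm:
  assumes "fd_algebra K A"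
  shows "fd_right_module K A (dual_module K A)"
proof -
  interpret A: fd_algebra K A by fact
  show ?thesis unfolding dual_module_eq
    by (rule dual_rmodule_fdm[OF assms A.vectorspace_axioms A.fin_dim_algebra])
      (simp_all add: A.A.l_distr A.A.r_distr A.A.m_assoc A.smult_mult_left A.smult_mult_right)
qed

text \<open>One direction of the adjunction \<open>Hom\<^sub>A(M, D(A)) \<cong> D(M)\<close>; the other one is evaluation at the unit.\<close>
lemma hom_to_dual:
  assumes M: "fd_right_module K A M" and m: "\<mu> \<in> functionals K M"
  shows "(\<lambda>x. \<lambda>a\<in>carrier A. \<mu> (x \<cdot>\<^bsub>M\<^esub> a)) \<in> rmod_hom K A M (dual_module K A)"
proof -
  interpret M: fd_right_module K A M by (rule M)
  interpret A: fd_algebra K A by (rule M.fd_algebra)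
  have ext: "restrict f (carrier A) = restrict g (carrier A)" if "\<And>x. x \<in> carrier A \<Longrightarrow> f x = g x"
    for f g :: "'b \<Rightarrow> 'a" using that by (rule restrict_ext)
  note c = M.ract_closed
  show ?thesis
  proof (rule rmod_homI, unfold dual_module_simps)
    fix x assume x: "x \<in> carrier M"
    show "(\<lambda>a\<in>carrier A. \<mu> (x \<cdot>\<^bsub>M\<^esub> a)) \<in> functionals K A"
      by (rule functionalsI) (simp_all add: x c functionalsD(1,3,4)[OF m] M.ract_add_right M.ract_smult)
  qed (intro ext; simp add: c functionalsD(1,3,4)[OF m] M.ract_add_left M.smult_ract M.ract_mult)+
qed

lemma dual_module_cogenerates:
  assumes M: "fd_right_module K A M" and x: "x \<in> carrier M" "x \<noteq> \<zero>\<^bsub>M\<^esub>"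
  shows "\<exists>f\<in>rmod_hom K A M (dual_module K A). f x \<noteq> \<zero>\<^bsub>dual_module K A\<^esub>"
proof -
  interpret M: fd_right_module K A M by (rule M)
  interpret A: fd_algebra K A by (rule M.fd_algebra)
  obtain \<mu> where \<mu>: "\<mu> \<in> functionals K M" "\<mu> x \<noteq> \<zero>\<^bsub>K\<^esub>"
    using M.separating_functional[OF M.fin_dim_module x] by blast
  have "(\<lambda>a\<in>carrier A. \<mu> (x \<cdot>\<^bsub>M\<^esub> a)) \<one>\<^bsub>A\<^esub> \<noteq> (\<lambda>a\<in>carrier A. \<zero>\<^bsub>K\<^esub>) \<one>\<^bsub>A\<^esub>"
    using \<mu>(2) x(1) by (simp add: M.ract_one)
  then have n: "(\<lambda>a\<in>carrier A. \<mu> (x \<cdot>\<^bsub>M\<^esub> a)) \<noteq> \<zero>\<^bsub>dual_module K A\<^esub>"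
    unfolding dual_module_simps by metis
  show ?thesis by (rule bexI[OF _ hom_to_dual[OF M \<mu>(1)]]) (rule n)
qed

text \<open>Under that adjunction, extending a homomorphism to \<open>D(A)\<close> means extending a functional.\<close>
lemma dual_module_injective:
  assumes A: "fd_algebra K A"
  shows "injective_module K A (dual_module K A)"
  unfolding injective_module_def
proof (intro conjI allI impI)
  interpret A: fd_algebra K A by fact
  show D: "fd_right_module K A (dual_module K A)" by (rule dual_module_fdm[OF A])
  fix M N :: "('a, 'b) fd_mod" and f g
  assume "fd_right_module K A M \<and> fd_right_module K A N \<and> f \<in> rmod_hom K A M N \<and>
    inj_on f (carrier M) \<and> g \<in> rmod_hom K A M (dual_module K A)"
  then have MN: "fd_right_module K A M" "fd_right_module K A N" "f \<in> rmod_hom K A M N"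
    "inj_on f (carrier M)" "g \<in> rmod_hom K A M (dual_module K A)" by auto
  interpret M: fd_right_module K A M by (rule MN)
  interpret N: fd_right_module K A N by (rule MN)
  have g: "g x \<in> functionals K A" if "x \<in> carrier M" for x
    using rmod_homD(1)[OF MN(5) that] by (simp add: dual_module_simps)
  have "(\<lambda>x\<in>carrier M. g x \<one>\<^bsub>A\<^esub>) \<in> functionals K M"
    by (rule functionalsI)
      (simp_all add: functionalsD(1)[OF g] rmod_homD(2)[OF MN(5)] rmod_homD(3)[OF MN(5)] dual_module_simps)
  then obtain \<mu> where \<mu>: "\<mu> \<in> functionals K N" "\<And>x. x \<in> carrier M \<Longrightarrow> \<mu> (f x) = (\<lambda>x\<in>carrier M. g x \<one>\<^bsub>A\<^esub>) x"
    by (rule N.functional_extension_inj[OF N.fin_dim_module M.vectorspace_axioms rmod_homD(5)[OF MN(3)] MN(4)])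
      (rule that, assumption, simp)
  have "(\<lambda>a\<in>carrier A. \<mu> (f x \<cdot>\<^bsub>N\<^esub> a)) = g x" if x: "x \<in> carrier M" for x
  proof (rule extensionalityI[of _ "carrier A"])
    fix a assume a: "a \<in> carrier A"
    have "\<mu> (f x \<cdot>\<^bsub>N\<^esub> a) = g (x \<cdot>\<^bsub>M\<^esub> a) \<one>\<^bsub>A\<^esub>"
      using \<mu>(2)[OF M.ract_closed[OF x a]] rmod_homD(4)[OF MN(3) x a] M.ract_closed[OF x a] by simp
    also have "\<dots> = g x a"
      using rmod_homD(4)[OF MN(5) x a] a by (simp add: dual_module_simps)
    finally show "(\<lambda>a\<in>carrier A. \<mu> (f x \<cdot>\<^bsub>N\<^esub> a)) a = g x a" using a by simp
  qed (use functionalsD(5)[OF g[OF x]] in simp_all)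
  then show "\<exists>h\<in>rmod_hom K A N (dual_module K A). \<forall>x\<in>carrier M. h (f x) = g x"
    by (intro bexI[OF _ hom_to_dual[OF MN(2) \<mu>(1)]] ballI)
qed

lemma injective_in_add_dual:
  fixes K :: "'k ring" and A :: "('k, 'a) module"
  assumes I: "injective_module K A I"
  shows "in_add K A I (dual_module K A)"
proof -
  note IF = injective_fdm[OF I]
  note D = dual_module_fdm[OF fd_right_module.fd_algebra[OF IF]]
  obtain E :: "('k, 'a) fd_mod" and j where E: "in_add K A E (dual_module K A)"
    "j \<in> rmod_hom K A I E" "inj_on j (carrier I)"
    by (rule embed_in_add[OF IF D dual_module_cogenerates[OF IF]])
  obtain s where s: "s \<in> rmod_hom K A E I" "\<And>x. x \<in> carrier I \<Longrightarrow> s (j x) = x"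
    using injective_extend[OF I IF in_addD(1)[OF E(1)] E(2,3) hom_id] by metis
  have "in_add K A I E" by (rule in_add_retract[OF IF in_addD(1)[OF E(1)] E(2) s(1)]) (rule s(2))
  then show ?thesis by (rule in_add_trans[OF _ E(1)])
qed

section \<open>Minimal injective resolutions\<close>

lemma image_dim_less:
  assumes M: "fd_right_module K A M" and N: "fd_right_module K A N" and f: "f \<in> rmod_hom K A M N"
    and x: "x \<in> carrier M" "x \<noteq> \<zero>\<^bsub>M\<^esub>" "f x = \<zero>\<^bsub>N\<^esub>"
  shows "vectorspace.dim K (N\<lparr>carrier := f ` carrier M\<rparr>) < vectorspace.dim K M"
proof -
  interpret M: fd_right_module K A M by fact
  interpret f: linear_map K M N f by (rule hom_linear_map[OF M N f])
  have kfd: "vectorspace.fin_dim K (M.vs f.kerT)"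
    by (rule M.subspace_fin_dim[OF M.fin_dim_module f.ker_is_submodule])
  interpret k: vectorspace K "M.vs f.kerT" by (rule M.subspace_vs[OF f.ker_is_submodule])
  have z: "LinearCombinations.submodule K {\<zero>\<^bsub>M\<^esub>} (M.vs f.kerT)"
    by (rule linear_submoduleI[OF k.module_axioms]) (auto simp: f.ker_def)
  have "x \<in> f.kerT" using x by (simp add: f.ker_def)
  then have "{\<zero>\<^bsub>M\<^esub>} \<noteq> carrier (M.vs f.kerT)" using x(2) by auto
  from k.proper_subspace_dim[OF kfd z this] have "0 < k.dim" by simp
  then show ?thesis using f.rank_nullity[OF M.fin_dim_module] by (simp add: f.im_def)
qed

text \<open>Among the endomorphisms of an injective module that fix a given submodule, one of minimal rank
  has an injective envelope of the submodule as its image.\<close>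
lemma injective_envelope:
  fixes K :: "'k ring" and A :: "('k, 'a) module"
  assumes X: "fd_right_module K A X"
  obtains E :: "('k, 'a) fd_mod" and j where "injective_module K A E" "j \<in> rmod_hom K A X E"
    "inj_on j (carrier X)" "essential_submodule K A E (j ` carrier X)"
proof -
  have Aalg: "fd_algebra K A" by (rule fd_right_module.fd_algebra[OF X])
  obtain E :: "('k, 'a) fd_mod" and j where E: "in_add K A E (dual_module K A)"
    "j \<in> rmod_hom K A X E" "inj_on j (carrier X)"
    by (rule embed_in_add[OF X dual_module_fdm[OF Aalg] dual_module_cogenerates[OF X]])
  have EI: "injective_module K A E" by (rule in_add_injective[OF E(1) dual_module_injective[OF Aalg]])
  note EF = in_addD(1)[OF E(1)]
  let ?d = "\<lambda>S. vectorspace.dim K (E\<lparr>carrier := S\<rparr>)"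
  let ?Q = "\<lambda>\<phi>. \<phi> \<in> rmod_hom K A E E \<and> (\<forall>x\<in>carrier X. \<phi> (j x) = j x)"
  have "?Q (\<lambda>x. x)" by (simp add: hom_id)
  then obtain \<phi> where \<phi>: "?Q \<phi>" and least: "\<And>\<psi>. ?Q \<psi> \<Longrightarrow> ?d (\<phi> ` carrier E) \<le> ?d (\<psi> ` carrier E)"
    using ex_has_least_nat[of ?Q "\<lambda>x. x" "\<lambda>\<phi>. ?d (\<phi> ` carrier E)"] by blast
  have \<phi>h: "\<phi> \<in> rmod_hom K A E E" and \<phi>j: "\<And>x. x \<in> carrier X \<Longrightarrow> \<phi> (j x) = j x" using \<phi> by auto
  define L where "L = \<phi> ` carrier E"
  define EL where "EL = E\<lparr>carrier := L\<rparr>"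
  have L: "rsubmodule K A E L" unfolding L_def by (rule im_rsubmodule[OF EF EF \<phi>h carrier_rsubmodule[OF EF]])
  note LD = rsubmoduleD[OF L]
  have ELF: "fd_right_module K A EL" unfolding EL_def by (rule submodule_fdm[OF EF L])
  have ELc [simp]: "carrier EL = L" "\<zero>\<^bsub>EL\<^esub> = \<zero>\<^bsub>E\<^esub>" by (simp_all add: EL_def)
  have \<phi>L: "\<phi> x \<in> L" if "x \<in> carrier E" for x using that by (simp add: L_def)
  have to_L: "\<phi> \<in> rmod_hom K A E EL" unfolding EL_def by (rule hom_to_submodule[OF \<phi>h \<phi>L])
  have on_L: "\<phi> \<in> rmod_hom K A EL EL"
    unfolding EL_def by (rule hom_from_submodule[OF to_L[unfolded EL_def] LD(1)])
  have inc: "(\<lambda>x. x) \<in> rmod_hom K A EL E" unfolding EL_def by (rule hom_inclusion[OF LD(1)])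
  \<comment> \<open>\<open>\<phi> \<circ> \<phi>\<close> also fixes \<open>X\<close>, so by minimality its rank is that of \<open>\<phi>\<close>.\<close>
  have "\<phi> ` L = L"
  proof (rule ccontr)
    assume ne: "\<phi> ` L \<noteq> L"
    have \<phi>\<phi>: "?Q (\<lambda>x. \<phi> (\<phi> x))" using hom_comp[OF \<phi>h \<phi>h] \<phi>j by auto
    have im: "(\<lambda>x. \<phi> (\<phi> x)) ` carrier E = \<phi> ` L" by (auto simp: L_def)
    have "\<phi> ` L \<subset> L" using ne \<phi>L LD(1) by blast
    then have "?d (\<phi> ` L) < ?d L" by (rule submodule_dim_less[OF EF im_rsubmodule[OF EF EF \<phi>h L] L])
    then show False using least[OF \<phi>\<phi>] unfolding im L_def[symmetric] by simp
  qed
  then have bij: "bij_betw \<phi> (carrier EL) (carrier EL)"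
    using endo_surj_imp_inj[OF ELF on_L] by (simp add: bij_betw_def)
  obtain \<sigma> where \<sigma>: "\<sigma> \<in> rmod_hom K A EL EL" "\<And>x. x \<in> carrier EL \<Longrightarrow> \<sigma> (\<phi> x) = x"
    using hom_inv[OF on_L bij ELF] by metis
  have "in_add K A EL E"
    by (rule in_add_retract[OF ELF EF inc hom_comp[OF to_L \<sigma>(1)]]) (rule \<sigma>(2))
  then have ELI: "injective_module K A EL" by (rule in_add_injective[OF _ EI])
  have jL: "j x \<in> L" if "x \<in> carrier X" for x
    using \<phi>L[OF rmod_homD(1)[OF E(2) that]] \<phi>j[OF that] by simp
  have jh: "j \<in> rmod_hom K A X EL" unfolding EL_def by (rule hom_to_submodule[OF E(2) jL])
  have "essential_submodule K A EL (j ` carrier X)"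
    unfolding essential_submodule_def
  proof (intro conjI allI impI)
    show "rsubmodule K A EL (j ` carrier X)"
      by (rule im_rsubmodule[OF X ELF jh carrier_rsubmodule[OF X]])
    fix C assume C: "rsubmodule K A EL C \<and> j ` carrier X \<inter> C = {\<zero>\<^bsub>EL\<^esub>}"
    then have CL: "rsubmodule K A EL C" and jC: "j ` carrier X \<inter> C = {\<zero>\<^bsub>E\<^esub>}" by auto
    show "C = {\<zero>\<^bsub>EL\<^esub>}"
    proof (rule ccontr)
      assume ne: "C \<noteq> {\<zero>\<^bsub>EL\<^esub>}"
      note CD = rsubmoduleD[OF CL]
      obtain c where c: "c \<in> C" "c \<noteq> \<zero>\<^bsub>E\<^esub>" using ne CD(2) by auto
      interpret E: fd_right_module K A E by (rule EF)
      let ?C = "EL\<lparr>carrier := C\<rparr>"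
      have CF: "fd_right_module K A ?C" by (rule submodule_fdm[OF ELF CL])
      note S = rmod_sum_fdm[OF X CF] and h = rmod_sum_homs[OF X CF]
      have Cinc: "(\<lambda>x. x) \<in> rmod_hom K A ?C E"
        by (rule hom_from_submodule[OF inc CD(1)])
      have CE: "y \<in> carrier E" if "y \<in> C" for y using that CD(1) LD(1) by auto
      have fh: "(\<lambda>v. j (fst v) \<oplus>\<^bsub>E\<^esub> snd v) \<in> rmod_hom K A (rmod_sum X ?C) E"
        by (rule hom_add[OF EF hom_comp[OF h(1) E(2)] hom_comp[OF h(2) Cinc]])
      have finj: "inj_on (\<lambda>v. j (fst v) \<oplus>\<^bsub>E\<^esub> snd v) (carrier (rmod_sum X ?C))"
      proof (rule hom_injI[OF S EF fh])
        fix v assume "v \<in> carrier (rmod_sum X ?C)" and e: "j (fst v) \<oplus>\<^bsub>E\<^esub> snd v = \<zero>\<^bsub>E\<^esub>"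
        then obtain x y where v: "v = (x, y)" "x \<in> carrier X" "y \<in> C" by auto
        have jx: "j x \<in> carrier E" using rmod_homD(1)[OF E(2) v(2)] .
        have "y = \<ominus>\<^bsub>E\<^esub> j x" using e v jx CE by (simp add: E.M.minus_equality E.M.a_comm)
        also have "\<dots> = j (\<ominus>\<^bsub>K\<^esub> \<one>\<^bsub>K\<^esub> \<odot>\<^bsub>X\<^esub> x)"
          using rmod_homD(3)[OF E(2), of "\<ominus>\<^bsub>K\<^esub> \<one>\<^bsub>K\<^esub>" x] v(2) jx by (simp add: E.smult_minus_1)
        finally have "y \<in> j ` carrier X" using fdm_closed(4)[OF X, of "\<ominus>\<^bsub>K\<^esub> \<one>\<^bsub>K\<^esub>" x] v(2) by simp
        then have y: "y = \<zero>\<^bsub>E\<^esub>" using jC v(3) by blast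
        then have "j x = \<zero>\<^bsub>E\<^esub>" using e v jx by simp
        then have "j x = j \<zero>\<^bsub>X\<^esub>" using hom_zero[OF X EF E(2)] by simp
        then have "x = \<zero>\<^bsub>X\<^esub>" using E(3) v(2) fdm_closed(1)[OF X] by (meson inj_onD)
        then show "v = \<zero>\<^bsub>rmod_sum X ?C\<^esub>" using v y by simp
      qed
      \<comment> \<open>The projection \<open>X \<oplus> C \<rightarrow> X\<close> extends to an endomorphism that fixes \<open>X\<close> and kills \<open>c \<in> L\<close>; composed with \<open>\<phi>\<close> it has smaller rank.\<close>
      obtain \<chi> where \<chi>: "\<chi> \<in> rmod_hom K A E E"
        "\<And>v. v \<in> carrier (rmod_sum X ?C) \<Longrightarrow> \<chi> (j (fst v) \<oplus>\<^bsub>E\<^esub> snd v) = j (fst v)"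
        using injective_extend[OF EI S EF fh finj hom_comp[OF h(1) E(2)]] by metis
      have \<chi>j: "\<chi> (j x) = j x" if "x \<in> carrier X" for x
        using \<chi>(2)[of "(x, \<zero>\<^bsub>E\<^esub>)"] that CD(2) rmod_homD(1)[OF E(2) that] by simp
      have \<chi>c: "\<chi> c = \<zero>\<^bsub>E\<^esub>"
        using \<chi>(2)[of "(\<zero>\<^bsub>X\<^esub>, c)"] c CE fdm_closed(1)[OF X] hom_zero[OF X EF E(2)] by simp
      have Q: "?Q (\<lambda>x. \<chi> (\<phi> x))" using hom_comp[OF \<phi>h \<chi>(1)] \<chi>j \<phi>j by auto
      have im: "(\<lambda>x. \<chi> (\<phi> x)) ` carrier E = \<chi> ` carrier EL" by (auto simp: L_def)
      have "\<chi> \<in> rmod_hom K A EL E" unfolding EL_def by (rule hom_from_submodule[OF \<chi>(1) LD(1)])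
      then have "?d (\<chi> ` carrier EL) < vectorspace.dim K EL"
        by (rule image_dim_less[OF ELF EF, of \<chi> c]) (use c CD(1) \<chi>c in auto)
      then show False using least[OF Q] unfolding im L_def[symmetric] by (simp add: EL_def)
    qed
  qed
  then show thesis by (rule that[OF ELI jh E(3)])
qed

text \<open>Injective envelopes of successive cokernels. Each cokernel is replaced by a copy in the type of the
  previous module, so that the construction can be iterated.\<close>
lemma ex_minimal_injective_resolution:
  fixes K :: "'k ring" and A :: "('k, 'a) module"
  assumes X: "fd_right_module K A X"
  shows "\<exists>(I :: nat \<Rightarrow> ('k, 'a) fd_mod) e d. minimal_injective_resolution K A X e I d"
proof -
  have step: "\<exists>(E :: ('k, 'a) fd_mod) (W :: ('k, 'a) fd_mod) j p. fd_right_module K A Y \<longrightarrow>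
    injective_module K A E \<and> ses K A Y E W j p \<and> essential_submodule K A E (j ` carrier Y)"
    for Y :: "('k, 'a) fd_mod"
  proof (cases "fd_right_module K A Y")
    case Y: True
    obtain E :: "('k, 'a) fd_mod" and j where E: "injective_module K A E" "j \<in> rmod_hom K A Y E"
      "inj_on j (carrier Y)" "essential_submodule K A E (j ` carrier Y)"
      using injective_envelope[OF Y] by metis
    note s = ses_cokernel[OF Y injective_fdm[OF E(1)] E(2,3)]
    obtain W :: "('k, 'a) fd_mod" and f where W: "fd_right_module K A W"
      "f \<in> rmod_hom K A (rmod_quot E (j ` carrier Y)) W"
      "bij_betw f (carrier (rmod_quot E (j ` carrier Y))) (carrier W)"
      using ex_isomorphic_fd_module[OF sesD(3)[OF s]] unfolding rmod_iso_def by blast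
    show ?thesis using E ses_iso_right[OF s W] by blast
  qed blast
  obtain E W :: "('k, 'a) fd_mod \<Rightarrow> ('k, 'a) fd_mod" and j p where
    EW: "\<And>Y. fd_right_module K A Y \<Longrightarrow> injective_module K A (E Y)"
    "\<And>Y. fd_right_module K A Y \<Longrightarrow> ses K A Y (E Y) (W Y) (j Y) (p Y)"
    "\<And>Y. fd_right_module K A Y \<Longrightarrow> essential_submodule K A (E Y) (j Y ` carrier Y)"
    using step by metis
  obtain X0 :: "('k, 'a) fd_mod" and f where X0: "fd_right_module K A X0"
    and f: "f \<in> rmod_hom K A X X0" "bij_betw f (carrier X) (carrier X0)"
    using ex_isomorphic_fd_module[OF X] unfolding rmod_iso_def by blast
  define s where "s n = (W ^^ n) X0" for n
  have s0: "s 0 = X0" and sS: "s (Suc n) = W (s n)" for n by (simp_all add: s_def)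
  have s: "fd_right_module K A (s n)" for n
  proof (induction n)
    case (Suc n)
    show ?case unfolding sS by (rule sesD(3)[OF EW(2)[OF Suc]])
  qed (simp add: s0 X0)
  note inj = EW(1)[OF s] and ss = EW(2)[OF s, folded sS] and ess = EW(3)[OF s]
  define I where "I n = E (s n)" for n
  define d where "d n x = j (s (Suc n)) (p (s n) x)" for n x
  define e where "e x = j X0 (f x)" for x
  have im_e: "e ` carrier X = j (s 0) ` carrier (s 0)"
    using f(2) unfolding e_def s0 bij_betw_def image_image[symmetric] by simp
  have im_d: "d n ` carrier (I n) = j (s (Suc n)) ` carrier (s (Suc n))" for n
    using sesD(7)[OF ss[of n]] unfolding d_def I_def image_image[symmetric] by simp
  have dh: "d n \<in> rmod_hom K A (I n) (I (Suc n))" for n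
    unfolding d_def I_def by (rule hom_comp[OF sesD(6)[OF ss] sesD(4)[OF ss]])
  have ker: "rmod_ker (I n) (I (Suc n)) (d n) = j (s n) ` carrier (s n)" for n
  proof -
    note S = sesD[OF ss[of n]] and S' = sesD[OF ss[of "Suc n"]]
    have "j (s (Suc n)) w = \<zero>\<^bsub>E (s (Suc n))\<^esub> \<longleftrightarrow> w = \<zero>\<^bsub>s (Suc n)\<^esub>" if "w \<in> carrier (s (Suc n))" for w
      using that S'(5) hom_zero[OF S'(1,2,4)] fdm_closed(1)[OF S'(1)] by (metis inj_onD)
    then have "d n x = \<zero>\<^bsub>I (Suc n)\<^esub> \<longleftrightarrow> x \<in> j (s n) ` carrier (s n)" if "x \<in> carrier (I n)" for x
      using that S(8) rmod_homD(1)[OF S(6)] unfolding d_def I_def by simp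
    moreover have "j (s n) ` carrier (s n) \<subseteq> carrier (I n)"
      using rmod_homD(1)[OF S(4)] unfolding I_def by auto
    ultimately show ?thesis unfolding rmod_ker_def by blast
  qed
  have "minimal_injective_resolution K A X e I d"
    unfolding minimal_injective_resolution_def injective_resolution_def
  proof (intro conjI allI)
    show "e \<in> rmod_hom K A X (I 0)"
      unfolding e_def I_def s0 using hom_comp[OF f(1)] sesD(4)[OF ss[of 0]] unfolding s0 by blast
    show "inj_on e (carrier X)"
    proof -
      have "inj_on (j X0) (f ` carrier X)" using sesD(5)[OF ss[of 0]] f(2) unfolding s0 bij_betw_def by simp
      then show ?thesis using comp_inj_on[of f "carrier X" "j X0"] f(2) unfolding e_def bij_betw_def comp_def by blast
    qed
    show "rmod_ker (I 0) (I 1) (d 0) = e ` carrier X" using ker[of 0] im_e by simp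
    show "rmod_ker (I (Suc i)) (I (Suc (Suc i))) (d (Suc i)) = d i ` carrier (I i)" for i
      unfolding ker im_d ..
    show "essential_submodule K A (I 0) (e ` carrier X)" unfolding im_e I_def by (rule ess)
    show "essential_submodule K A (I (Suc i)) (d i ` carrier (I i))" for i
      unfolding im_d unfolding I_def by (rule ess)
    show "injective_module K A (I i)" for i unfolding I_def by (rule inj)
  qed (use X dh in simp_all)
  then show ?thesis by blast
qed

section \<open>Comparison of resolutions\<close>

text \<open>The cosyzygies \<open>\<Omega>\<^bsup>-i\<^esup>\<close>, taken as kernels so that degree zero is uniform with the others.\<close>
definition cycles ::
    "(nat \<Rightarrow> ('k, 'a, 'm) rmodule) \<Rightarrow> (nat \<Rightarrow> 'm \<Rightarrow> 'm) \<Rightarrow> nat \<Rightarrow> ('k, 'a, 'm) rmodule"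
  where "cycles I d i = (I i)\<lparr>carrier := rmod_ker (I i) (I (Suc i)) (d i)\<rparr>"

lemma resolutionD:
  assumes "injective_resolution K A M e I d"
  shows "fd_right_module K A M" "\<And>i. injective_module K A (I i)" "\<And>i. fd_right_module K A (I i)"
    "e \<in> rmod_hom K A M (I 0)" "inj_on e (carrier M)" "\<And>i. d i \<in> rmod_hom K A (I i) (I (Suc i))"
    "rmod_ker (I 0) (I 1) (d 0) = e ` carrier M"
    "\<And>i. rmod_ker (I (Suc i)) (I (Suc (Suc i))) (d (Suc i)) = d i ` carrier (I i)"
  using assms unfolding injective_resolution_def by (simp_all add: injective_fdm)

lemma resolution_ses:
  assumes r: "injective_resolution K A M e I d"
  shows "ses K A (cycles I d i) (I i) (cycles I d (Suc i)) (\<lambda>x. x) (d i)"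
proof -
  note R = resolutionD[OF r]
  have k: "rsubmodule K A (I i) (rmod_ker (I i) (I (Suc i)) (d i))" for i
    unfolding rmod_ker_def by (rule ker_rsubmodule[OF R(3,3,6)])
  have c: "fd_right_module K A (cycles I d i)" for i
    unfolding cycles_def by (rule submodule_fdm[OF R(3) k])
  have h: "d i \<in> rmod_hom K A (I i) (cycles I d (Suc i))"
    unfolding cycles_def by (rule hom_to_submodule[OF R(6)]) (simp add: R(8))
  have inc: "(\<lambda>x. x) \<in> rmod_hom K A (cycles I d i) (I i)"
    unfolding cycles_def by (rule hom_inclusion[OF rsubmoduleD(1)[OF k]])
  show ?thesis unfolding ses_def
  proof (intro conjI c R(3) h inc ballI)
    show "d i ` carrier (I i) = carrier (cycles I d (Suc i))" by (simp add: cycles_def R(8))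
    show "d i x = \<zero>\<^bsub>cycles I d (Suc i)\<^esub> \<longleftrightarrow> x \<in> (\<lambda>x. x) ` carrier (cycles I d i)" if "x \<in> carrier (I i)" for x
      using that by (simp add: cycles_def rmod_ker_def)
  qed (simp add: inj_on_def)
qed

lemma resolution_start:
  assumes r: "injective_resolution K A M e I d"
  shows "e \<in> rmod_hom K A M (cycles I d 0)" "bij_betw e (carrier M) (carrier (cycles I d 0))"
proof -
  note R = resolutionD[OF r]
  show "e \<in> rmod_hom K A M (cycles I d 0)"
    unfolding cycles_def by (rule hom_to_submodule[OF R(4)]) (simp add: R(7)[simplified])
  show "bij_betw e (carrier M) (carrier (cycles I d 0))"
    using R(5) R(7)[simplified] by (simp add: bij_betw_def cycles_def)
qed

lemma cycles_in_add:
  assumes r: "injective_resolution K A M e I d"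
  shows "in_add K A M (cycles I d 0)" "in_add K A (cycles I d 0) M"
  using in_add_bij[OF resolutionD(1)[OF r] sesD(1)[OF resolution_ses[OF r]] resolution_start[OF r]] by auto

lemma cycles_before_zero:
  assumes r: "injective_resolution K A M e I d" and z: "carrier (I (Suc i)) = {\<zero>\<^bsub>I (Suc i)\<^esub>}"
  shows "cycles I d i = I i"
proof -
  have "rmod_ker (I i) (I (Suc i)) (d i) = carrier (I i)"
    using rmod_homD(1)[OF resolutionD(6)[OF r], of _ i] z by (auto simp: rmod_ker_def)
  then show ?thesis by (simp add: cycles_def)
qed

text \<open>Applied to two minimal resolutions of the same module, this is their uniqueness up to \<open>add\<close>. Applied to
  an arbitrary resolution, it bounds the minimal one: projectivity and vanishing of terms are inherited.\<close>
lemma minimal_terms_in_add: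
  assumes J: "minimal_injective_resolution K A X e J d"
    and s: "\<And>i. ses K A (Z i) (I i) (Z (Suc i)) (a i) (b i)"
    and I: "\<And>i. injective_module K A (I i)" and X: "in_add K A X (Z 0)"
  shows "in_add K A (J i) (I i)"
proof -
  have r: "injective_resolution K A X e J d" using J by (simp add: minimal_injective_resolution_def)
  note R = resolutionD[OF r]
  have ess: "essential_submodule K A (J i) ((\<lambda>x. x) ` carrier (cycles J d i))" for i
    using J by (cases i) (simp_all add: cycles_def R(7)[simplified] R(8) minimal_injective_resolution_def)
  have c: "in_add K A (cycles J d i) (Z i)" for i
  proof (induction i)
    case 0 show ?case by (rule in_add_trans[OF cycles_in_add(2)[OF r] X])
  next
    case (Suc i)
    show ?case by (rule minimal_cosyzygy_in_add(2)[OF resolution_ses[OF r] R(2) ess s I Suc])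
  qed
  show ?thesis by (rule minimal_cosyzygy_in_add(1)[OF resolution_ses[OF r] R(2) ess s I c])
qed

lemma minimal_resolutions_in_add:
  assumes J: "minimal_injective_resolution K A X e J d" and I: "injective_resolution K A Y e' I d'"
    and X: "in_add K A X Y"
  shows "in_add K A (J i) (I i)"
  by (rule minimal_terms_in_add[where Z = "cycles I d'" and I = I and a = "\<lambda>i x. x" and b = d',
        OF J resolution_ses[OF I] resolutionD(2)[OF I]])
    (rule in_add_trans[OF X cycles_in_add(1)[OF I]])

text \<open>The terms of any two minimal resolutions are in \<open>add\<close> of each other, so the choice of the resolution in
  the definition of \<open>domdim\<close> does not affect which terms are projective.\<close>
lemma domdim_eq_iff:
  fixes K :: "'k ring" and A :: "('k, 'a) module"
  assumes I: "minimal_injective_resolution K A M e I d" and n: "n \<ge> 1"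
  shows "domdim K A M = enat n \<longleftrightarrow> (\<forall>i<n. projective_module K A (I i)) \<and> \<not> projective_module K A (I n)"
proof -
  have r: "injective_resolution K A M e I d" using I by (simp add: minimal_injective_resolution_def)
  note M = resolutionD(1)[OF r]
  define I' where "I' = (SOME I' :: nat \<Rightarrow> ('k, 'a) fd_mod. \<exists>e d. minimal_injective_resolution K A M e I' d)"
  have "\<exists>e d. minimal_injective_resolution K A M e I' d"
    unfolding I'_def by (rule someI_ex[OF ex_minimal_injective_resolution[OF M]])
  then obtain e' d' where I': "minimal_injective_resolution K A M e' I' d'" by blast
  have r': "injective_resolution K A M e' I' d'" using I' by (simp add: minimal_injective_resolution_def)
  have p: "projective_module K A (I' i) \<longleftrightarrow> projective_module K A (I i)" for i
    using in_add_projective[OF minimal_resolutions_in_add[OF I r' in_add_refl[OF M], of i]]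
      in_add_projective[OF minimal_resolutions_in_add[OF I' r in_add_refl[OF M], of i]] by blast
  have dd: "domdim K A M = (if \<not> projective_module K A (I 0) then 0
        else Sup {enat n | n. \<forall>i\<le>n. projective_module K A (I i)} + 1)"
    unfolding domdim_def Let_def I'_def[symmetric] p ..
  show ?thesis
  proof (cases "\<exists>k. \<not> projective_module K A (I k)")
    case False
    have "infinite (range enat)" by (rule range_inj_infinite) (simp add: inj_on_def)
    moreover have "{enat n | n. \<forall>i\<le>n. projective_module K A (I i)} = range enat" using False by auto
    ultimately have "domdim K A M = \<infinity>" using False unfolding dd Sup_enat_def by simp
    then show ?thesis using False by simp
  next
    case True
    define k where "k = (LEAST k. \<not> projective_module K A (I k))"
    have k: "\<not> projective_module K A (I k)" unfolding k_def using True by (rule LeastI_ex)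
    have lt: "projective_module K A (I i)" if "i < k" for i using not_less_Least that unfolding k_def by blast
    have rhs: "(\<forall>i<n. projective_module K A (I i)) \<and> \<not> projective_module K A (I n) \<longleftrightarrow> n = k"
      using k lt by (metis linorder_neqE_nat)
    have "domdim K A M = enat k"
    proof (cases k)
      case 0 then show ?thesis using k unfolding dd by (simp add: zero_enat_def)
    next
      case (Suc k')
      have S: "{enat n | n. \<forall>i\<le>n. projective_module K A (I i)} = enat ` {..k'}"
        using k lt Suc by (auto simp: image_iff) (metis not_less_eq_eq)
      have m: "Max (enat ` {..k'}) = enat k'"
        by (rule Max_eqI) auto
      show ?thesis using lt[of 0] Suc unfolding dd S Sup_enat_def m
        by (simp add: one_enat_def)
    qed
    then show ?thesis using rhs by auto
  qed
qed

lemma Inf_enat_attained: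
  assumes "Inf {enat n | n. P n} = enat m"
  shows "P m"
proof -
  have ne: "{enat n | n. P n} \<noteq> {}" using assms unfolding Inf_enat_def by (auto split: if_splits)
  then obtain x where "x \<in> {enat n | n. P n}" by blast
  then have "(LEAST x. x \<in> {enat n | n. P n}) \<in> {enat n | n. P n}" by (rule LeastI)
  then have "Inf {enat n | n. P n} \<in> {enat n | n. P n}"
    unfolding Inf_enat_def using ne by (simp only: if_False)
  then show ?thesis using assms by simp
qed

lemma injdim_minimal_resolution:
  fixes K :: "'k ring" and A :: "('k, 'a) module"
  assumes J: "minimal_injective_resolution K A M e J d" and n: "injdim K A M = enat n" and i: "i > n"
  shows "carrier (J i) = {\<zero>\<^bsub>J i\<^esub>}"
proof -
  obtain e' d' and I :: "nat \<Rightarrow> ('k, 'a) fd_mod" where I: "injective_resolution K A M e' I d'"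
    "\<forall>i>n. carrier (I i) = {\<zero>\<^bsub>I i\<^esub>}"
    using Inf_enat_attained[OF n[unfolded injdim_def]] by blast
  show ?thesis
    by (rule in_add_zero[OF minimal_resolutions_in_add[OF J I(1) in_add_refl[OF resolutionD(1)[OF I(1)]]]])
      (use I(2) i in blast)
qed

text \<open>The sequence of syzygies starts with a copy of \<open>M\<close>, because all its members have to be of one type.\<close>
lemma projdim_syzygies:
  fixes K :: "'k ring" and A :: "('k, 'a) module"
  assumes n: "projdim K A M = enat n"
  obtains L P :: "nat \<Rightarrow> ('k, 'a) fd_mod" and q where "in_add K A M (L 0)" "in_add K A (L 0) M"
    "\<And>i. ses K A (L (Suc i)) (P i) (L i) (\<lambda>x. x) (q i)"
    "\<And>i. projective_module K A (P i)" "projective_module K A (L n)"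
proof -
  obtain p d and P :: "nat \<Rightarrow> ('k, 'a) fd_mod" where "projective_resolution K A M p P d"
    and P0: "\<forall>i>n. carrier (P i) = {\<zero>\<^bsub>P i\<^esub>}"
    using Inf_enat_attained[OF n[unfolded projdim_def]] by blast
  then have M: "fd_right_module K A M" and P: "\<And>i. projective_module K A (P i)"
    and p: "p \<in> rmod_hom K A (P 0) M" "p ` carrier (P 0) = carrier M"
    and d: "\<And>i. d i \<in> rmod_hom K A (P (Suc i)) (P i)"
    and k0: "rmod_ker (P 0) M p = d 0 ` carrier (P 1)"
    and k: "\<And>i. rmod_ker (P (Suc i)) (P i) (d i) = d (Suc i) ` carrier (P (Suc (Suc i)))"
    unfolding projective_resolution_def by auto
  note PF = projective_fdm[OF P]
  obtain J :: "('k, 'a) fd_mod" and f where J: "fd_right_module K A J"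
    and f: "f \<in> rmod_hom K A M J" "bij_betw f (carrier M) (carrier J)"
    using ex_isomorphic_fd_module[OF M] unfolding rmod_iso_def by blast
  define L where "L i = (case i of 0 \<Rightarrow> J | Suc i \<Rightarrow> (P i)\<lparr>carrier := d i ` carrier (P (Suc i))\<rparr>)" for i
  define q where "q i = (case i of 0 \<Rightarrow> (\<lambda>x. f (p x)) | Suc i \<Rightarrow> d i)" for i
  have s: "ses K A (L (Suc i)) (P i) (L i) (\<lambda>x. x) (q i)" for i
  proof (cases i)
    case 0
    have "ses K A ((P 0)\<lparr>carrier := rmod_ker (P 0) M p\<rparr>) (P 0) M (\<lambda>x. x) p"
      unfolding rmod_ker_def by (rule ses_kernel[OF PF M p])
    from ses_iso_right[OF this J f] show ?thesis by (simp add: 0 L_def q_def k0)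
  next
    case (Suc j)
    let ?W = "(P j)\<lparr>carrier := d j ` carrier (P (Suc j))\<rparr>"
    have W: "fd_right_module K A ?W"
      by (rule submodule_fdm[OF PF im_rsubmodule[OF PF PF d carrier_rsubmodule[OF PF]]])
    have "d j \<in> rmod_hom K A (P (Suc j)) ?W" by (rule hom_to_submodule[OF d]) simp
    from ses_kernel[OF PF W this] have "ses K A ((P (Suc j))\<lparr>carrier := rmod_ker (P (Suc j)) (P j) (d j)\<rparr>)
      (P (Suc j)) ?W (\<lambda>x. x) (d j)" unfolding rmod_ker_def by simp
    then show ?thesis by (simp add: Suc L_def q_def k)
  qed
  have "carrier (L (Suc n)) = {\<zero>\<^bsub>L (Suc n)\<^esub>}"
    using P0[rule_format, of "Suc n"] hom_zero[OF PF PF d, of n] by (simp add: L_def)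
  then have "inj_on (q n) (carrier (P n))"
    using sesD(8)[OF s, of _ n] hom_zero[OF sesD(1,2,4)[OF s[of n]]]
    by (intro hom_injI[OF sesD(2,3,6)[OF s[of n]]]) auto
  then have "in_add K A (L n) (P n)"
    by (intro in_add_bij(2)[OF sesD(2,3,6)[OF s[of n]]]) (simp add: bij_betw_def sesD(7)[OF s[of n]])
  then have Ln: "projective_module K A (L n)" by (rule in_add_projective[OF _ P])
  have L0: "L 0 = J" by (simp add: L_def)
  show thesis by (rule that[of L P q]) (use in_add_bij[OF M J f] L0 s P Ln in simp_all)
qed

section \<open>Duals of algebras with large dominant dimension\<close>

text \<open>A one-sided form of Schanuel's lemma: if \<open>Y\<close> is a retract of \<open>Y'\<close> up to maps that factor through
  projectives, then the same holds for the kernels of surjections from projective modules. After all maps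
  have been lifted, the defect on \<open>Q\<close> has values in \<open>L\<close>, and its restriction to \<open>L\<close> factors through \<open>Q\<close>.\<close>
lemma stable_retract_syzygy:
  assumes s: "ses K A L Q Y i q" and Q: "projective_module K A Q"
    and s': "ses K A L' Q' Y' i' q'" and Q': "projective_module K A Q'"
    and f: "f \<in> rmod_hom K A Y Y'" and g: "g \<in> rmod_hom K A Y' Y"
    and \<psi>: "\<psi> \<in> factor_thru K A (regular_module A) Y Y"
    and id: "\<And>y. y \<in> carrier Y \<Longrightarrow> y = g (f y) \<oplus>\<^bsub>Y\<^esub> \<psi> y"
  shows "\<exists>f\<in>rmod_hom K A L L'. \<exists>g\<in>rmod_hom K A L' L. \<exists>\<psi>\<in>factor_thru K A (regular_module A) L L.
    \<forall>x\<in>carrier L. x = g (f x) \<oplus>\<^bsub>L\<^esub> \<psi> x"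
proof -
  note S = sesD[OF s] and S' = sesD[OF s']
  have R: "projective_module K A (regular_module A)"
    by (rule regular_module_projective[OF fd_right_module.fd_algebra[OF S(1)]])
  obtain F where F: "F \<in> rmod_hom K A Q Q'" "\<And>x. x \<in> carrier Q \<Longrightarrow> q' (F x) = f (q x)"
    using projective_lift[OF Q S'(2,3,6,7) hom_comp[OF S(6) f]] by metis
  obtain G where G: "G \<in> rmod_hom K A Q' Q" "\<And>x. x \<in> carrier Q' \<Longrightarrow> q (G x) = g (q' x)"
    using projective_lift[OF Q' S(2,3,6,7) hom_comp[OF S'(6) g]] by metis
  obtain \<sigma> where \<sigma>: "\<sigma> \<in> factor_thru K A (regular_module A) Y Q" "\<And>y. y \<in> carrier Y \<Longrightarrow> q (\<sigma> y) = \<psi> y"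
    using factor_thru_lift[OF R S(2,3,6,7) \<psi> S(3)] by metis
  note \<sigma>h = factor_thru_hom[OF \<sigma>(1) S(3,2)]
  note FD = rmod_homD(1)[OF F(1)] and GD = rmod_homD(1)[OF G(1)] and \<sigma>D = rmod_homD(1)[OF \<sigma>h]
    and qD = rmod_homD(1)[OF S(6)] and iD = rmod_homD(1)[OF S(4)]
  have GFh: "(\<lambda>x. G (F x) \<oplus>\<^bsub>Q\<^esub> \<sigma> (q x)) \<in> rmod_hom K A Q Q"
    by (rule hom_add[OF S(2) hom_comp[OF F(1) G(1)] hom_comp[OF S(6) \<sigma>h]])
  have GFD: "G (F x) \<oplus>\<^bsub>Q\<^esub> \<sigma> (q x) \<in> carrier Q" if "x \<in> carrier Q" for x using rmod_homD(1)[OF GFh that] .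
  have qGF: "q (G (F x) \<oplus>\<^bsub>Q\<^esub> \<sigma> (q x)) = q x" if "x \<in> carrier Q" for x
    using that id[OF qD[OF that]] by (simp add: rmod_homD(2)[OF S(6)] FD GD qD \<sigma>D F(2) G(2) \<sigma>(2))
  obtain t where t: "t \<in> rmod_hom K A Q L"
    "\<And>x. x \<in> carrier Q \<Longrightarrow> i (t x) = x \<ominus>\<^bsub>Q\<^esub> (G (F x) \<oplus>\<^bsub>Q\<^esub> \<sigma> (q x))"
    by (rule ses_corestrict[OF s hom_diff[OF S(2,2) hom_id GFh]])
      (simp_all add: hom_minus[OF S(2,3,6)] GFD qGF qD fdm_diff_eq_zero[OF S(3)])
  obtain f1 where f1: "f1 \<in> rmod_hom K A L L'" "\<And>x. x \<in> carrier L \<Longrightarrow> i' (f1 x) = F (i x)"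
    by (rule ses_corestrict[OF s' hom_comp[OF S(4) F(1)]])
      (simp_all add: F(2) iD S(9) hom_zero[OF S(3) S'(3) f])
  obtain g1 where g1: "g1 \<in> rmod_hom K A L' L" "\<And>x. x \<in> carrier L' \<Longrightarrow> i (g1 x) = G (i' x)"
    by (rule ses_corestrict[OF s hom_comp[OF S'(4) G(1)]])
      (simp_all add: G(2) rmod_homD(1)[OF S'(4)] S'(9) hom_zero[OF S'(3) S(3) g])
  have \<psi>1: "(\<lambda>x. t (i x)) \<in> factor_thru K A (regular_module A) L L"
    by (rule factor_thru_trans[OF projective_in_add_regular[OF Q] factor_thru.comp[OF S(4) t(1)] S(1)])
  have "x = g1 (f1 x) \<oplus>\<^bsub>L\<^esub> t (i x)" if x: "x \<in> carrier L" for x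
  proof -
    interpret Q: fd_right_module K A Q by (rule S(2))
    have c: "g1 (f1 x) \<in> carrier L" "t (i x) \<in> carrier L"
      using x rmod_homD(1)[OF g1(1)] rmod_homD(1)[OF f1(1)] rmod_homD(1)[OF t(1)] iD by auto
    have GF: "G (F (i x)) \<in> carrier Q" using GD FD iD x by simp
    have "i (g1 (f1 x) \<oplus>\<^bsub>L\<^esub> t (i x)) = G (F (i x)) \<oplus>\<^bsub>Q\<^esub> (i x \<ominus>\<^bsub>Q\<^esub> (G (F (i x)) \<oplus>\<^bsub>Q\<^esub> \<sigma> (q (i x))))"
      using c x by (simp add: rmod_homD(2)[OF S(4)] g1(2) f1(2) t(2) rmod_homD(1)[OF f1(1)] iD)
    also have "\<dots> = G (F (i x)) \<oplus>\<^bsub>Q\<^esub> (i x \<ominus>\<^bsub>Q\<^esub> G (F (i x)))"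
      using GF by (simp add: S(9)[OF x] hom_zero[OF S(3,2) \<sigma>h])
    also have "\<dots> = i x" by (rule fdm_diff_add_cancel[OF S(2) iD[OF x] GF])
    finally have "i x = i (g1 (f1 x) \<oplus>\<^bsub>L\<^esub> t (i x))" ..
    then show ?thesis using S(5) x fdm_closed(2)[OF S(1) c] by (meson inj_onD)
  qed
  then show ?thesis by (intro bexI[OF _ f1(1)] bexI[OF _ g1(1)] bexI[OF _ \<psi>1] ballI)
qed

inductive add_syzygy ::
    "'k ring \<Rightarrow> ('k, 'a) module \<Rightarrow> ('k, 'a, 'u) rmodule \<Rightarrow> ('k, 'a) fd_mod \<Rightarrow> nat \<Rightarrow> ('k, 'a) fd_mod \<Rightarrow> bool"
  for K A U J where
  base: "add_syzygy K A U J 0 J"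
| step: "add_syzygy K A U J m Y \<Longrightarrow> ses K A X (P :: ('k, 'a) fd_mod) Y i p \<Longrightarrow> in_add K A P U \<Longrightarrow>
    add_syzygy K A U J (Suc m) X"

text \<open>When \<open>I\<close> and \<open>I'\<close> are projective, this says that \<open>Ext\<^sup>1(Z'', Y) = 0\<close> implies \<open>Ext\<^sup>1(Z', X) = 0\<close>, a dimension
  shift in both arguments.\<close>
lemma extension_shift:
  assumes s: "ses K A X P Y i p" and P: "injective_module K A P"
    and z: "ses K A Z I Z' a b" and z': "ses K A Z' I' Z'' a' b'" and I': "projective_module K A I'"
    and ext: "\<And>f. f \<in> rmod_hom K A Z' Y \<Longrightarrow> \<exists>h\<in>rmod_hom K A I' Y. \<forall>z\<in>carrier Z'. h (a' z) = f z"
    and f: "f \<in> rmod_hom K A Z X"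
  shows "\<exists>h\<in>rmod_hom K A I X. \<forall>z\<in>carrier Z. h (a z) = f z"
proof -
  note S = sesD[OF s] and Z = sesD[OF z] and Z' = sesD[OF z']
  obtain g where g: "g \<in> rmod_hom K A I P" "\<And>z. z \<in> carrier Z \<Longrightarrow> g (a z) = i (f z)"
    using injective_extend[OF P Z(1,2,4,5) hom_comp[OF f S(4)]] by metis
  obtain c where c: "c \<in> rmod_hom K A Z' Y" "\<And>x. x \<in> carrier I \<Longrightarrow> c (b x) = p (g x)"
    by (rule ses_factor[OF z S(3) hom_comp[OF g(1) S(6)]]) (simp_all add: g(2) S(9) rmod_homD(1)[OF f])
  obtain c' where c': "c' \<in> rmod_hom K A I' Y" "\<And>z. z \<in> carrier Z' \<Longrightarrow> c' (a' z) = c z"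
    using ext[OF c(1)] by blast
  obtain k where k: "k \<in> rmod_hom K A I' P" "\<And>x. x \<in> carrier I' \<Longrightarrow> p (k x) = c' x"
    using projective_lift[OF I' S(2,3,6,7) c'(1)] by metis
  have kh: "(\<lambda>x. k (a' (b x))) \<in> rmod_hom K A I P"
    by (rule hom_comp[OF Z(6) hom_comp[OF Z'(4) k(1)]])
  have bD: "b x \<in> carrier Z'" "a' (b x) \<in> carrier I'" if "x \<in> carrier I" for x
    using that rmod_homD(1)[OF Z(6)] rmod_homD(1)[OF Z'(4)] by auto
  obtain h where h: "h \<in> rmod_hom K A I X" "\<And>x. x \<in> carrier I \<Longrightarrow> i (h x) = g x \<ominus>\<^bsub>P\<^esub> k (a' (b x))"
  proof (rule ses_corestrict[OF s hom_diff[OF Z(2) S(2) g(1) kh]])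
    fix x assume x: "x \<in> carrier I"
    show "p (g x \<ominus>\<^bsub>P\<^esub> k (a' (b x))) = \<zero>\<^bsub>Y\<^esub>"
      using x bD rmod_homD(1)[OF g(1) x] rmod_homD(1)[OF k(1)] rmod_homD(1)[OF S(6)]
      by (simp add: hom_minus[OF S(2,3,6)] k(2) c'(2) c(2) fdm_diff_eq_zero[OF S(3)])
  qed blast
  have "h (a y) = f y" if y: "y \<in> carrier Z" for y
  proof -
    interpret P: fd_right_module K A P by (rule S(2))
    have ay: "a y \<in> carrier I" using rmod_homD(1)[OF Z(4) y] .
    have ify: "i (f y) \<in> carrier P" using rmod_homD(1)[OF S(4) rmod_homD(1)[OF f y]] .
    have "i (h (a y)) = i (f y)"
      using ify by (simp add: h(2)[OF ay] g(2)[OF y] Z(9)[OF y] hom_zero[OF Z'(1,2,4)]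
          hom_zero[OF Z'(2) S(2) k(1)] P.M.minus_eq)
    then show ?thesis using S(5) rmod_homD(1)[OF h(1) ay] rmod_homD(1)[OF f y] by (meson inj_onD)
  qed
  then show ?thesis using h(1) by blast
qed

locale injective_coresolution =
  fixes K :: "'k ring" and A :: "('k, 'a) module"
    and Z :: "nat \<Rightarrow> ('k, 'a, 'z) rmodule" and I :: "nat \<Rightarrow> ('k, 'a, 'i) rmodule"
    and a :: "nat \<Rightarrow> 'z \<Rightarrow> 'i" and b :: "nat \<Rightarrow> 'i \<Rightarrow> 'z"
  assumes ses: "\<And>i. ses K A (Z i) (I i) (Z (Suc i)) (a i) (b i)"
    and inj: "\<And>i. injective_module K A (I i)"
begin

text \<open>Since \<open>Z 0\<close> is a copy of \<open>A\<close>, extension of maps from \<open>Z 0\<close> to \<open>I 0\<close> makes a module a quotient of a module in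
  \<open>add (I 0)\<close>. For the injective module \<open>J\<close> the extension property holds in all degrees, and every further
  syzygy loses one degree.\<close>
lemma syzygy_exists:
  fixes J :: "('k, 'a) fd_mod"
  assumes J: "injective_module K A J" and proj: "\<And>i. i < n \<Longrightarrow> projective_module K A (I i)"
    and r: "r \<in> rmod_hom K A (Z 0) (regular_module A)" "z0 \<in> carrier (Z 0)" "r z0 = \<one>\<^bsub>A\<^esub>"
    and m: "m \<le> n"
  shows "\<exists>X. add_syzygy K A (I 0) J m X \<and> fd_right_module K A X \<and>
    (\<forall>j. j + m < n \<longrightarrow> (\<forall>f\<in>rmod_hom K A (Z j) X. \<exists>h\<in>rmod_hom K A (I j) X. \<forall>z\<in>carrier (Z j). h (a j z) = f z))"
  using m
proof (induction m)
  case 0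
  have "\<exists>h\<in>rmod_hom K A (I j) J. \<forall>z\<in>carrier (Z j). h (a j z) = f z"
    if f: "f \<in> rmod_hom K A (Z j) J" for j f
    using injective_extend[OF J sesD(1,2,4,5)[OF ses[of j]] f] by metis
  then show ?case using add_syzygy.base injective_fdm[OF J] by blast
next
  case (Suc m)
  then obtain Y where Y: "add_syzygy K A (I 0) J m Y" "fd_right_module K A Y"
    and ext: "\<And>j f. j + m < n \<Longrightarrow> f \<in> rmod_hom K A (Z j) Y \<Longrightarrow>
      \<exists>h\<in>rmod_hom K A (I j) Y. \<forall>z\<in>carrier (Z j). h (a j z) = f z" by auto
  interpret Y: fd_right_module K A Y by (rule Y)
  obtain P :: "('k, 'a) fd_mod" and q where P: "in_add K A P (I 0)" "q \<in> rmod_hom K A P Y"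
    "q ` carrier P = carrier Y"
  proof (rule cover_by_add[OF Y(2) sesD(2)[OF ses[of 0]]])
    fix y assume y: "y \<in> carrier Y"
    obtain h where h: "h \<in> rmod_hom K A (I 0) Y" "\<And>z. z \<in> carrier (Z 0) \<Longrightarrow> h (a 0 z) = y \<cdot>\<^bsub>Y\<^esub> r z"
      using ext[of 0, OF _ hom_comp[OF r(1) hom_from_regular[OF Y(2) y]]] Suc.prems by auto
    have "h (a 0 z0) = y" using h(2)[OF r(2)] r(3) Y.ract_one[OF y] by simp
    then show "\<exists>f\<in>rmod_hom K A (I 0) Y. y \<in> f ` carrier (I 0)"
      using h(1) rmod_homD(1)[OF sesD(4)[OF ses[of 0]] r(2)] by (metis imageI)
  qed blast
  note PF = in_addD(1)[OF P(1)] and PI = in_add_injective[OF P(1) inj]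
  note s = ses_kernel[OF PF Y(2) P(2,3)]
  let ?X = "P\<lparr>carrier := {x \<in> carrier P. q x = \<zero>\<^bsub>Y\<^esub>}\<rparr>"
  have "add_syzygy K A (I 0) J (Suc m) ?X" by (rule add_syzygy.step[OF Y(1) s P(1)])
  moreover have "\<exists>h\<in>rmod_hom K A (I j) ?X. \<forall>z\<in>carrier (Z j). h (a j z) = f z"
    if j: "j + Suc m < n" and f: "f \<in> rmod_hom K A (Z j) ?X" for j f
  proof (rule extension_shift[OF s PI ses ses _ _ f])
    show "projective_module K A (I (Suc j))" using proj j by simp
  next
    fix f assume "f \<in> rmod_hom K A (Z (Suc j)) Y"
    then show "\<exists>h\<in>rmod_hom K A (I (Suc j)) Y. \<forall>z\<in>carrier (Z (Suc j)). h (a (Suc j) z) = f z"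
      using ext[of "Suc j" f] j by simp
  qed
  ultimately show ?case using sesD(1)[OF s] by blast
qed

text \<open>A decomposition of the identity into a map through copies of a cosyzygy and a map through copies of
  \<open>I 0\<close> passes from a syzygy of \<open>J\<close> to the preceding one: the difference between the identity of \<open>P\<close> and
  \<open>\<Phi> + i \<sigma>\<close> vanishes on \<open>X\<close>, hence is \<open>t p\<close>, and \<open>p t\<close> is the new map through copies of \<open>I 0\<close>.\<close>
lemma syzygy_descend:
  assumes "add_syzygy K A (I 0) J m X" "m \<le> n"
    and "\<phi> \<in> factor_thru K A (Z (n - m)) X X" "\<psi> \<in> factor_thru K A (I 0) X X"
    and "\<forall>x\<in>carrier X. x = \<phi> x \<oplus>\<^bsub>X\<^esub> \<psi> x"
  shows "\<exists>\<phi>\<in>factor_thru K A (Z n) J J. \<exists>\<psi>\<in>factor_thru K A (I 0) J J. \<forall>x\<in>carrier J. x = \<phi> x \<oplus>\<^bsub>J\<^esub> \<psi> x"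
  using assms
proof (induction arbitrary: \<phi> \<psi> rule: add_syzygy.induct)
  case base
  then show ?case by auto
next
  case (step m Y X P i p)
  note s = step.hyps(2) and P = step.hyps(3) and \<phi> = step.prems(2) and \<psi> = step.prems(3)
  note S = sesD[OF s] and PI = in_add_injective[OF P inj]
  have Sn: "Suc (n - Suc m) = n - m" using step.prems(1) by simp
  obtain \<Phi> \<Phi>' where \<Phi>: "\<Phi> \<in> factor_thru K A (I (n - Suc m)) P P" "\<Phi>' \<in> factor_thru K A (Z (n - m)) Y Y"
    "\<And>y. y \<in> carrier X \<Longrightarrow> \<Phi> (i y) = i (\<phi> y)" "\<And>x. x \<in> carrier P \<Longrightarrow> p (\<Phi> x) = \<Phi>' (p x)"
    using lift_factorization[OF s PI ses[of "n - Suc m", unfolded Sn] inj \<phi>] by metis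
  obtain \<sigma> where \<sigma>: "\<sigma> \<in> factor_thru K A (I 0) P X" "\<And>x. x \<in> carrier X \<Longrightarrow> \<sigma> (i x) = \<psi> x"
    using factor_thru_extend[OF inj S(1,2,4,5) \<psi>] by metis
  note \<Phi>h = factor_thru_hom[OF \<Phi>(1) S(2,2)] and \<Phi>'h = factor_thru_hom[OF \<Phi>(2) S(3,3)]
    and \<sigma>h = factor_thru_hom[OF \<sigma>(1) S(2,1)]
    and \<phi>h = factor_thru_hom[OF \<phi> S(1,1)] and \<psi>h = factor_thru_hom[OF \<psi> S(1,1)]
  have eh: "(\<lambda>x. \<Phi> x \<oplus>\<^bsub>P\<^esub> i (\<sigma> x)) \<in> rmod_hom K A P P"
    by (rule hom_add[OF S(2) \<Phi>h hom_comp[OF \<sigma>h S(4)]])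
  have iD: "i x \<in> carrier P" if "x \<in> carrier X" for x using rmod_homD(1)[OF S(4) that] .
  have ei: "\<Phi> (i x) \<oplus>\<^bsub>P\<^esub> i (\<sigma> (i x)) = i x" if x: "x \<in> carrier X" for x
    unfolding \<Phi>(3)[OF x] \<sigma>(2)[OF x]
    using rmod_homD(2)[OF S(4) rmod_homD(1)[OF \<phi>h x] rmod_homD(1)[OF \<psi>h x]] step.prems(4) x by simp
  obtain t where t: "t \<in> rmod_hom K A Y P" "\<And>x. x \<in> carrier P \<Longrightarrow> t (p x) = x \<ominus>\<^bsub>P\<^esub> (\<Phi> x \<oplus>\<^bsub>P\<^esub> i (\<sigma> x))"
    by (rule ses_factor[OF s S(2) hom_diff[OF S(2,2) hom_id eh]])
      (simp_all add: ei iD fdm_diff_eq_zero[OF S(2)])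
  have \<psi>': "(\<lambda>y. p (t y)) \<in> factor_thru K A (I 0) Y Y"
    by (rule factor_thru_trans[OF P factor_thru.comp[OF t(1) S(6)] S(3)])
  have "y = \<Phi>' y \<oplus>\<^bsub>Y\<^esub> p (t y)" if y: "y \<in> carrier Y" for y
  proof -
    interpret Y: fd_right_module K A Y by (rule S(3))
    have "y \<in> p ` carrier P" using y S(7) by simp
    then obtain x where x: "x \<in> carrier P" "y = p x" by (elim imageE)
    note xD = rmod_homD(1)[OF \<Phi>h x(1)] rmod_homD(1)[OF \<sigma>h x(1)] rmod_homD(1)[OF eh x(1)]
    have "p (t y) = y \<ominus>\<^bsub>Y\<^esub> \<Phi>' y"
      using xD rmod_homD(1)[OF \<Phi>'h y] unfolding x(2) t(2)[OF x(1)]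
      by (simp add: hom_minus[OF S(2,3,6) x(1)] rmod_homD(2)[OF S(6)] iD S(9) \<Phi>(4)[OF x(1)])
    then show ?thesis using fdm_diff_add_cancel[OF S(3) y rmod_homD(1)[OF \<Phi>'h y]] by simp
  qed
  then show ?case using step.IH[OF _ \<Phi>(2) \<psi>'] step.prems(1) by simp
qed

text \<open>The \<open>n\<close>-th syzygy \<open>X\<close> of \<open>D(A)\<close> is projective, so its identity factors through copies of
  \<open>A\<close>, that is, of \<open>Z 0\<close>; descending to \<open>D(A)\<close> turns \<open>Z 0\<close> into \<open>Z n\<close>.\<close>
lemma dual_in_add:
  assumes A: "fd_algebra K A" and n: "n > 0" and proj: "\<And>i. i < n \<Longrightarrow> projective_module K A (I i)"
    and start: "e \<in> rmod_hom K A (regular_module A) (Z 0)" "bij_betw e (carrier A) (carrier (Z 0))"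
    and pd: "projdim K A (dual_module K A) = enat n"
    and T: "in_add K A (Z n) T" "in_add K A (I 0) T"
  shows "in_add K A (dual_module K A) T"
proof -
  interpret A: fd_algebra K A by (rule A)
  let ?R = "regular_module A" and ?D = "dual_module K A"
  note RF = regular_module_fdm[OF A] and DF = dual_module_fdm[OF A]
  obtain L P :: "nat \<Rightarrow> ('k, 'a) fd_mod" and q where L: "in_add K A ?D (L 0)" "in_add K A (L 0) ?D"
    "\<And>i. ses K A (L (Suc i)) (P i) (L i) (\<lambda>x. x) (q i)"
    "\<And>i. projective_module K A (P i)" "projective_module K A (L n)"
    using projdim_syzygies[OF pd] by metis
  define J where "J = L 0"
  have JI: "injective_module K A J"
    unfolding J_def by (rule in_add_injective[OF L(2) dual_module_injective[OF A]])
  obtain r where r: "r \<in> rmod_hom K A (Z 0) ?R" "\<And>x. x \<in> carrier A \<Longrightarrow> r (e x) = x"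
    using hom_inv[of e K A ?R "Z 0"] start RF by (metis regular_module_simps(1))
  have r0: "r (e \<one>\<^bsub>A\<^esub>) = \<one>\<^bsub>A\<^esub>" "e \<one>\<^bsub>A\<^esub> \<in> carrier (Z 0)" using r(2) rmod_homD(1)[OF start(1)] by simp_all
  obtain X where X: "add_syzygy K A (I 0) J n X" "fd_right_module K A X"
    using syzygy_exists[OF JI proj r(1) r0(2,1) order_refl] by blast
  have stable: "\<exists>f\<in>rmod_hom K A X' (L m). \<exists>g\<in>rmod_hom K A (L m) X'. \<exists>\<psi>\<in>factor_thru K A ?R X' X'.
      \<forall>x\<in>carrier X'. x = g (f x) \<oplus>\<^bsub>X'\<^esub> \<psi> x"
    if "add_syzygy K A (I 0) J m X'" "m \<le> n" for m X'
    using that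
  proof (induction rule: add_syzygy.induct)
    case base
    interpret J: fd_right_module K A J by (rule injective_fdm[OF JI])
    have "\<forall>x\<in>carrier J. x = x \<oplus>\<^bsub>J\<^esub> \<zero>\<^bsub>J\<^esub>" by simp
    moreover have "(\<lambda>x. x) \<in> rmod_hom K A J (L 0)" "(\<lambda>x. x) \<in> rmod_hom K A (L 0) J"
      by (simp_all add: J_def hom_id)
    ultimately show ?case
      using factor_thru_zero[OF RF injective_fdm[OF JI], of J] by (intro bexI[of _ "\<lambda>x. x"] bexI[of _ "\<lambda>x. \<zero>\<^bsub>J\<^esub>"])
  next
    case (step m Y X' P' i p)
    have P': "projective_module K A P'" by (rule in_add_projective[OF step.hyps(3) proj]) (rule n)
    obtain f g \<psi> where f: "f \<in> rmod_hom K A Y (L m)" "g \<in> rmod_hom K A (L m) Y"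
      "\<psi> \<in> factor_thru K A ?R Y Y" "\<forall>x\<in>carrier Y. x = g (f x) \<oplus>\<^bsub>Y\<^esub> \<psi> x"
      using step.IH step.prems by auto
    show ?case by (rule stable_retract_syzygy[OF step.hyps(2) P' L(3,4) f(1-3)]) (rule bspec[OF f(4)])
  qed
    obtain f g \<psi> where f: "f \<in> rmod_hom K A X (L n)" "g \<in> rmod_hom K A (L n) X" "\<psi> \<in> factor_thru K A ?R X X"
      "\<And>x. x \<in> carrier X \<Longrightarrow> x = g (f x) \<oplus>\<^bsub>X\<^esub> \<psi> x"
      using stable[OF X(1) order_refl] by auto
    have "(\<lambda>x. g (f x)) \<in> factor_thru K A ?R X X"
      by (rule factor_thru_trans[OF projective_in_add_regular[OF L(5)] factor_thru.comp[OF f(1,2)] X(2)])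
    from factor_thru.cong[OF factor_thru.add[OF this f(3)] f(4)]
    have XR: "in_add K A X ?R" unfolding in_add_def using X(2) RF by blast
    have RZ: "in_add K A ?R (Z 0)" using in_add_bij(1)[OF RF sesD(1)[OF ses[of 0]] start(1)] start(2) by simp
    have XZ: "in_add K A X (Z (n - n))" using in_add_trans[OF XR RZ] by simp
    interpret X: fd_right_module K A X by (rule X)
    have "\<exists>\<phi>\<in>factor_thru K A (Z n) J J. \<exists>\<psi>\<in>factor_thru K A (I 0) J J. \<forall>x\<in>carrier J. x = \<phi> x \<oplus>\<^bsub>J\<^esub> \<psi> x"
      by (rule syzygy_descend[OF X(1) order_refl in_addD(3)[OF XZ] factor_thru_zero[OF sesD(2)[OF ses[of 0]] X(2)]])
        simp
    then obtain \<phi> \<psi> where \<phi>: "\<phi> \<in> factor_thru K A (Z n) J J" "\<psi> \<in> factor_thru K A (I 0) J J"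
      "\<And>x. x \<in> carrier J \<Longrightarrow> x = \<phi> x \<oplus>\<^bsub>J\<^esub> \<psi> x" by blast
    note JF = injective_fdm[OF JI]
    have "(\<lambda>x. x) \<in> factor_thru K A T J J"
      by (rule factor_thru.cong[OF factor_thru.add[OF factor_thru_trans[OF T(1) \<phi>(1) JF]
              factor_thru_trans[OF T(2) \<phi>(2) JF]] \<phi>(3)])
    then have "in_add K A J T" unfolding in_add_def using JF in_addD(2)[OF T(1)] by blast
    then show ?thesis using in_add_trans[OF L(1)] unfolding J_def by blast
qed

end

section \<open>The endomorphism algebra\<close>

definition hom_space ::
    "'k ring \<Rightarrow> ('k, 'a) module \<Rightarrow> ('k, 'a, 'x) rmodule \<Rightarrow> ('k, 'a, 't) rmodule \<Rightarrow> ('k, 'x \<Rightarrow> 't) module"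
  where "hom_space K A X T =
    \<lparr>carrier = rmod_hom K A X T \<inter> extensional (carrier X), mult = undefined, one = undefined,
     zero = (\<lambda>x\<in>carrier X. \<zero>\<^bsub>T\<^esub>),
     add = (\<lambda>f g. \<lambda>x\<in>carrier X. f x \<oplus>\<^bsub>T\<^esub> g x),
     smult = (\<lambda>c f. \<lambda>x\<in>carrier X. c \<odot>\<^bsub>T\<^esub> f x)\<rparr>"

lemma hom_space_simps [simp]:
  "carrier (hom_space K A X T) = rmod_hom K A X T \<inter> extensional (carrier X)"
  "\<zero>\<^bsub>hom_space K A X T\<^esub> = (\<lambda>x\<in>carrier X. \<zero>\<^bsub>T\<^esub>)"
  "f \<oplus>\<^bsub>hom_space K A X T\<^esub> g = (\<lambda>x\<in>carrier X. f x \<oplus>\<^bsub>T\<^esub> g x)"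
  "c \<odot>\<^bsub>hom_space K A X T\<^esub> f = (\<lambda>x\<in>carrier X. c \<odot>\<^bsub>T\<^esub> f x)"
  by (simp_all add: hom_space_def)

lemma restrict_hom:
  assumes X: "fd_right_module K A X" and f: "f \<in> rmod_hom K A X T"
  shows "restrict f (carrier X) \<in> carrier (hom_space K A X T)"
  using hom_cong[OF X f, of "restrict f (carrier X)"] by simp

lemma hom_smult:
  assumes X: "fd_right_module K A X" and T: "fd_right_module K A T" and f: "f \<in> rmod_hom K A X T"
    and c: "c \<in> carrier K"
  shows "(\<lambda>x. c \<odot>\<^bsub>T\<^esub> f x) \<in> rmod_hom K A X T"
proof -
  interpret T: fd_right_module K A T by (rule T)
  show ?thesis
    by (rule rmod_homI) (simp_all add: c rmod_homD(1-4)[OF f] T.smult_r_distr T.smult_ract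
        T.smult_assoc1[symmetric] T.R.m_comm)
qed

lemma hom_space_vectorspace:
  assumes X: "fd_right_module K A X" and T: "fd_right_module K A T"
  shows "vectorspace K (hom_space K A X T)"
proof (rule pointwise_vectorspace)
  interpret T: fd_right_module K A T by (rule T)
  let ?H = "hom_space K A X T"
  note rh = restrict_hom[OF X]
  show "vectorspace K T" by (rule T.vectorspace_axioms)
  show "\<zero>\<^bsub>?H\<^esub> \<in> carrier ?H" unfolding hom_space_simps(2) by (rule rh[OF hom_zero_map[OF T]])
  fix f assume f: "f \<in> carrier ?H"
  show "f \<in> extensional (carrier X)" using f by simp
  show "f x \<in> carrier T" if "x \<in> carrier X" for x using f rmod_homD(1)[OF _ that] by auto
  show "f \<oplus>\<^bsub>?H\<^esub> g \<in> carrier ?H" if "g \<in> carrier ?H" for g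
    unfolding hom_space_simps(3) by (rule rh[OF hom_add[OF T]]) (use f that in simp_all)
  show "c \<odot>\<^bsub>?H\<^esub> f \<in> carrier ?H" if "c \<in> carrier K" for c
    unfolding hom_space_simps(4) by (rule rh[OF hom_smult[OF X T]]) (use f that in simp_all)
qed simp_all

lemma hom_space_fin_dim:
  assumes X: "fd_right_module K A X" and T: "fd_right_module K A T"
  shows "vectorspace.fin_dim K (hom_space K A X T)"
proof -
  interpret X: fd_right_module K A X by (rule X)
  interpret T: fd_right_module K A T by (rule T)
  obtain S where S: "finite S" "S \<subseteq> carrier X" "X.gen_set S"
    using X.fin_dim_module unfolding X.fin_dim_def by blast
  show ?thesis
  proof (rule fin_dim_jointly_injective[OF hom_space_vectorspace[OF X T] T.vectorspace_axioms T.fin_dim_module])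
    show "finite ((\<lambda>x f. f x) ` S)" using S by simp
    show "(\<lambda>x f. f x) ` S \<subseteq> LinearCombinations.module_hom K (hom_space K A X T) T"
      using S(2) by (auto simp: LinearCombinations.module_hom_def rmod_homD(1) subset_iff)
    fix f assume f: "f \<in> carrier (hom_space K A X T)"
      and z: "\<And>g. g \<in> (\<lambda>x f. f x) ` S \<Longrightarrow> g f = \<zero>\<^bsub>T\<^esub>"
    then have fh: "f \<in> rmod_hom K A X T" "f \<in> extensional (carrier X)" by auto
    let ?N = "{x \<in> carrier X. f x = \<zero>\<^bsub>T\<^esub>}"
    have "S \<subseteq> ?N" using z S(2) by auto
    then have "X.span S \<subseteq> ?N"
      by (rule X.span_is_subset) (rule rsubmoduleD(6)[OF ker_rsubmodule[OF X T fh(1)]])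
    then have "f x = \<zero>\<^bsub>T\<^esub>" if "x \<in> carrier X" for x using S(3) that by auto
    then show "f = \<zero>\<^bsub>hom_space K A X T\<^esub>"
      unfolding hom_space_simps using fh(2) by (intro extensionalityI[of _ "carrier X"]) simp_all
  qed
qed

lemma End_algebra_simps [simp]:
  "carrier (End_algebra K A T) = rmod_hom K A T T \<inter> extensional (carrier T)"
  "f \<otimes>\<^bsub>End_algebra K A T\<^esub> g = compose (carrier T) f g"
  "\<one>\<^bsub>End_algebra K A T\<^esub> = (\<lambda>x\<in>carrier T. x)"
  "\<zero>\<^bsub>End_algebra K A T\<^esub> = (\<lambda>x\<in>carrier T. \<zero>\<^bsub>T\<^esub>)"
  "f \<oplus>\<^bsub>End_algebra K A T\<^esub> g = (\<lambda>x\<in>carrier T. f x \<oplus>\<^bsub>T\<^esub> g x)"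
  "c \<odot>\<^bsub>End_algebra K A T\<^esub> f = (\<lambda>x\<in>carrier T. c \<odot>\<^bsub>T\<^esub> f x)"
  by (simp_all add: End_algebra_def)

lemma End_algebra_fd_algebra:
  assumes T: "fd_right_module K A T"
  shows "fd_algebra K (End_algebra K A T)"
proof -
  interpret T: fd_right_module K A T by (rule T)
  let ?B = "End_algebra K A T"
  have ext: "restrict f (carrier T) = restrict g (carrier T)" if "\<And>x. x \<in> carrier T \<Longrightarrow> f x = g x"
    for f g :: "'c \<Rightarrow> 'c" using that by (rule restrict_ext)
  note vc = vectorspace_cong[OF hom_space_vectorspace[OF T T], of ?B]
  have vs: "vectorspace K ?B" and fd: "vectorspace.fin_dim K ?B"
    using vc hom_space_fin_dim[OF T T] by (simp_all add: fun_eq_iff)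
  interpret B: vectorspace K ?B by (rule vs)
  have D: "f x \<in> carrier T" if "f \<in> carrier ?B" "x \<in> carrier T" for f x
    using that rmod_homD(1) by fastforce
  have h: "f \<in> rmod_hom K A T T" if "f \<in> carrier ?B" for f using that by simp
  have ring: "ring ?B"
  proof (rule ringI)
    show "abelian_group ?B" by (rule B.M.abelian_group_axioms)
    show "monoid ?B"
    proof (rule monoidI)
      show "\<one>\<^bsub>?B\<^esub> \<in> carrier ?B" using restrict_hom[OF T hom_id] by simp
      fix f g assume f: "f \<in> carrier ?B" and g: "g \<in> carrier ?B"
      show "f \<otimes>\<^bsub>?B\<^esub> g \<in> carrier ?B"
        using restrict_hom[OF T hom_comp[OF h[OF g] h[OF f]]] by (simp add: compose_def)
      have fe: "f \<in> extensional (carrier T)" using f by simp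
      show "\<one>\<^bsub>?B\<^esub> \<otimes>\<^bsub>?B\<^esub> f = f"
        unfolding End_algebra_simps(2,3) compose_def
        by (rule extensionalityI[OF restrict_extensional fe]) (simp add: D[OF f])
      show "f \<otimes>\<^bsub>?B\<^esub> \<one>\<^bsub>?B\<^esub> = f"
        unfolding End_algebra_simps(2,3) compose_def
        by (rule extensionalityI[OF restrict_extensional fe]) simp
      fix k assume k: "k \<in> carrier ?B"
      show "f \<otimes>\<^bsub>?B\<^esub> g \<otimes>\<^bsub>?B\<^esub> k = f \<otimes>\<^bsub>?B\<^esub> (g \<otimes>\<^bsub>?B\<^esub> k)"
        unfolding End_algebra_simps(2) compose_def by (intro ext) (simp add: D[OF k])
    qed
    fix f g k assume f: "f \<in> carrier ?B" "g \<in> carrier ?B" and k: "k \<in> carrier ?B"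
    show "(f \<oplus>\<^bsub>?B\<^esub> g) \<otimes>\<^bsub>?B\<^esub> k = f \<otimes>\<^bsub>?B\<^esub> k \<oplus>\<^bsub>?B\<^esub> g \<otimes>\<^bsub>?B\<^esub> k"
      unfolding End_algebra_simps(2,5) compose_def by (intro ext) (simp add: D[OF k])
    show "k \<otimes>\<^bsub>?B\<^esub> (f \<oplus>\<^bsub>?B\<^esub> g) = k \<otimes>\<^bsub>?B\<^esub> f \<oplus>\<^bsub>?B\<^esub> k \<otimes>\<^bsub>?B\<^esub> g"
      unfolding End_algebra_simps(2,5) compose_def
      by (intro ext) (simp add: rmod_homD(2)[OF h[OF k]] D[OF f(1)] D[OF f(2)])
  qed
  show ?thesis
  proof (intro fd_algebra.intro fd_algebra_axioms.intro vs ring fd)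
    fix c f g assume c: "c \<in> carrier K" and f: "f \<in> carrier ?B" and g: "g \<in> carrier ?B"
    show "(c \<odot>\<^bsub>?B\<^esub> f) \<otimes>\<^bsub>?B\<^esub> g = c \<odot>\<^bsub>?B\<^esub> (f \<otimes>\<^bsub>?B\<^esub> g)"
      unfolding End_algebra_simps(2,6) compose_def by (intro ext) (simp add: D[OF g])
    show "f \<otimes>\<^bsub>?B\<^esub> (c \<odot>\<^bsub>?B\<^esub> g) = c \<odot>\<^bsub>?B\<^esub> (f \<otimes>\<^bsub>?B\<^esub> g)"
      unfolding End_algebra_simps(2,6) compose_def
      by (intro ext) (simp add: D[OF g] rmod_homD(3)[OF h[OF f] c])
  qed
qed

section \<open>The functor to modules over the endomorphism algebra\<close>

locale endomorphism_functor =
  fixes K :: "'k ring" and A :: "('k, 'a) module" and T :: "('k, 'a, 't) rmodule"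
  assumes T: "fd_right_module K A T"
begin

abbreviation "B \<equiv> End_algebra K A T"

abbreviation "homs X \<equiv> carrier (hom_space K A X T)"

text \<open>The functor \<open>D(Hom\<^sub>A(-, T))\<close> to right \<open>B\<close>-modules. For \<open>T = D(A)\<close> it is the double dual, that is, the identity
  functor; in general it plays the part of the Morita equivalence.\<close>
definition G :: "('k, 'a, 'x) rmodule \<Rightarrow> ('k, 't \<Rightarrow> 't, ('x \<Rightarrow> 't) \<Rightarrow> 'k) rmodule"
  where "G X = dual_rmodule K (hom_space K A X T) (compose (carrier X))"

definition G_map :: "('k, 'a, 'x) rmodule \<Rightarrow> ('k, 'a, 'y) rmodule \<Rightarrow> ('x \<Rightarrow> 'y) \<Rightarrow>
    (('x \<Rightarrow> 't) \<Rightarrow> 'k) \<Rightarrow> ('y \<Rightarrow> 't) \<Rightarrow> 'k"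
  where "G_map X Y f \<xi> = (\<lambda>h\<in>homs Y. \<xi> (compose (carrier X) h f))"

lemma B: "fd_algebra K B" by (rule End_algebra_fd_algebra[OF T])

lemma homsD:
  assumes "h \<in> homs X"
  shows "h \<in> rmod_hom K A X T" "h \<in> extensional (carrier X)" "\<And>x. x \<in> carrier X \<Longrightarrow> h x \<in> carrier T"
  using assms rmod_homD(1) by fastforce+

lemma homs_eqI:
  assumes "h \<in> homs X" "k \<in> homs X" "\<And>x. x \<in> carrier X \<Longrightarrow> h x = k x"
  shows "h = k"
  using homsD(2)[OF assms(1)] homsD(2)[OF assms(2)] assms(3) by (rule extensionalityI)

lemma compose_homs:
  assumes X: "fd_right_module K A X" and f: "f \<in> rmod_hom K A X Y" and h: "h \<in> rmod_hom K A Y T"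
  shows "compose (carrier X) h f \<in> homs X"
  using restrict_hom[OF X hom_comp[OF f h]] by (simp only: compose_def)

lemma G_simps:
  "carrier (G X) = functionals K (hom_space K A X T)"
  "\<zero>\<^bsub>G X\<^esub> = (\<lambda>h\<in>homs X. \<zero>\<^bsub>K\<^esub>)"
  "\<xi> \<oplus>\<^bsub>G X\<^esub> \<eta> = (\<lambda>h\<in>homs X. \<xi> h \<oplus>\<^bsub>K\<^esub> \<eta> h)"
  "c \<odot>\<^bsub>G X\<^esub> \<xi> = (\<lambda>h\<in>homs X. c \<otimes>\<^bsub>K\<^esub> \<xi> h)"
  "\<xi> \<cdot>\<^bsub>G X\<^esub> b = (\<lambda>h\<in>homs X. \<xi> (compose (carrier X) b h))"
  by (simp_all add: G_def del: hom_space_simps)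

lemma G_fdm:
  assumes X: "fd_right_module K A X"
  shows "fd_right_module K B (G X)"
proof -
  have ext: "restrict f (carrier X) = restrict g (carrier X)" if "\<And>x. x \<in> carrier X \<Longrightarrow> f x = g x"
    for f g :: "'b \<Rightarrow> 't" using that by (rule restrict_ext)
  interpret T: fd_right_module K A T by (rule T)
  show ?thesis unfolding G_def
  proof (rule dual_rmodule_fdm[OF B hom_space_vectorspace[OF X T] hom_space_fin_dim[OF X T]])
    fix b h assume b: "b \<in> carrier B" and h: "h \<in> homs X"
    then have bh: "b \<in> rmod_hom K A T T" by simp
    note hD = homsD(3)[OF h]
    show "compose (carrier X) b h \<in> homs X" by (rule compose_homs[OF X homsD(1)[OF h] bh])
    show "compose (carrier X) b (h \<oplus>\<^bsub>hom_space K A X T\<^esub> h') =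
      compose (carrier X) b h \<oplus>\<^bsub>hom_space K A X T\<^esub> compose (carrier X) b h'" if "h' \<in> homs X" for h'
      unfolding compose_def hom_space_simps using hD homsD(3)[OF that]
      by (intro ext) (simp add: rmod_homD(2)[OF bh])
    show "compose (carrier X) b (c \<odot>\<^bsub>hom_space K A X T\<^esub> h) = c \<odot>\<^bsub>hom_space K A X T\<^esub> compose (carrier X) b h"
      "compose (carrier X) (c \<odot>\<^bsub>B\<^esub> b) h = c \<odot>\<^bsub>hom_space K A X T\<^esub> compose (carrier X) b h"
      if "c \<in> carrier K" for c
      unfolding compose_def hom_space_simps End_algebra_simps using hD that
      by (intro ext; simp add: rmod_homD(3)[OF bh])+
    show "compose (carrier X) (b \<oplus>\<^bsub>B\<^esub> b') h = compose (carrier X) b h \<oplus>\<^bsub>hom_space K A X T\<^esub> compose (carrier X) b' h"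
      "compose (carrier X) (b \<otimes>\<^bsub>B\<^esub> b') h = compose (carrier X) b (compose (carrier X) b' h)"
      if "b' \<in> carrier B" for b'
      unfolding compose_def hom_space_simps End_algebra_simps using hD
      by (intro ext; simp)+
  next
    fix h assume h: "h \<in> homs X"
    show "compose (carrier X) \<one>\<^bsub>B\<^esub> h = h"
      unfolding compose_def End_algebra_simps using homsD(2,3)[OF h]
      by (intro extensionalityI[of _ "carrier X"]) simp_all
  qed
qed

lemma G_map_hom:
  assumes X: "fd_right_module K A X" and Y: "fd_right_module K A Y" and f: "f \<in> rmod_hom K A X Y"
  shows "G_map X Y f \<in> rmod_hom K B (G X) (G Y)"
proof -
  note fD = rmod_homD(1)[OF f]
  interpret HY: vectorspace K "hom_space K A Y T" by (rule hom_space_vectorspace[OF Y T])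
  have c: "compose (carrier X) h f \<in> homs X" if "h \<in> homs Y" for h
    by (rule compose_homs[OF X f homsD(1)[OF that]])
  have ca: "compose (carrier X) (h \<oplus>\<^bsub>hom_space K A Y T\<^esub> h') f =
    compose (carrier X) h f \<oplus>\<^bsub>hom_space K A X T\<^esub> compose (carrier X) h' f" for h h'
    unfolding compose_def hom_space_simps by (rule restrict_ext) (simp add: fD)
  have cs: "compose (carrier X) (k \<odot>\<^bsub>hom_space K A Y T\<^esub> h) f =
    k \<odot>\<^bsub>hom_space K A X T\<^esub> compose (carrier X) h f" for k h
    unfolding compose_def hom_space_simps by (rule restrict_ext) (simp add: fD)
  have cb: "compose (carrier X) (compose (carrier Y) b h) f = compose (carrier X) b (compose (carrier X) h f)" for b h
    unfolding compose_def by (rule restrict_ext) (simp add: fD)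
  have bc: "compose (carrier Y) b h \<in> homs Y" if "b \<in> carrier B" "h \<in> homs Y" for b h
    using that by (intro compose_homs[OF Y homsD(1)]) simp_all
  show ?thesis
  proof (rule rmod_homI, unfold G_simps)
    fix \<xi> assume x: "\<xi> \<in> functionals K (hom_space K A X T)"
    show "G_map X Y f \<xi> \<in> functionals K (hom_space K A Y T)"
      unfolding G_map_def
      by (rule functionalsI) (simp_all add: c ca cs functionalsD(1,3,4)[OF x] HY.M.a_closed HY.smult_closed del: hom_space_simps)
  next
    fix \<xi> \<eta> assume "\<xi> \<in> functionals K (hom_space K A X T)" "\<eta> \<in> functionals K (hom_space K A X T)"
    show "G_map X Y f (\<lambda>h\<in>homs X. \<xi> h \<oplus>\<^bsub>K\<^esub> \<eta> h) = (\<lambda>h\<in>homs Y. G_map X Y f \<xi> h \<oplus>\<^bsub>K\<^esub> G_map X Y f \<eta> h)"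
      unfolding G_map_def by (rule restrict_ext) (simp add: c del: hom_space_simps)
  next
    fix k \<xi> assume "k \<in> carrier K" "\<xi> \<in> functionals K (hom_space K A X T)"
    show "G_map X Y f (\<lambda>h\<in>homs X. k \<otimes>\<^bsub>K\<^esub> \<xi> h) = (\<lambda>h\<in>homs Y. k \<otimes>\<^bsub>K\<^esub> G_map X Y f \<xi> h)"
      unfolding G_map_def by (rule restrict_ext) (simp add: c del: hom_space_simps)
  next
    fix \<xi> b assume "\<xi> \<in> functionals K (hom_space K A X T)" "b \<in> carrier B"
    then show "G_map X Y f (\<lambda>h\<in>homs X. \<xi> (compose (carrier X) b h)) =
      (\<lambda>h\<in>homs Y. G_map X Y f \<xi> (compose (carrier Y) b h))"
      unfolding G_map_def by (intro restrict_ext) (simp add: c cb bc del: hom_space_simps End_algebra_simps)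
  qed
qed

lemma G_map_comp:
  assumes X: "fd_right_module K A X" and Y: "fd_right_module K A Y" and f: "f \<in> rmod_hom K A X Y" and g: "g \<in> rmod_hom K A Y Z"
  shows "G_map X Z (\<lambda>x. g (f x)) \<xi> = G_map Y Z g (G_map X Y f \<xi>)"
proof -
  have e: "compose (carrier X) h (\<lambda>x. g (f x)) = compose (carrier X) (compose (carrier Y) h g) f" for h
    unfolding compose_def by (rule restrict_ext) (simp add: rmod_homD(1)[OF f])
  show ?thesis
    unfolding G_map_def
    by (rule restrict_ext) (simp add: compose_homs[OF Y g homsD(1)] e del: hom_space_simps)
qed

lemma G_map_factor_thru:
  assumes S: "fd_right_module K A S" and X: "fd_right_module K A X" and Y: "fd_right_module K A Y"
    and \<phi>: "\<phi> \<in> factor_thru K A S X Y"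
  shows "G_map X Y \<phi> \<in> factor_thru K B (G S) (G X) (G Y)"
  using \<phi>
proof induction
  case (comp f g)
  show ?case
    by (rule factor_thru.cong[OF factor_thru.comp[OF G_map_hom[OF X S comp(1)] G_map_hom[OF S Y comp(2)]]])
      (rule G_map_comp[OF X S comp])
next
  case (add \<phi> \<psi>)
  note h = factor_thru_hom[OF add.hyps(1) X Y] factor_thru_hom[OF add.hyps(2) X Y]
  show ?case
  proof (rule factor_thru.cong[OF factor_thru.add[OF add.IH]])
    fix \<xi> assume "\<xi> \<in> carrier (G X)"
    then have x: "\<xi> \<in> functionals K (hom_space K A X T)" by (simp add: G_simps)
    have "compose (carrier X) k (\<lambda>x. \<phi> x \<oplus>\<^bsub>Y\<^esub> \<psi> x) =
      compose (carrier X) k \<phi> \<oplus>\<^bsub>hom_space K A X T\<^esub> compose (carrier X) k \<psi>" if k: "k \<in> homs Y" for k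
      unfolding compose_def hom_space_simps
      by (rule restrict_ext) (simp add: rmod_homD(2)[OF homsD(1)[OF k]] rmod_homD(1)[OF h(1)] rmod_homD(1)[OF h(2)])
    then show "G_map X Y (\<lambda>x. \<phi> x \<oplus>\<^bsub>Y\<^esub> \<psi> x) \<xi> = G_map X Y \<phi> \<xi> \<oplus>\<^bsub>G Y\<^esub> G_map X Y \<psi> \<xi>"
      unfolding G_simps G_map_def
      by (intro restrict_ext) (simp add: functionalsD(3)[OF x] compose_homs[OF X h(1) homsD(1)]
          compose_homs[OF X h(2) homsD(1)] del: hom_space_simps)
  qed
next
  case (cong \<phi> \<psi>)
  have "compose (carrier X) k \<psi> = compose (carrier X) k \<phi>" for k :: "'d \<Rightarrow> 't"
    unfolding compose_def by (rule restrict_ext) (simp add: cong.hyps(2))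
  then have "G_map X Y \<psi> = G_map X Y \<phi>" unfolding G_map_def by (intro ext) simp
  then show ?case using cong.IH by simp
qed

lemma G_map_id:
  assumes x: "\<xi> \<in> carrier (G X)"
  shows "G_map X X (\<lambda>x. x) \<xi> = \<xi>"
proof -
  have x: "\<xi> \<in> functionals K (hom_space K A X T)" using x by (simp add: G_simps)
  have "compose (carrier X) h (\<lambda>x. x) = h" if "h \<in> homs X" for h
    using extensional_restrict[OF homsD(2)[OF that]] by (simp only: compose_def)
  then show ?thesis unfolding G_map_def
    using functionalsD(5)[OF x] by (intro extensionalityI[of _ "homs X"]) (simp_all del: hom_space_simps)
qed

lemma G_in_add:
  assumes "in_add K A X S"
  shows "in_add K B (G X) (G S)"
proof -
  note X = in_addD[OF assms]
  show ?thesis unfolding in_add_def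
    using G_fdm[OF X(1)] G_fdm[OF X(2)] factor_thru.cong[OF G_map_factor_thru[OF X(2,1,1,3)], of "\<lambda>x. x"] G_map_id
    by metis
qed

lemma G_T: "G T = dual_module K B"
  unfolding G_def dual_module_eq
  by (simp add: dual_rmodule_def functionals_def fun_eq_iff)

lemma G_zero:
  assumes X: "fd_right_module K A X" "carrier X = {\<zero>\<^bsub>X\<^esub>}"
  shows "carrier (G X) = {\<zero>\<^bsub>G X\<^esub>}"
proof -
  interpret H: vectorspace K "hom_space K A X T" by (rule hom_space_vectorspace[OF X(1) T])
  have "\<xi> = \<zero>\<^bsub>G X\<^esub>" if "\<xi> \<in> carrier (G X)" for \<xi>
  proof -
    have x: "\<xi> \<in> functionals K (hom_space K A X T)" using that by (simp add: G_simps)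
    have "\<xi> h = \<zero>\<^bsub>K\<^esub>" if h: "h \<in> homs X" for h
    proof -
      have "h = \<zero>\<^bsub>hom_space K A X T\<^esub>"
        by (rule homs_eqI[OF h H.M.zero_closed]) (use X hom_zero[OF X(1) T homsD(1)[OF h]] in auto)
      then show ?thesis using H.functional_zero[OF x] by simp
    qed
    then show ?thesis unfolding G_simps using functionalsD(5)[OF x]
      by (intro extensionalityI[of _ "homs X"]) (simp_all del: hom_space_simps)
  qed
  then show ?thesis using fdm_closed(1)[OF G_fdm[OF X(1)]] by blast
qed

text \<open>Exactness in the middle holds because a functional that vanishes on the maps through \<open>W\<close> depends only on
  the restrictions to \<open>X\<close>, and every map from \<open>X\<close> to \<open>T\<close> is a restriction. Surjectivity on the right is the
  extension of functionals along \<open>Hom\<^sub>A(W, T) \<rightarrow> Hom\<^sub>A(P, T)\<close>.\<close>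
lemma G_ses:
  assumes s: "ses K A X P W i p" and TI: "injective_module K A T"
  shows "ses K B (G X) (G P) (G W) (G_map X P i) (G_map P W p)"
proof -
  note S = sesD[OF s]
  let ?HX = "hom_space K A X T" and ?HP = "hom_space K A P T" and ?HW = "hom_space K A W T"
  interpret HX: vectorspace K ?HX by (rule hom_space_vectorspace[OF S(1) T])
  interpret HP: vectorspace K ?HP by (rule hom_space_vectorspace[OF S(2) T])
  interpret HW: vectorspace K ?HW by (rule hom_space_vectorspace[OF S(3) T])
  interpret T: fd_right_module K A T by (rule T)
  note HPfd = hom_space_fin_dim[OF S(2) T]
  note GF = G_fdm[OF S(1)] G_fdm[OF S(2)] G_fdm[OF S(3)]
  note Gi = G_map_hom[OF S(1,2,4)] and Gp = G_map_hom[OF S(2,3,6)]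
  have iD: "i x \<in> carrier P" if "x \<in> carrier X" for x using rmod_homD(1)[OF S(4) that] .
  have pD: "p x \<in> carrier W" if "x \<in> carrier P" for x using rmod_homD(1)[OF S(6) that] .
  have ext: "\<exists>h\<in>homs P. compose (carrier X) h i = k" if k: "k \<in> homs X" for k
  proof -
    obtain h where h: "h \<in> rmod_hom K A P T" "\<And>x. x \<in> carrier X \<Longrightarrow> h (i x) = k x"
      using injective_extend[OF TI S(1,2,4,5) homsD(1)[OF k]] by metis
    have "compose (carrier X) (restrict h (carrier P)) i = k"
      unfolding compose_def
      by (rule extensionalityI[OF restrict_extensional homsD(2)[OF k]]) (simp add: iD h(2))
    then show ?thesis using restrict_hom[OF S(2) h(1)] by blast
  qed
  have ci: "compose (carrier X) h i \<in> homs X" if "h \<in> homs P" for h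
    by (rule compose_homs[OF S(1,4) homsD(1)[OF that]])
  have cp: "compose (carrier P) h p \<in> homs P" if "h \<in> homs W" for h
    by (rule compose_homs[OF S(2,6) homsD(1)[OF that]])
  have inj: "inj_on (G_map X P i) (carrier (G X))"
  proof (rule hom_injI[OF GF(1,2) Gi])
    fix \<xi> assume x: "\<xi> \<in> carrier (G X)" and z: "G_map X P i \<xi> = \<zero>\<^bsub>G P\<^esub>"
    have x: "\<xi> \<in> functionals K ?HX" using x by (simp add: G_simps)
    have "\<xi> k = \<zero>\<^bsub>K\<^esub>" if "k \<in> homs X" for k
    proof -
      obtain h where h: "h \<in> homs P" "compose (carrier X) h i = k" using ext[OF \<open>k \<in> homs X\<close>] by blast
      have "G_map X P i \<xi> h = \<zero>\<^bsub>G P\<^esub> h" using z by simp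
      then show ?thesis using h by (simp add: G_map_def G_simps(2) del: hom_space_simps)
    qed
    then show "\<xi> = \<zero>\<^bsub>G X\<^esub>" unfolding G_simps using functionalsD(5)[OF x]
      by (intro extensionalityI[of _ "homs X"]) (simp_all del: hom_space_simps)
  qed
  have surj: "\<eta> \<in> G_map P W p ` carrier (G P)" if "\<eta> \<in> carrier (G W)" for \<eta>
  proof -
    have e: "\<eta> \<in> functionals K ?HW" using that by (simp add: G_simps)
    have lin: "(\<lambda>h. compose (carrier P) h p) \<in> LinearCombinations.module_hom K ?HW ?HP"
    proof -
      have "compose (carrier P) (h \<oplus>\<^bsub>?HW\<^esub> h') p = compose (carrier P) h p \<oplus>\<^bsub>?HP\<^esub> compose (carrier P) h' p" for h h'
        unfolding compose_def hom_space_simps by (rule restrict_ext) (simp add: pD)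
      moreover have "compose (carrier P) (c \<odot>\<^bsub>?HW\<^esub> h) p = c \<odot>\<^bsub>?HP\<^esub> compose (carrier P) h p" for c h
        unfolding compose_def hom_space_simps by (rule restrict_ext) (simp add: pD)
      ultimately show ?thesis
        unfolding LinearCombinations.module_hom_def using cp by (simp del: hom_space_simps add: Pi_iff)
    qed
    have linj: "inj_on (\<lambda>h. compose (carrier P) h p) (homs W)"
    proof
      fix h h' assume hh: "h \<in> homs W" "h' \<in> homs W" "compose (carrier P) h p = compose (carrier P) h' p"
      show "h = h'"
      proof (rule homs_eqI[OF hh(1,2)])
        fix w assume "w \<in> carrier W"
        then have "w \<in> p ` carrier P" using S(7) by simp
        then obtain x where x: "x \<in> carrier P" "w = p x" by (elim imageE)
        then show "h w = h' w" using fun_cong[OF hh(3), of x] by (simp add: compose_def)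
      qed
    qed
    obtain \<xi> where \<xi>: "\<xi> \<in> functionals K ?HP" "\<And>h. h \<in> homs W \<Longrightarrow> \<xi> (compose (carrier P) h p) = \<eta> h"
      by (rule HP.functional_extension_inj[OF HPfd HW.vectorspace_axioms lin linj e]) (rule that, assumption, simp)
    have "\<eta> = G_map P W p \<xi>"
      unfolding G_map_def using functionalsD(5)[OF e] \<xi>(2)
      by (intro extensionalityI[of _ "homs W"]) (simp_all del: hom_space_simps)
    then show ?thesis using \<xi>(1) by (simp add: G_simps(1))
  qed
  \<comment> \<open>Two maps that agree on \<open>X\<close> differ by a map through \<open>W\<close>.\<close>
  have agree: "\<xi> h = \<xi> h'"
    if x: "\<xi> \<in> functionals K ?HP" and z: "\<And>h. h \<in> homs W \<Longrightarrow> \<xi> (compose (carrier P) h p) = \<zero>\<^bsub>K\<^esub>"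
      and h: "h \<in> homs P" "h' \<in> homs P" and e: "compose (carrier X) h i = compose (carrier X) h' i"
    for \<xi> h h'
  proof -
    have e': "h (i y) = h' (i y)" if "y \<in> carrier X" for y
      using fun_cong[OF e, of y] that by (simp add: compose_def)
    obtain t where t: "t \<in> rmod_hom K A W T" "\<And>x. x \<in> carrier P \<Longrightarrow> t (p x) = h x \<ominus>\<^bsub>T\<^esub> h' x"
      by (rule ses_factor[OF s T hom_diff[OF S(2) T homsD(1)[OF h(1)] homsD(1)[OF h(2)]]])
        (simp_all add: e' fdm_diff_eq_zero[OF T] homsD(3)[OF h(2)] iD)
    let ?t = "restrict t (carrier W)"
    have tW: "?t \<in> homs W" by (rule restrict_hom[OF S(3) t(1)])
    have "h = h' \<oplus>\<^bsub>?HP\<^esub> compose (carrier P) ?t p"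
    proof (rule homs_eqI[OF h(1) HP.M.a_closed[OF h(2) cp[OF tW]]])
      fix x assume x: "x \<in> carrier P"
      show "h x = (h' \<oplus>\<^bsub>?HP\<^esub> compose (carrier P) ?t p) x"
        using x pD[OF x] fdm_diff_add_cancel[OF T homsD(3)[OF h(1) x] homsD(3)[OF h(2) x]]
        by (simp add: compose_def t(2))
    qed
    then have "\<xi> h = \<xi> h' \<oplus>\<^bsub>K\<^esub> \<xi> (compose (carrier P) ?t p)"
      using functionalsD(3)[OF x h(2) cp[OF tW]] by simp
    then show ?thesis using z[OF tW] functionalsD(1)[OF x h(2)] by simp
  qed
  have exact: "G_map P W p \<xi> = \<zero>\<^bsub>G W\<^esub> \<longleftrightarrow> \<xi> \<in> G_map X P i ` carrier (G X)" if "\<xi> \<in> carrier (G P)" for \<xi>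
  proof
    have x: "\<xi> \<in> functionals K ?HP" using that by (simp add: G_simps)
    assume "G_map P W p \<xi> = \<zero>\<^bsub>G W\<^esub>"
    then have "G_map P W p \<xi> h = \<zero>\<^bsub>G W\<^esub> h" for h by simp
    then have z: "\<xi> (compose (carrier P) h p) = \<zero>\<^bsub>K\<^esub>" if "h \<in> homs W" for h
      using that by (simp add: G_map_def G_simps(2) del: hom_space_simps split: if_splits) metis
    obtain E where E: "\<And>k. k \<in> homs X \<Longrightarrow> E k \<in> homs P" "\<And>k. k \<in> homs X \<Longrightarrow> compose (carrier X) (E k) i = k"
      using ext by metis
    have ag: "\<xi> h = \<xi> h'"
      if "h \<in> homs P" "h' \<in> homs P" "compose (carrier X) h i = compose (carrier X) h' i" for h h'
      by (rule agree[OF x _ that]) (rule z)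
    have "(\<lambda>k\<in>homs X. \<xi> (E k)) \<in> functionals K ?HX"
    proof (rule functionalsI)
      fix k k' assume k: "k \<in> homs X" "k' \<in> homs X"
      have "compose (carrier X) (E k \<oplus>\<^bsub>?HP\<^esub> E k') i =
          compose (carrier X) (E k) i \<oplus>\<^bsub>?HX\<^esub> compose (carrier X) (E k') i"
        unfolding compose_def hom_space_simps by (rule restrict_ext) (simp add: iD)
      then have "\<xi> (E (k \<oplus>\<^bsub>?HX\<^esub> k')) = \<xi> (E k \<oplus>\<^bsub>?HP\<^esub> E k')"
        using k by (intro ag) (simp_all add: E HP.M.a_closed HX.M.a_closed del: hom_space_simps)
      then show "(\<lambda>k\<in>homs X. \<xi> (E k)) (k \<oplus>\<^bsub>?HX\<^esub> k') = (\<lambda>k\<in>homs X. \<xi> (E k)) k \<oplus>\<^bsub>K\<^esub> (\<lambda>k\<in>homs X. \<xi> (E k)) k'"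
        using functionalsD(3)[OF x E(1)[OF k(1)] E(1)[OF k(2)]] HX.M.a_closed[OF k] k
        by (simp del: hom_space_simps)
    next
      fix c k assume c: "c \<in> carrier K" and k: "k \<in> homs X"
      have "compose (carrier X) (c \<odot>\<^bsub>?HP\<^esub> E k) i = c \<odot>\<^bsub>?HX\<^esub> compose (carrier X) (E k) i"
        unfolding compose_def hom_space_simps by (rule restrict_ext) (simp add: iD)
      then have "\<xi> (E (c \<odot>\<^bsub>?HX\<^esub> k)) = \<xi> (c \<odot>\<^bsub>?HP\<^esub> E k)"
        using k c by (intro ag) (simp_all add: E HP.smult_closed HX.smult_closed del: hom_space_simps)
      then show "(\<lambda>k\<in>homs X. \<xi> (E k)) (c \<odot>\<^bsub>?HX\<^esub> k) = c \<otimes>\<^bsub>K\<^esub> (\<lambda>k\<in>homs X. \<xi> (E k)) k"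
        using functionalsD(4)[OF x c E(1)[OF k]] HX.smult_closed[OF c k] k
        by (simp del: hom_space_simps)
    qed (simp_all add: functionalsD(1)[OF x] E(1) del: hom_space_simps)
    moreover have "\<xi> = G_map X P i (\<lambda>k\<in>homs X. \<xi> (E k))"
    proof (rule extensionalityI[of _ "homs P"])
      fix h assume h: "h \<in> homs P"
      have "\<xi> (E (compose (carrier X) h i)) = \<xi> h"
        by (rule ag[OF E(1)[OF ci[OF h]] h E(2)[OF ci[OF h]]])
      then show "\<xi> h = G_map X P i (\<lambda>k\<in>homs X. \<xi> (E k)) h"
        unfolding G_map_def using h ci[OF h] by (simp del: hom_space_simps)
    qed (use functionalsD(5)[OF x] in \<open>simp_all add: G_map_def del: hom_space_simps\<close>)
    ultimately show "\<xi> \<in> G_map X P i ` carrier (G X)"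
      unfolding G_simps(1) by - (rule image_eqI[of _ "G_map X P i"], assumption+)
  next
    assume "\<xi> \<in> G_map X P i ` carrier (G X)"
    then obtain \<zeta> where \<zeta>: "\<zeta> \<in> functionals K ?HX" "\<xi> = G_map X P i \<zeta>" unfolding G_simps(1) by (elim imageE)
    have "compose (carrier X) h (\<lambda>x. p (i x)) = \<zero>\<^bsub>?HX\<^esub>" if h: "h \<in> homs W" for h
      unfolding compose_def hom_space_simps
      by (rule restrict_ext) (simp add: S(9) hom_zero[OF S(3) T homsD(1)[OF h]])
    then show "G_map P W p \<xi> = \<zero>\<^bsub>G W\<^esub>"
      unfolding \<zeta>(2) G_map_comp[OF S(1,2,4,6), symmetric] unfolding G_map_def G_simps(2)
      by (intro restrict_ext) (simp add: HX.functional_zero[OF \<zeta>(1)] del: hom_space_simps)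
  qed
  show ?thesis unfolding ses_def
    using GF Gi Gp inj surj exact rmod_homD(1)[OF Gp] by blast
qed

text \<open>By reflexivity the transpose of \<open>\<chi>\<close> sends each \<open>h : Y \<rightarrow> T\<close> to some \<open>c(h) : X \<rightarrow> T\<close>, and \<open>c\<close> commutes with the
  action of \<open>B\<close>. If \<open>1\<^sub>Y = \<Sum> g\<^sub>i f\<^sub>i\<close> with \<open>f\<^sub>i : Y \<rightarrow> T\<close> and \<open>g\<^sub>i : T \<rightarrow> Y\<close>, then
  \<open>c(h) = c(\<Sum> (h g\<^sub>i) f\<^sub>i) = h \<Sum> g\<^sub>i c(f\<^sub>i)\<close>, so \<open>k = \<Sum> g\<^sub>i c(f\<^sub>i)\<close>.\<close>
lemma G_full:
  assumes X: "fd_right_module K A X" and Y: "in_add K A Y T" and \<chi>: "\<chi> \<in> rmod_hom K B (G X) (G Y)"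
  obtains k where "k \<in> rmod_hom K A X Y"
    "\<And>\<xi> h. \<xi> \<in> carrier (G X) \<Longrightarrow> h \<in> homs Y \<Longrightarrow> \<chi> \<xi> h = \<xi> (compose (carrier X) h k)"
proof -
  note YF = in_addD(1)[OF Y]
  let ?HX = "hom_space K A X T" and ?HY = "hom_space K A Y T"
  interpret HX: vectorspace K ?HX by (rule hom_space_vectorspace[OF X T])
  interpret HY: vectorspace K ?HY by (rule hom_space_vectorspace[OF YF T])
  note fdX = hom_space_fin_dim[OF X T]
  have \<chi>D: "\<chi> \<xi> \<in> functionals K ?HY" if "\<xi> \<in> functionals K ?HX" for \<xi>
    using rmod_homD(1)[OF \<chi>, of \<xi>] that by (simp add: G_simps(1))
  have "\<exists>c\<in>homs X. \<forall>\<xi>\<in>functionals K ?HX. \<chi> \<xi> h = \<xi> c" if h: "h \<in> homs Y" for h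
  proof -
    let ?F = "\<lambda>\<xi>\<in>functionals K ?HX. \<chi> \<xi> h"
    have "?F \<in> functionals K (dual_space K ?HX)"
    proof (rule functionalsI, unfold dual_space_simps)
      fix \<xi> \<eta> assume x: "\<xi> \<in> functionals K ?HX" "\<eta> \<in> functionals K ?HX"
      have "\<chi> (\<lambda>k\<in>homs X. \<xi> k \<oplus>\<^bsub>K\<^esub> \<eta> k) h = \<chi> \<xi> h \<oplus>\<^bsub>K\<^esub> \<chi> \<eta> h"
        using rmod_homD(2)[OF \<chi>, of \<xi> \<eta>] x h by (simp add: G_simps(1,3) del: hom_space_simps)
      then show "?F (\<lambda>k\<in>homs X. \<xi> k \<oplus>\<^bsub>K\<^esub> \<eta> k) = ?F \<xi> \<oplus>\<^bsub>K\<^esub> ?F \<eta>"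
        using x HX.dual_add_closed[OF x] by (simp del: hom_space_simps)
    next
      fix c \<xi> assume c: "c \<in> carrier K" and x: "\<xi> \<in> functionals K ?HX"
      have "\<chi> (\<lambda>k\<in>homs X. c \<otimes>\<^bsub>K\<^esub> \<xi> k) h = c \<otimes>\<^bsub>K\<^esub> \<chi> \<xi> h"
        using rmod_homD(3)[OF \<chi> c, of \<xi>] x h by (simp add: G_simps(1,4) del: hom_space_simps)
      then show "?F (\<lambda>k\<in>homs X. c \<otimes>\<^bsub>K\<^esub> \<xi> k) = c \<otimes>\<^bsub>K\<^esub> ?F \<xi>"
        using x HX.dual_smult_closed[OF c x] by (simp del: hom_space_simps)
    qed (use functionalsD(1)[OF \<chi>D h] in \<open>simp_all del: hom_space_simps\<close>)
    then obtain c where c: "c \<in> homs X" "\<And>\<xi>. \<xi> \<in> functionals K ?HX \<Longrightarrow> ?F \<xi> = \<xi> c"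
      by (rule HX.dual_space_reflexive[OF fdX]) (rule that, assumption, simp)
    then show ?thesis by (intro bexI[OF _ c(1)] ballI) (use c(2) in \<open>simp del: hom_space_simps\<close>)
  qed
  then obtain c where c: "\<And>h. h \<in> homs Y \<Longrightarrow> c h \<in> homs X"
    "\<And>h \<xi>. h \<in> homs Y \<Longrightarrow> \<xi> \<in> functionals K ?HX \<Longrightarrow> \<chi> \<xi> h = \<xi> (c h)" by metis
  have c_add: "c (h \<oplus>\<^bsub>?HY\<^esub> h') = c h \<oplus>\<^bsub>?HX\<^esub> c h'" if h: "h \<in> homs Y" "h' \<in> homs Y" for h h'
  proof (rule HX.functionals_separate[OF fdX c(1)[OF HY.M.a_closed[OF h]] HX.M.a_closed[OF c(1)[OF h(1)] c(1)[OF h(2)]]])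
    fix \<xi> assume x: "\<xi> \<in> functionals K ?HX"
    show "\<xi> (c (h \<oplus>\<^bsub>?HY\<^esub> h')) = \<xi> (c h \<oplus>\<^bsub>?HX\<^esub> c h')"
      using functionalsD(3)[OF \<chi>D[OF x] h] functionalsD(3)[OF x c(1)[OF h(1)] c(1)[OF h(2)]]
        c(2)[OF HY.M.a_closed[OF h] x] c(2)[OF h(1) x] c(2)[OF h(2) x] by metis
  qed
  have c_comp: "c (compose (carrier Y) b h) = compose (carrier X) b (c h)" if b: "b \<in> carrier B" and h: "h \<in> homs Y" for b h
  proof (rule HX.functionals_separate[OF fdX])
    have bh: "compose (carrier Y) b h \<in> homs Y"
      using b by (intro compose_homs[OF YF homsD(1)[OF h]]) simp
    show "c (compose (carrier Y) b h) \<in> homs X" by (rule c(1)[OF bh])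
    show bc: "compose (carrier X) b (c h) \<in> homs X"
      using b by (intro compose_homs[OF X homsD(1)[OF c(1)[OF h]]]) simp
    fix \<xi> assume x: "\<xi> \<in> functionals K ?HX"
    have xb: "\<xi> \<cdot>\<^bsub>G X\<^esub> b \<in> functionals K ?HX"
      using fdm_closed(5)[OF G_fdm[OF X] _ b, of \<xi>] x by (simp add: G_simps(1))
    have "\<xi> (c (compose (carrier Y) b h)) = (\<chi> \<xi> \<cdot>\<^bsub>G Y\<^esub> b) h"
      using c(2)[OF bh x] h by (simp add: G_simps(5) del: hom_space_simps)
    also have "\<dots> = \<chi> (\<xi> \<cdot>\<^bsub>G X\<^esub> b) h" using rmod_homD(4)[OF \<chi>, of \<xi> b] x b by (simp add: G_simps(1))
    also have "\<dots> = (\<xi> \<cdot>\<^bsub>G X\<^esub> b) (c h)" by (rule c(2)[OF h xb])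
    also have "\<dots> = \<xi> (compose (carrier X) b (c h))" using c(1)[OF h] by (simp add: G_simps(5) del: hom_space_simps)
    finally show "\<xi> (c (compose (carrier Y) b h)) = \<xi> (compose (carrier X) b (c h))" .
  qed
  have "\<exists>k\<in>rmod_hom K A X Y. \<forall>h\<in>homs Y. c (compose (carrier Y) h \<phi>) = compose (carrier X) h k"
    if "\<phi> \<in> factor_thru K A T Y Y" for \<phi>
    using that
  proof induction
    case (comp f g)
    let ?f = "restrict f (carrier Y)"
    have f: "?f \<in> homs Y" by (rule restrict_hom[OF YF comp(1)])
    have gc: "(\<lambda>x. g (c ?f x)) \<in> rmod_hom K A X Y" by (rule hom_comp[OF homsD(1)[OF c(1)[OF f]] comp(2)])
    have "c (compose (carrier Y) h (\<lambda>x. g (f x))) = compose (carrier X) h (\<lambda>x. g (c ?f x))" if h: "h \<in> homs Y" for h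
    proof -
      let ?b = "compose (carrier T) h g"
      have b: "?b \<in> carrier B" using compose_homs[OF T comp(2) homsD(1)[OF h]] by simp
      have "compose (carrier Y) h (\<lambda>x. g (f x)) = compose (carrier Y) ?b ?f"
        unfolding compose_def by (rule restrict_ext) (simp add: rmod_homD(1)[OF comp(1)])
      then have "c (compose (carrier Y) h (\<lambda>x. g (f x))) = compose (carrier X) ?b (c ?f)" using c_comp[OF b f] by simp
      also have "\<dots> = compose (carrier X) h (\<lambda>x. g (c ?f x))"
        unfolding compose_def by (rule restrict_ext) (use homsD(3)[OF c(1)[OF f]] in \<open>simp del: hom_space_simps\<close>)
      finally show ?thesis .
    qed
    then show ?case by (intro bexI[OF _ gc] ballI)
  next
    case (add \<phi> \<psi>)
    then obtain k l where k: "k \<in> rmod_hom K A X Y" "\<And>h. h \<in> homs Y \<Longrightarrow> c (compose (carrier Y) h \<phi>) = compose (carrier X) h k"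
      and l: "l \<in> rmod_hom K A X Y" "\<And>h. h \<in> homs Y \<Longrightarrow> c (compose (carrier Y) h \<psi>) = compose (carrier X) h l" by metis
    note \<phi>h = factor_thru_hom[OF add.hyps(1) YF YF] and \<psi>h = factor_thru_hom[OF add.hyps(2) YF YF]
    have "c (compose (carrier Y) h (\<lambda>x. \<phi> x \<oplus>\<^bsub>Y\<^esub> \<psi> x)) = compose (carrier X) h (\<lambda>x. k x \<oplus>\<^bsub>Y\<^esub> l x)" if h: "h \<in> homs Y" for h
    proof -
      have "compose (carrier Y) h (\<lambda>x. \<phi> x \<oplus>\<^bsub>Y\<^esub> \<psi> x) = compose (carrier Y) h \<phi> \<oplus>\<^bsub>?HY\<^esub> compose (carrier Y) h \<psi>"
        unfolding compose_def hom_space_simps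
        by (rule restrict_ext) (simp add: rmod_homD(2)[OF homsD(1)[OF h]] rmod_homD(1)[OF \<phi>h] rmod_homD(1)[OF \<psi>h])
      moreover have "compose (carrier X) h (\<lambda>x. k x \<oplus>\<^bsub>Y\<^esub> l x) = compose (carrier X) h k \<oplus>\<^bsub>?HX\<^esub> compose (carrier X) h l"
        unfolding compose_def hom_space_simps
        by (rule restrict_ext) (simp add: rmod_homD(2)[OF homsD(1)[OF h]] rmod_homD(1)[OF k(1)] rmod_homD(1)[OF l(1)])
      ultimately show ?thesis
        using c_add[OF compose_homs[OF YF \<phi>h homsD(1)[OF h]] compose_homs[OF YF \<psi>h homsD(1)[OF h]]] k(2)[OF h] l(2)[OF h]
        by metis
    qed
    then show ?case by (intro bexI[OF _ hom_add[OF YF k(1) l(1)]] ballI)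
  next
    case (cong \<phi> \<psi>)
    have "compose (carrier Y) h \<psi> = compose (carrier Y) h \<phi>" for h :: "'c \<Rightarrow> 't"
      unfolding compose_def by (rule restrict_ext) (simp add: cong.hyps(2))
    then show ?case using cong.IH by metis
  qed
  from this[OF in_addD(3)[OF Y]] obtain k where k: "k \<in> rmod_hom K A X Y"
    "\<And>h. h \<in> homs Y \<Longrightarrow> c (compose (carrier Y) h (\<lambda>x. x)) = compose (carrier X) h k" by metis
  show thesis
  proof (rule that[OF k(1)])
    fix \<xi> h assume x: "\<xi> \<in> carrier (G X)" and h: "h \<in> homs Y"
    have "compose (carrier Y) h (\<lambda>x. x) = h"
      using extensional_restrict[OF homsD(2)[OF h]] by (simp only: compose_def)
    then show "\<chi> \<xi> h = \<xi> (compose (carrier X) h k)" using k(2)[OF h] c(2)[OF h] x unfolding G_simps(1) by metis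
  qed
qed

section \<open>Dominant dimension of the endomorphism algebra\<close>

text \<open>The modules \<open>G(A)\<close> and \<open>Hom\<^sub>A(T, D(A))\<close> are isomorphic: \<open>to_dual \<xi>\<close> is the homomorphism that corresponds to \<open>\<xi>\<close>, and
  \<open>from_hom v b\<close> corresponds to \<open>v \<circ> b\<close>. In these terms, composition with homomorphisms between \<open>T\<close> and \<open>D(A)\<close>
  leads back and forth between \<open>G(A)\<close> and \<open>Hom\<^sub>A(T, T) = B\<close>.\<close>
definition translate :: "'t \<Rightarrow> 'a \<Rightarrow> 't"
  where "translate t = (\<lambda>x\<in>carrier A. t \<cdot>\<^bsub>T\<^esub> x)"

definition to_dual :: "(('a \<Rightarrow> 't) \<Rightarrow> 'k) \<Rightarrow> 't \<Rightarrow> 'a \<Rightarrow> 'k"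
  where "to_dual \<xi> t = (\<lambda>a\<in>carrier A. \<xi> (translate (t \<cdot>\<^bsub>T\<^esub> a)))"

lemma translate_homs: "t \<in> carrier T \<Longrightarrow> translate t \<in> homs (regular_module A)"
  unfolding translate_def
  using restrict_hom[OF regular_module_fdm[OF fd_right_module.fd_algebra[OF T]] hom_from_regular[OF T]]
  by simp

lemma translate_hom:
  assumes h: "h \<in> homs (regular_module A)"
  shows "translate (h \<one>\<^bsub>A\<^esub>) = h"
proof -
  interpret T: fd_right_module K A T by (rule T)
  interpret A: fd_algebra K A by (rule T.fd_algebra)
  show ?thesis
    unfolding translate_def
  proof (rule extensionalityI[OF restrict_extensional])
    show "h \<in> extensional (carrier A)" using homsD(2)[OF h] by simp
    show "(\<lambda>x\<in>carrier A. h \<one>\<^bsub>A\<^esub> \<cdot>\<^bsub>T\<^esub> x) x = h x" if "x \<in> carrier A" for x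
      using rmod_homD(4)[OF homsD(1)[OF h], of "\<one>\<^bsub>A\<^esub>" x] that by simp
  qed
qed

lemma to_dual_hom:
  assumes x: "\<xi> \<in> carrier (G (regular_module A))"
  shows "to_dual \<xi> \<in> rmod_hom K A T (dual_module K A)"
proof -
  interpret T: fd_right_module K A T by (rule T)
  interpret A: fd_algebra K A by (rule T.fd_algebra)
  let ?H = "hom_space K A (regular_module A) T"
  have x: "\<xi> \<in> functionals K ?H" using x by (simp add: G_simps(1))
  note tr = translate_homs
  have tr_add: "translate (s \<oplus>\<^bsub>T\<^esub> t) = translate s \<oplus>\<^bsub>?H\<^esub> translate t" if "s \<in> carrier T" "t \<in> carrier T" for s t
    unfolding translate_def hom_space_simps regular_module_simps using that
    by (intro restrict_ext) (simp add: T.ract_add_left)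
  have tr_smult: "translate (c \<odot>\<^bsub>T\<^esub> t) = c \<odot>\<^bsub>?H\<^esub> translate t" if "c \<in> carrier K" "t \<in> carrier T" for c t
    unfolding translate_def hom_space_simps regular_module_simps using that
    by (intro restrict_ext) (simp add: T.smult_ract)
  note c = T.ract_closed and F = functionalsD(1,3,4)[OF x]
  show ?thesis
  proof (rule rmod_homI, unfold dual_module_simps)
    fix t assume t: "t \<in> carrier T"
    show "to_dual \<xi> t \<in> functionals K A" unfolding to_dual_def
      by (rule functionalsI) (simp_all add: t c T.ract_add_right T.ract_smult tr_add tr_smult tr F del: hom_space_simps)
  next
    fix s t assume "s \<in> carrier T" "t \<in> carrier T"
    then show "to_dual \<xi> (s \<oplus>\<^bsub>T\<^esub> t) = (\<lambda>x\<in>carrier A. to_dual \<xi> s x \<oplus>\<^bsub>K\<^esub> to_dual \<xi> t x)"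
      unfolding to_dual_def by (intro restrict_ext) (simp add: c T.ract_add_left tr_add tr F del: hom_space_simps)
  next
    fix k t assume "k \<in> carrier K" "t \<in> carrier T"
    then show "to_dual \<xi> (k \<odot>\<^bsub>T\<^esub> t) = (\<lambda>x\<in>carrier A. k \<otimes>\<^bsub>K\<^esub> to_dual \<xi> t x)"
      unfolding to_dual_def by (intro restrict_ext) (simp add: c T.smult_ract tr_smult tr F del: hom_space_simps)
  next
    fix t a assume "t \<in> carrier T" "a \<in> carrier A"
    then show "to_dual \<xi> (t \<cdot>\<^bsub>T\<^esub> a) = (\<lambda>x\<in>carrier A. to_dual \<xi> t (a \<otimes>\<^bsub>A\<^esub> x))"
      unfolding to_dual_def by (intro restrict_ext) (simp add: T.ract_mult)
  qed
qed

definition from_hom :: "('t \<Rightarrow> 'a \<Rightarrow> 'k) \<Rightarrow> ('t \<Rightarrow> 't) \<Rightarrow> ('a \<Rightarrow> 't) \<Rightarrow> 'k"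
  where "from_hom v b = (\<lambda>h\<in>homs (regular_module A). v (b (h \<one>\<^bsub>A\<^esub>)) \<one>\<^bsub>A\<^esub>)"

lemma from_hom_hom:
  assumes v: "v \<in> rmod_hom K A T (dual_module K A)"
  shows "from_hom v \<in> rmod_hom K B (regular_module B) (G (regular_module A))"
proof -
  interpret T: fd_right_module K A T by (rule T)
  interpret A: fd_algebra K A by (rule T.fd_algebra)
  let ?R = "regular_module A"
  let ?H = "hom_space K A ?R T"
  note RF = regular_module_fdm[OF T.fd_algebra]
  interpret H: vectorspace K ?H by (rule hom_space_vectorspace[OF RF T])
  have vF: "v t \<in> functionals K A" if "t \<in> carrier T" for t
    using rmod_homD(1)[OF v that] by (simp add: dual_module_simps)
  have h1: "h \<one>\<^bsub>A\<^esub> \<in> carrier T" if "h \<in> homs ?R" for h using homsD(3)[OF that, of "\<one>\<^bsub>A\<^esub>"] by simp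
  have v1: "v t \<one>\<^bsub>A\<^esub> \<in> carrier K" if "t \<in> carrier T" for t using functionalsD(1)[OF vF[OF that]] by simp
  have va: "v (s \<oplus>\<^bsub>T\<^esub> t) \<one>\<^bsub>A\<^esub> = v s \<one>\<^bsub>A\<^esub> \<oplus>\<^bsub>K\<^esub> v t \<one>\<^bsub>A\<^esub>" if "s \<in> carrier T" "t \<in> carrier T" for s t
    using rmod_homD(2)[OF v that] by (simp add: dual_module_simps)
  have vs: "v (k \<odot>\<^bsub>T\<^esub> t) \<one>\<^bsub>A\<^esub> = k \<otimes>\<^bsub>K\<^esub> v t \<one>\<^bsub>A\<^esub>" if "k \<in> carrier K" "t \<in> carrier T" for k t
    using rmod_homD(3)[OF v that] by (simp add: dual_module_simps)
  have bh: "b \<in> rmod_hom K A T T" if "b \<in> carrier B" for b using that by simp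
  have ha: "(h \<oplus>\<^bsub>?H\<^esub> h') \<one>\<^bsub>A\<^esub> = h \<one>\<^bsub>A\<^esub> \<oplus>\<^bsub>T\<^esub> h' \<one>\<^bsub>A\<^esub>" and hs: "(k \<odot>\<^bsub>?H\<^esub> h) \<one>\<^bsub>A\<^esub> = k \<odot>\<^bsub>T\<^esub> h \<one>\<^bsub>A\<^esub>" for h h' k
    by simp_all
  show ?thesis
  proof (rule rmod_homI, unfold G_simps regular_module_simps)
    fix b assume "b \<in> carrier B"
    note bD = rmod_homD(1-3)[OF bh[OF this]]
    show "from_hom v b \<in> functionals K ?H" unfolding from_hom_def
      by (rule functionalsI)
        (simp_all add: h1 v1 va vs bD ha hs H.M.a_closed H.smult_closed del: hom_space_simps)
  next
    fix b b' assume b: "b \<in> carrier B" "b' \<in> carrier B"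
    note bD = rmod_homD(1)[OF bh[OF b(1)]] rmod_homD(1)[OF bh[OF b(2)]]
    show "from_hom v (b \<oplus>\<^bsub>B\<^esub> b') = (\<lambda>h\<in>homs ?R. from_hom v b h \<oplus>\<^bsub>K\<^esub> from_hom v b' h)"
      unfolding from_hom_def End_algebra_simps(5)
      by (rule restrict_ext) (simp add: h1 va bD del: hom_space_simps)
    have "compose (carrier A) b' h \<in> homs ?R" if "h \<in> homs ?R" for h
      using compose_homs[OF RF homsD(1)[OF that] bh[OF b(2)]] by simp
    then show "from_hom v (b \<otimes>\<^bsub>B\<^esub> b') = (\<lambda>h\<in>homs ?R. from_hom v b (compose (carrier A) b' h))"
      unfolding from_hom_def End_algebra_simps(2)
      by (intro restrict_ext) (simp add: h1 bD compose_def del: hom_space_simps)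
  next
    fix k b assume k: "k \<in> carrier K" and b: "b \<in> carrier B"
    show "from_hom v (k \<odot>\<^bsub>B\<^esub> b) = (\<lambda>h\<in>homs ?R. k \<otimes>\<^bsub>K\<^esub> from_hom v b h)"
      unfolding from_hom_def End_algebra_simps(6)
      by (rule restrict_ext) (simp add: h1 vs k rmod_homD(1)[OF bh[OF b]] del: hom_space_simps)
  qed
qed

lemma to_hom_hom:
  assumes u: "u \<in> rmod_hom K A (dual_module K A) T"
  shows "(\<lambda>\<xi>. \<lambda>t\<in>carrier T. u (to_dual \<xi> t)) \<in> rmod_hom K B (G (regular_module A)) (regular_module B)"
proof -
  interpret T: fd_right_module K A T by (rule T)
  interpret A: fd_algebra K A by (rule T.fd_algebra)
  let ?R = "regular_module A"
  let ?H = "hom_space K A ?R T"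
  note RF = regular_module_fdm[OF T.fd_algebra]
  have tD: "to_dual \<xi> t \<in> carrier (dual_module K A)" if "\<xi> \<in> carrier (G ?R)" "t \<in> carrier T" for \<xi> t
    by (rule rmod_homD(1)[OF to_dual_hom[OF that(1)] that(2)])
  note tr = translate_homs[OF T.ract_closed]
  show ?thesis
  proof (rule rmod_homI, unfold regular_module_simps)
    fix \<xi> assume x: "\<xi> \<in> carrier (G ?R)"
    show "(\<lambda>t\<in>carrier T. u (to_dual \<xi> t)) \<in> carrier B"
      using restrict_hom[OF T hom_comp[OF to_dual_hom[OF x] u]] by simp
  next
    fix \<xi> \<eta> assume x: "\<xi> \<in> carrier (G ?R)" "\<eta> \<in> carrier (G ?R)"
    have "to_dual (\<xi> \<oplus>\<^bsub>G ?R\<^esub> \<eta>) t = to_dual \<xi> t \<oplus>\<^bsub>dual_module K A\<^esub> to_dual \<eta> t" if "t \<in> carrier T" for t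
      unfolding to_dual_def dual_module_simps G_simps
      by (rule restrict_ext) (simp add: tr that del: hom_space_simps)
    then show "(\<lambda>t\<in>carrier T. u (to_dual (\<xi> \<oplus>\<^bsub>G ?R\<^esub> \<eta>) t)) =
      (\<lambda>t\<in>carrier T. u (to_dual \<xi> t)) \<oplus>\<^bsub>B\<^esub> (\<lambda>t\<in>carrier T. u (to_dual \<eta> t))"
      unfolding End_algebra_simps
      by (intro restrict_ext) (simp add: rmod_homD(2)[OF u tD[OF x(1)] tD[OF x(2)]])
  next
    fix k \<xi> assume k: "k \<in> carrier K" and x: "\<xi> \<in> carrier (G ?R)"
    have "to_dual (k \<odot>\<^bsub>G ?R\<^esub> \<xi>) t = k \<odot>\<^bsub>dual_module K A\<^esub> to_dual \<xi> t" if "t \<in> carrier T" for t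
      unfolding to_dual_def dual_module_simps G_simps
      by (rule restrict_ext) (simp add: tr that del: hom_space_simps)
    then show "(\<lambda>t\<in>carrier T. u (to_dual (k \<odot>\<^bsub>G ?R\<^esub> \<xi>) t)) = k \<odot>\<^bsub>B\<^esub> (\<lambda>t\<in>carrier T. u (to_dual \<xi> t))"
      unfolding End_algebra_simps
      by (intro restrict_ext) (simp add: rmod_homD(3)[OF u k tD[OF x]])
  next
    fix \<xi> b assume x: "\<xi> \<in> carrier (G ?R)" and b: "b \<in> carrier B"
    then have bh: "b \<in> rmod_hom K A T T" by simp
    have "to_dual (\<xi> \<cdot>\<^bsub>G ?R\<^esub> b) t = to_dual \<xi> (b t)" if t: "t \<in> carrier T" for t
    proof -
      have "compose (carrier A) b (translate s) = translate (b s)" if "s \<in> carrier T" for s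
        unfolding compose_def translate_def
        by (rule restrict_ext) (simp add: rmod_homD(4)[OF bh that])
      then show ?thesis
        unfolding to_dual_def G_simps regular_module_simps using t
        by (intro restrict_ext) (simp add: tr rmod_homD(4)[OF bh] T.ract_closed del: hom_space_simps)
    qed
    then show "(\<lambda>t\<in>carrier T. u (to_dual (\<xi> \<cdot>\<^bsub>G ?R\<^esub> b) t)) = (\<lambda>t\<in>carrier T. u (to_dual \<xi> t)) \<otimes>\<^bsub>B\<^esub> b"
      unfolding End_algebra_simps compose_def
      by (intro restrict_ext) (simp add: rmod_homD(1)[OF bh])
  qed
qed

text \<open>The functor \<open>Hom\<^sub>A(T, -)\<close> is additive, so \<open>T \<in> add(D(A))\<close> gives
  \<open>Hom\<^sub>A(T, T) \<in> add(Hom\<^sub>A(T, D(A)))\<close>; likewise for the converse direction below.\<close>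
lemma regular_in_add_G_regular:
  assumes TD: "in_add K A T (dual_module K A)"
  shows "in_add K B (regular_module B) (G (regular_module A))"
proof -
  interpret T: fd_right_module K A T by (rule T)
  interpret A: fd_algebra K A by (rule T.fd_algebra)
  let ?R = "regular_module A" and ?D = "dual_module K A"
  note RF = regular_module_fdm[OF T.fd_algebra]
  have "(\<lambda>b. \<lambda>t\<in>carrier T. \<phi> (b t)) \<in> factor_thru K B (G ?R) (regular_module B) (regular_module B)"
    if "\<phi> \<in> factor_thru K A ?D T T" for \<phi>
    using that
  proof induction
    case (comp v u)
    show ?case
    proof (rule factor_thru.cong[OF factor_thru.comp[OF from_hom_hom[OF comp(1)] to_hom_hom[OF comp(2)]]])
      fix b assume "b \<in> carrier (regular_module B)"
      then have b: "b \<in> rmod_hom K A T T" by simp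
      have "to_dual (from_hom v b) t = v (b t)" if t: "t \<in> carrier T" for t
      proof (rule extensionalityI[of _ "carrier A"])
        have vF: "v s \<in> functionals K A" if "s \<in> carrier T" for s
          using rmod_homD(1)[OF comp(1) that] by (simp add: dual_module_simps)
        show "v (b t) \<in> extensional (carrier A)" by (rule functionalsD(5)[OF vF[OF rmod_homD(1)[OF b t]]])
        show "to_dual (from_hom v b) t \<in> extensional (carrier A)" by (simp add: to_dual_def)
        fix a assume a: "a \<in> carrier A"
        have ta: "t \<cdot>\<^bsub>T\<^esub> a \<in> carrier T" by (rule T.ract_closed[OF t a])
        have "to_dual (from_hom v b) t a = v (b (translate (t \<cdot>\<^bsub>T\<^esub> a) \<one>\<^bsub>A\<^esub>)) \<one>\<^bsub>A\<^esub>"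
          unfolding to_dual_def from_hom_def using a translate_homs[OF ta] by (simp del: hom_space_simps)
        also have "\<dots> = v (b t \<cdot>\<^bsub>T\<^esub> a) \<one>\<^bsub>A\<^esub>"
          using ta T.ract_one[OF ta] rmod_homD(4)[OF b t a] by (simp add: translate_def)
        also have "\<dots> = v (b t) a"
          using rmod_homD(4)[OF comp(1) rmod_homD(1)[OF b t] a] a by (simp add: dual_module_simps)
        finally show "to_dual (from_hom v b) t a = v (b t) a" .
      qed
      then show "(\<lambda>t\<in>carrier T. u (v (b t))) = (\<lambda>t\<in>carrier T. u (to_dual (from_hom v b) t))"
        by (intro restrict_ext) simp
    qed
  next
    case (add \<phi> \<psi>)
    show ?case
      by (rule factor_thru.cong[OF factor_thru.add[OF add.IH]], unfold regular_module_simps End_algebra_simps)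
        (rule restrict_ext, simp)
  next
    case (cong \<phi> \<psi>)
    show ?case
    proof (rule factor_thru.cong[OF cong.IH])
      fix b assume "b \<in> carrier (regular_module B)"
      then have b: "b \<in> rmod_hom K A T T" by simp
      show "(\<lambda>t\<in>carrier T. \<psi> (b t)) = (\<lambda>t\<in>carrier T. \<phi> (b t))"
        by (rule restrict_ext) (rule cong.hyps(2)[OF rmod_homD(1)[OF b]])
    qed
  qed
  from this[OF in_addD(3)[OF TD]]
  have "(\<lambda>b. b) \<in> factor_thru K B (G ?R) (regular_module B) (regular_module B)"
    by (rule factor_thru.cong) (simp add: extensional_restrict)
  then show ?thesis unfolding in_add_def using G_fdm[OF RF] regular_module_fdm[OF B] by blast
qed

lemma G_regular_in_add_regular:
  assumes DT: "in_add K A (dual_module K A) T"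
  shows "in_add K B (G (regular_module A)) (regular_module B)"
proof -
  interpret T: fd_right_module K A T by (rule T)
  interpret A: fd_algebra K A by (rule T.fd_algebra)
  let ?R = "regular_module A" and ?D = "dual_module K A"
  note RF = regular_module_fdm[OF T.fd_algebra]
  note DF = dual_module_fdm[OF T.fd_algebra]
  have h1: "h \<one>\<^bsub>A\<^esub> \<in> carrier T" if "h \<in> homs ?R" for h using homsD(3)[OF that, of "\<one>\<^bsub>A\<^esub>"] by simp
  have tD: "to_dual \<xi> t \<in> carrier ?D" if "\<xi> \<in> carrier (G ?R)" "t \<in> carrier T" for \<xi> t
    by (rule rmod_homD(1)[OF to_dual_hom[OF that(1)] that(2)])
  have "(\<lambda>\<xi>. \<lambda>h\<in>homs ?R. \<phi> (to_dual \<xi> (h \<one>\<^bsub>A\<^esub>)) \<one>\<^bsub>A\<^esub>) \<in> factor_thru K B (regular_module B) (G ?R) (G ?R)"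
    if "\<phi> \<in> factor_thru K A T ?D ?D" for \<phi>
    using that
  proof induction
    case (comp u v)
    show ?case
      by (rule factor_thru.cong[OF factor_thru.comp[OF to_hom_hom[OF comp(1)] from_hom_hom[OF comp(2)]]])
        (unfold from_hom_def, rule restrict_ext, simp add: h1 del: hom_space_simps)
  next
    case (add \<phi> \<psi>)
    show ?case
      by (rule factor_thru.cong[OF factor_thru.add[OF add.IH]], unfold G_simps dual_module_simps)
        (rule restrict_ext, simp del: hom_space_simps)
  next
    case (cong \<phi> \<psi>)
    show ?case
      by (rule factor_thru.cong[OF cong.IH], rule restrict_ext)
        (simp add: cong.hyps(2) tD h1 del: hom_space_simps)
  qed
  from this[OF in_addD(3)[OF DT]]
  have "(\<lambda>\<xi>. \<xi>) \<in> factor_thru K B (regular_module B) (G ?R) (G ?R)"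
  proof (rule factor_thru.cong)
    fix \<xi> assume "\<xi> \<in> carrier (G ?R)"
    then have x: "\<xi> \<in> functionals K (hom_space K A ?R T)" by (simp add: G_simps(1))
    show "\<xi> = (\<lambda>h\<in>homs ?R. to_dual \<xi> (h \<one>\<^bsub>A\<^esub>) \<one>\<^bsub>A\<^esub>)"
      using functionalsD(5)[OF x]
      by (intro extensionalityI[of _ "homs ?R"])
        (simp_all add: to_dual_def T.ract_one h1 translate_hom del: hom_space_simps)
  qed
  then show ?thesis unfolding in_add_def using G_fdm[OF RF] regular_module_fdm[OF B] by blast
qed

lemma T_cogenerates:
  assumes DT: "in_add K A (dual_module K A) T" and Z: "fd_right_module K A Z"
    and z: "z \<in> carrier Z" "z' \<in> carrier Z" and eq: "\<And>h. h \<in> homs Z \<Longrightarrow> h z = h z'"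
  shows "z = z'"
proof -
  interpret T: fd_right_module K A T by (rule T)
  let ?D = "dual_module K A"
  note DF = dual_module_fdm[OF T.fd_algebra]
  have fe: "\<phi> z = \<phi> z'" if "\<phi> \<in> factor_thru K A T Z ?D" for \<phi>
    using that
  proof induction
    case (comp f g)
    then show ?case using eq[OF restrict_hom[OF Z comp(1)]] z by simp
  qed (use z in simp_all)
  have "f (z \<ominus>\<^bsub>Z\<^esub> z') = \<zero>\<^bsub>?D\<^esub>" if f: "f \<in> rmod_hom K A Z ?D" for f
    using fe[OF factor_thru_pre[OF in_addD(3)[OF DT] f]] hom_minus[OF Z DF f z] fdm_diff_eq_zero[OF DF]
      rmod_homD(1)[OF f] z by simp
  then have "z \<ominus>\<^bsub>Z\<^esub> z' = \<zero>\<^bsub>Z\<^esub>"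
    using dual_module_cogenerates[OF Z fdm_closed(3)[OF Z z]] by metis
  then show ?thesis using fdm_diff_eq_zero[OF Z z] by simp
qed

text \<open>The terms of a minimal resolution \<open>J\<close> of \<open>B\<close> are summands of sums of copies of the terms \<open>G (I i)\<close>, which
  settles the projectivity of the first \<open>n\<close> of them. For the term of degree \<open>n\<close> both resolutions are split.\<close>
lemma domdim_End:
  assumes TD: "in_add K A T (dual_module K A)" and DT: "in_add K A (dual_module K A) T"
    and min: "minimal_injective_resolution K A (regular_module A) e I d" and n: "n \<ge> 1"
    and proj: "\<And>i. i < n \<Longrightarrow> projective_module K A (I i)" and nproj: "\<not> projective_module K A (I n)"
    and zero: "carrier (I (Suc n)) = {\<zero>\<^bsub>I (Suc n)\<^esub>}"
  shows "algebra_domdim K B = enat n"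
proof -
  interpret T: fd_right_module K A T by (rule T)
  let ?R = "regular_module A" and ?D = "dual_module K A" and ?RB = "regular_module B"
  note RF = regular_module_fdm[OF T.fd_algebra] and RBF = regular_module_fdm[OF B]
  have TI: "injective_module K A T" by (rule in_add_injective[OF TD dual_module_injective[OF T.fd_algebra]])
  have r: "injective_resolution K A ?R e I d" using min by (simp add: minimal_injective_resolution_def)
  note R = resolutionD[OF r] and s = resolution_ses[OF r]
  let ?Z = "cycles I d"
  have IT: "in_add K A (I i) T" for i by (rule in_add_trans[OF injective_in_add_dual[OF R(2)] DT])
  note RG = regular_in_add_G_regular[OF TD] and GR = G_regular_in_add_regular[OF DT]
  note Gs = G_ses[OF s TI]
  have GI: "injective_module K B (G (I i))" for i
    by (rule in_add_injective[OF G_in_add[OF IT]]) (simp only: G_T dual_module_injective[OF B])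
  have GP: "projective_module K B (G (I i))" if "i < n" for i
    by (rule in_add_projective[OF in_add_trans[OF G_in_add[OF projective_in_add_regular[OF proj[OF that]]] GR]
          regular_module_projective[OF B]])
  obtain J :: "nat \<Rightarrow> ('k, 't \<Rightarrow> 't) fd_mod" and e' d' where J: "minimal_injective_resolution K B ?RB e' J d'"
    using ex_minimal_injective_resolution[OF RBF] by blast
  have rJ: "injective_resolution K B ?RB e' J d'" using J by (simp add: minimal_injective_resolution_def)
  note RJ = resolutionD[OF rJ] and sJ = resolution_ses[OF rJ]
  let ?ZJ = "cycles J d'"
  have JG: "in_add K B (J i) (G (I i))" for i
    by (rule minimal_terms_in_add[where Z = "\<lambda>i. G (?Z i)" and I = "\<lambda>i. G (I i)", OF J Gs GI])
      (rule in_add_trans[OF RG G_in_add[OF cycles_in_add(1)[OF r]]])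
  have JP: "projective_module K B (J i)" if "i < n" for i by (rule in_add_projective[OF JG GP[OF that]])
  have J0: "carrier (J (Suc n)) = {\<zero>\<^bsub>J (Suc n)\<^esub>}"
    by (rule in_add_zero[OF JG G_zero[OF R(3) zero]])
  have "\<not> projective_module K B (J n)"
  proof
    assume JPn: "projective_module K B (J n)"
    \<comment> \<open>With \<open>J n\<close> all earlier cosyzygies of \<open>B\<close> are projective, as the resolution splits from the right.\<close>
    have "projective_module K B (?ZJ (n - k))" if "k \<le> n" for k
      using that
    proof (induction k)
      case 0
      have c: "carrier (?ZJ (Suc n)) = {\<zero>\<^bsub>?ZJ (Suc n)\<^esub>}"
        using fdm_closed(1)[OF sesD(3)[OF sJ[of n]]] J0 by (auto simp: cycles_def rmod_ker_def)
      have "in_add K B (?ZJ (Suc n)) ?RB" unfolding in_add_def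
        using sesD(3)[OF sJ[of n]] RBF factor_thru.cong[OF factor_thru_zero[OF RBF sesD(3)[OF sJ[of n]]], of "?ZJ (Suc n)" "\<lambda>x. x"] c
        by simp
      then have "projective_module K B (?ZJ (Suc n))" by (rule in_add_projective[OF _ regular_module_projective[OF B]])
      then show ?case using in_add_projective[OF ses_split_projective[OF sJ] JPn] by simp
    next
      case (Suc k)
      have eq: "Suc (n - Suc k) = n - k" using Suc.prems by simp
      have "in_add K B (?ZJ (n - Suc k)) (J (n - Suc k))"
        by (rule ses_split_projective[OF sJ]) (use Suc in \<open>simp add: eq\<close>)
      then show ?case by (rule in_add_projective[OF _ JP]) (use Suc.prems in simp)
    qed
    from this[of "n - 1"] have "projective_module K B (?ZJ 1)" using n by simp
    then have "in_add K B (?ZJ 0) (J 0)" using ses_split_projective[OF sJ[of 0]] by simp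
    then have "injective_module K B ?RB"
      using in_add_injective[OF in_add_trans[OF cycles_in_add(1)[OF rJ]] RJ(2)] by blast
    \<comment> \<open>As \<open>G(A)\<close> is in \<open>add(B)\<close>, the image of the resolution of \<open>A\<close> splits from the left.\<close>
    then have "injective_module K B (G (?Z 0))"
      by (rule in_add_injective[OF in_add_trans[OF G_in_add[OF cycles_in_add(2)[OF r]] GR]])
    then have GZ: "injective_module K B (G (?Z i))" for i
      by (induction i) (use in_add_injective[OF ses_split_injective(1)[OF Gs] GI] in blast)+
    obtain m where m: "n = Suc m" using n by (cases n) auto
    note S = sesD[OF s[of m]]
    obtain \<rho> where \<rho>: "\<rho> \<in> rmod_hom K B (G (?Z n)) (G (I m))"
      "\<And>\<xi>. \<xi> \<in> carrier (G (?Z n)) \<Longrightarrow> G_map (I m) (?Z n) (d m) (\<rho> \<xi>) = \<xi>"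
      using ses_split_injective(2)[OF Gs[of m] GZ] unfolding m by blast
    note ZF = S(3)[folded m] and dh = S(6)[folded m]
    \<comment> \<open>By fullness the section of \<open>G(I\<^bsub>n-1\<^esub>) \<rightarrow> G(I\<^sub>n)\<close> comes from a section of \<open>I\<^bsub>n-1\<^esub> \<rightarrow> I\<^sub>n\<close>.\<close>
    obtain k where k: "k \<in> rmod_hom K A (?Z n) (I m)"
      "\<And>\<xi> h. \<xi> \<in> carrier (G (?Z n)) \<Longrightarrow> h \<in> homs (I m) \<Longrightarrow> \<rho> \<xi> h = \<xi> (compose (carrier (?Z n)) h k)"
      by (rule G_full[OF ZF IT \<rho>(1)]) (rule that, assumption, simp del: hom_space_simps)
    interpret H: vectorspace K "hom_space K A (?Z n) T" by (rule hom_space_vectorspace[OF ZF T])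
    have dk: "(\<lambda>z. d m (k z)) \<in> rmod_hom K A (?Z n) (?Z n)" by (rule hom_comp[OF k(1) dh])
    have hh: "compose (carrier (?Z n)) h (\<lambda>z. d m (k z)) = h" if h: "h \<in> homs (?Z n)" for h
    proof (rule H.functionals_separate[OF hom_space_fin_dim[OF ZF T] compose_homs[OF ZF dk homsD(1)[OF h]] h])
      fix \<xi> assume "\<xi> \<in> functionals K (hom_space K A (?Z n) T)"
      then have x: "\<xi> \<in> carrier (G (?Z n))" by (simp add: G_simps(1))
      have hd: "compose (carrier (I m)) h (d m) \<in> homs (I m)" by (rule compose_homs[OF S(2) dh homsD(1)[OF h]])
      have "compose (carrier (?Z n)) (compose (carrier (I m)) h (d m)) k = compose (carrier (?Z n)) h (\<lambda>z. d m (k z))"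
        unfolding compose_def by (rule restrict_ext) (simp add: rmod_homD(1)[OF k(1)])
      then have "\<xi> (compose (carrier (?Z n)) h (\<lambda>z. d m (k z))) = \<rho> \<xi> (compose (carrier (I m)) h (d m))"
        using k(2)[OF x hd] by simp
      also have "\<dots> = G_map (I m) (?Z n) (d m) (\<rho> \<xi>) h" using h by (simp add: G_map_def del: hom_space_simps)
      finally show "\<xi> (compose (carrier (?Z n)) h (\<lambda>z. d m (k z))) = \<xi> h" using \<rho>(2)[OF x] by simp
    qed
    have dkz: "d m (k z) = z" if z: "z \<in> carrier (?Z n)" for z
    proof (rule T_cogenerates[OF DT ZF rmod_homD(1)[OF dk z] z])
      fix h assume "h \<in> homs (?Z n)"
      from fun_cong[OF hh[OF this], of z] z show "h (d m (k z)) = h z" by (simp add: compose_def)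
    qed
    have "in_add K A (?Z n) (I m)" by (rule in_add_retract[OF ZF S(2) k(1) dh]) (rule dkz)
    then have "projective_module K A (?Z n)" by (rule in_add_projective) (rule proj, simp add: m)
    then show False using nproj unfolding cycles_before_zero[OF r zero] by simp
  qed
  then show ?thesis unfolding algebra_domdim_def using domdim_eq_iff[OF J n] JP by blast
qed

end

lemma ses_cokernel_unique:
  assumes s: "ses K A Y P W i p" and s': "ses K A Y P W' i p'"
  shows "in_add K A W W'"
proof -
  note S = sesD[OF s] and S' = sesD[OF s']
  obtain f where f: "f \<in> rmod_hom K A W W'" "\<And>x. x \<in> carrier P \<Longrightarrow> f (p x) = p' x"
    by (rule ses_factor[OF s S'(3,6)]) (rule S'(9), assumption, rule that, assumption, simp)
  obtain g where g: "g \<in> rmod_hom K A W' W" "\<And>x. x \<in> carrier P \<Longrightarrow> g (p' x) = p x"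
    by (rule ses_factor[OF s' S(3,6)]) (rule S(9), assumption, rule that, assumption, simp)
  show ?thesis
  proof (rule in_add_retract[OF S(3) S'(3) f(1) g(1)])
    fix w assume "w \<in> carrier W"
    then have "w \<in> p ` carrier P" using S(7) by simp
    then show "g (f w) = w" by (elim imageE) (simp add: f(2) g(2))
  qed
qed

theorem theorem3p3:
  fixes K :: "'k ring" and A :: "('k, 'a) module" and n :: nat
    and e :: "'a \<Rightarrow> 'm" and I :: "nat \<Rightarrow> ('k, 'a, 'm) rmodule" and d :: "nat \<Rightarrow> 'm \<Rightarrow> 'm"
  assumes "fd_algebra K A"
    and "basic_algebra K A"
    and "connected_algebra A"
    and "\<not> semisimple_algebra K A"
    and "algebra_domdim K A = enat n"
    and "n \<ge> 2"
    and "Gdim K A = algebra_domdim K A"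
    and "minimal_injective_resolution K A (regular_module A) e I d"
  shows "algebra_domdim K (End_algebra K A (rmod_sum (I 0) (cosyzygy I d n))) = enat n"
proof -
  note A = assms(1) and n = assms(6) and min = assms(8)
  let ?R = "regular_module A" and ?D = "dual_module K A"
  have r: "injective_resolution K A ?R e I d" using min by (simp add: minimal_injective_resolution_def)
  note R = resolutionD[OF r] and s = resolution_ses[OF r]
  have proj: "\<And>i. i < n \<Longrightarrow> projective_module K A (I i)" and nproj: "\<not> projective_module K A (I n)"
    using domdim_eq_iff[OF min, of n] n assms(5) unfolding algebra_domdim_def by auto
  have id: "injdim K A ?R = enat n" and pd: "projdim K A ?D = enat n"
    using assms(5,7) unfolding Gdim_def gorenstein_algebra_def by (auto split: if_splits)
  have zero: "carrier (I (Suc n)) = {\<zero>\<^bsub>I (Suc n)\<^esub>}" by (rule injdim_minimal_resolution[OF min id]) simp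
  let ?C = "cosyzygy I d n"
  obtain m where m: "n = Suc (Suc m)" using n by (metis One_nat_def Suc_le_D Suc_1 Suc_le_mono)
  \<comment> \<open>\<open>\<Omega>\<^bsup>-n\<^esup>(A)\<close> and the image of \<open>d (n - 1)\<close> are both cokernels of \<open>I (n - 2) \<rightarrow> I (n - 1)\<close>.\<close>
  have "ses K A (cycles I d (Suc m)) (I (Suc m)) ?C (\<lambda>x. x) (\<lambda>x. carrier (cycles I d (Suc m)) +>\<^bsub>I (Suc m)\<^esub> x)"
    using ses_cokernel[OF sesD(1,2,4,5)[OF s[of "Suc m"]]] sesD(7)[OF s[of m]] unfolding cosyzygy_def m by simp
  from ses_cokernel_unique[OF this s] ses_cokernel_unique[OF s this]
  have C: "in_add K A ?C (cycles I d n)" "in_add K A (cycles I d n) ?C" unfolding m by auto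
  have Zn: "cycles I d n = I n" by (rule cycles_before_zero[OF r zero])
  let ?T = "rmod_sum (I 0) ?C"
  note CF = in_addD(1)[OF C(1)]
  note T = rmod_sum_fdm[OF R(3)[of 0] CF] and h = rmod_sum_homs[OF R(3)[of 0] CF]
  have TD: "in_add K A ?T ?D"
    by (rule in_add_sum[OF injective_in_add_dual[OF R(2)] in_add_trans[OF C(1)[unfolded Zn] injective_in_add_dual[OF R(2)]]])
  have IT: "in_add K A (I 0) ?T" by (rule in_add_retract[OF R(3) T h(3,1)]) simp
  have CT: "in_add K A ?C ?T" by (rule in_add_retract[OF CF T h(4,2)]) simp
  interpret co: injective_coresolution K A "cycles I d" I "\<lambda>i x. x" d
    by (rule injective_coresolution.intro) (rule s, rule R(2))
  have DT: "in_add K A ?D ?T"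
    by (rule co.dual_in_add[OF A _ proj resolution_start[OF r, unfolded regular_module_simps] pd in_add_trans[OF C(2) CT] IT])
      (use n in simp)
  interpret endomorphism_functor K A ?T by (rule endomorphism_functor.intro[OF T])
  show ?thesis by (rule domdim_End[OF TD DT min _ proj nproj zero]) (use n in simp)
qed

end
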